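(* Let $0\le k<n$ be integers and put $q^*=\frac{2n^2}{(n-k)(2n-1)}$. Let $1<p\le q<\infty$ and $\varepsilon>0$. (i) If $q\le q^*p$, there exist positive constants $C=C(p,q,k,n)$ and $C'=C'(p,q,k,n,\varepsilon)$ such that for all $\delta\in(0,1)$ $$C'\,\delta^{\frac{k-n}{2np}+\varepsilon}\ \le\ \|M^k_\delta\|_{L^p\to L^q}\ \le\ C\,\delta^{\frac{k-n}{2np}}.$$ (ii) If $q>q^*p$, then $$\|M^k_\delta\|_{L^p\to L^q}\approx \delta^{\frac nq-\frac{n-k}{p}}\qquad\text{for all }\delta\in(0,1),$$ that is, there are positive constants $c,c'$ depending only on $p,q,k,n$ (not on $\delta$) such that $c'\,\delta^{\frac nq-\frac{n-k}{p}}\le \|M^k_\delta\|_{L^p\to L^q}\le c\,\delta^{\frac nq-\frac{n-k}{p}}$ for all $\delta\in(0,1)$.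
   Context: For $x\in\mathbb{R}^n$ and $r>0$, the $k$-skeleton $S_k(x,r)$ is the $k$-dimensional boundary (the union of all $k$-dimensional faces) of the $n$-dimensional cube with center $x$, side length $2r$ and sides parallel to the coordinate axes. It has $N=2^{n-k}\binom nk$ $k$-faces. For $0<\delta<1$, $S_{k,\delta}(x,r)$ denotes the $\delta$-neighborhood of $S_k(x,r)$, and $S^j_{k,\delta}(x,r)$, $j=1,\dots,N$, denotes the $\delta$-neighborhood of its $j$-th $k$-face. For $f\in L^1_{\rm loc}(\mathbb{R}^n)$ the $k$-skeleton maximal operator with width $\delta$ is $$M^k_\delta f(x)=\sup_{1\le r\le 2}\ \min_{1\le j\le N}\ \frac{1}{|S^j_{k,\delta}(x,r)|}\int_{S^j_{k,\delta}(x,r)}|f(y)|\,dy ,\qquad x\in\mathbb{R}^n,$$ where $|\cdot|$ is Lebesgue measure. Its norm is $$\|M^k_\delta\|_{L^p\to L^q}=\sup_{f\ne0}\frac{\|M^k_\delta f\|_{L^q(\mathbb{R}^n)}}{\|f\|_{L^p(\mathbb{R}^n)}}.$$ *)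

theory Defs
  imports "HOL-Analysis.Analysis"
begin

definition axis_cube :: "real ^ 'n \<Rightarrow> real \<Rightarrow> (real ^ 'n) set" where
  "axis_cube x r = cbox (\<chi> i. x $ i - r) (\<chi> i. x $ i + r)"

definition skeleton_faces :: "nat \<Rightarrow> real ^ 'n \<Rightarrow> real \<Rightarrow> (real ^ 'n) set set" where
  "skeleton_faces k x r = {F. F face_of axis_cube x r \<and> aff_dim F = int k}"

text \<open>The minimum in the maximal operator is taken over a finite family.\<close>

lemma finite_skeleton_faces: "finite (skeleton_faces k x r)"
  unfolding skeleton_faces_def axis_cube_def
  by (rule finite_subset[OF _ finite_polytope_faces[OF polytope_interval]]) auto

definition nbhd :: "real \<Rightarrow> (real ^ 'n) set \<Rightarrow> (real ^ 'n) set" where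
  "nbhd \<delta> S = (\<Union>y\<in>S. ball y \<delta>)"

definition average_on :: "(real ^ 'n) set \<Rightarrow> (real ^ 'n \<Rightarrow> real) \<Rightarrow> ennreal" where
  "average_on A f = (\<integral>\<^sup>+y\<in>A. ennreal \<bar>f y\<bar> \<partial>lebesgue) / emeasure lebesgue A"

text \<open>
  The operator is \<open>ennreal\<close>-valued, since the supremum over \<open>r\<close> can a priori be infinite.
\<close>

definition skeleton_maximal ::
    "nat \<Rightarrow> real \<Rightarrow> (real ^ 'n \<Rightarrow> real) \<Rightarrow> real ^ 'n \<Rightarrow> ennreal" where
  "skeleton_maximal k \<delta> f x =
     (SUP r\<in>{1..2}. Min ((\<lambda>F. average_on (nbhd \<delta> F) f) ` skeleton_faces k x r))"

text \<open>Real powers on \<open>[0, \<infinity>]\<close>; only used with exponent \<open>a > 0\<close>.\<close>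

definition ennpowr :: "ennreal \<Rightarrow> real \<Rightarrow> ennreal" where
  "ennpowr t a = (if t = \<infinity> then \<infinity> else ennreal (enn2real t powr a))"

definition Lp_norm :: "real \<Rightarrow> (real ^ 'n \<Rightarrow> ennreal) \<Rightarrow> ennreal" where
  "Lp_norm p g = ennpowr (\<integral>\<^sup>+x. ennpowr (g x) p \<partial>lebesgue) (1 / p)"

text \<open>
  The nonzero elements of \<open>L\<^sup>p\<close>, as functions: zero means zero almost everywhere, that is,
  vanishing norm.
\<close>

definition nonzero_Lp :: "real \<Rightarrow> (real ^ 'n \<Rightarrow> real) set" where
  "nonzero_Lp p = {f. f \<in> borel_measurable lebesgue \<and>
     Lp_norm p (\<lambda>x. ennreal \<bar>f x\<bar>) < \<infinity> \<and> \<not> (AE x in lebesgue. f x = 0)}"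

text \<open>
  The dimension \<open>n = CARD('n)\<close> enters through the type argument. The quotient is taken in
  \<open>ennreal\<close>; its denominator is positive and finite on \<open>nonzero_Lp p\<close>.
\<close>

definition skeleton_op_norm ::
    "'n::finite itself \<Rightarrow> nat \<Rightarrow> real \<Rightarrow> real \<Rightarrow> real \<Rightarrow> ennreal" where
  "skeleton_op_norm _ k \<delta> p q =
     (SUP f\<in>(nonzero_Lp p :: (real ^ 'n \<Rightarrow> real) set).
        Lp_norm q (skeleton_maximal k \<delta> f) / Lp_norm p (\<lambda>x. ennreal \<bar>f x\<bar>))"

definition q_star :: "nat \<Rightarrow> nat \<Rightarrow> real" where
  "q_star n k = 2 * (real n)\<^sup>2 / ((real n - real k) * (2 * real n - 1))"

end

theory Submission
  imports Defs
begin

text \<open>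
  Upper bound. By Jensen's inequality up to a constant it suffices to bound \<open>M\<close> from \<open>L\<^sup>1\<close> to
  \<open>L\<^sup>s\<close> with \<open>s = q / p\<close>. Discretise \<open>x\<close> and \<open>r\<close> at scale \<open>\<delta>\<close>. For each set \<open>I\<close> of \<open>d = n - k\<close>
  coordinates let \<open>F\<^sub>I\<close> be the mass of \<open>f\<close> in the slabs prescribed by the coordinates in \<open>I\<close>, so that
  \<open>M f (x)\<close> is at most \<open>\<delta>\<^bsup>-d\<^esup>\<close> times the maximum over \<open>r\<close> of the minimum of the \<open>F\<^sub>I\<close> over the vertices of
  the cube. The inequality of Loomis--Whitney and Finner turns \<open>\<Sum> F\<^sub>I \<le> 1\<close> for all \<open>I\<close> into
  \<open>\<Sum> g \<le> 1\<close> for a function \<open>g\<close> on \<open>\<int>\<^sup>n\<close> with \<open>(min\<^sub>I F\<^sub>I)\<^bsup>n/d\<^esup> \<le> g\<close>. If \<open>h (x) \<le> g (x + \<sigma> r)\<close> for all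
  vertices, let \<open>L\<^sub>j (x)\<close> be the sum of \<open>g\<close> over the line through \<open>x\<close> in the direction of the \<open>j\<close>-th of
  \<open>n\<close> independent main diagonals. A center is determined by a pair of opposite vertices, so
  \<open>\<Sum> h\<^sup>2 / L\<^sub>j \<le> 1\<close>, while Loomis--Whitney gives \<open>\<Sum> (\<Prod>\<^sub>j L\<^sub>j)\<^bsup>1/(n-1)\<^esup> \<le> 1\<close>; pointwise, one of these
  summands is at least \<open>h\<^bsup>2n/(2n-1)\<^esup>\<close>. This is the bound from \<open>L\<^sup>1\<close> to \<open>L\<^bsup>q*\<^esup>\<close>, and it implies the
  other exponents on unit cubes.

  Lower bounds. For large \<open>q\<close> test on the neighborhood of one skeleton. For small \<open>q\<close> test on the
  points with \<open>n - k\<close> coordinates in a set \<open>D\<close>, where \<open>D\<close> is the union over \<open>j < 2n\<close> of the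
  \<open>b\<^bsup>-j-1\<^esup>\<close>-neighborhoods of \<open>b\<^bsup>-j\<^esup>\<int>\<close>, up to constants, with \<open>b = \<delta>\<^bsup>-1/(2n)\<^esup>\<close>. A greedy choice of \<open>r\<close> puts each of
  the \<open>2n\<close> numbers \<open>x\<^sub>i \<plusminus> r\<close> near the lattice of a scale of its own.
\<close>

subsection \<open>Discrete Loomis--Whitney inequality\<close>

lemma root_prod_le_mean:
  fixes y :: "'j \<Rightarrow> real"
  assumes "finite K" "card K = d" "d \<ge> 1" "\<And>j. j \<in> K \<Longrightarrow> y j \<ge> 0"
  shows "(\<Prod>j\<in>K. root d (y j)) \<le> (\<Sum>j\<in>K. y j) / d"
proof -
  have "K \<noteq> {}" using assms by auto
  have "(\<Prod>j\<in>K. root d (y j)) = (\<Prod>j\<in>K. y j powr (1/d))"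
    using assms by (intro prod.cong) (auto simp: root_powr_inverse)
  also have "\<dots> = (\<Prod>j\<in>K. y j) powr (1/d)"
    using assms by (simp add: prod_powr_distrib)
  also have "\<dots> \<le> (\<Sum>j\<in>K. y j / d)"
    using arith_geom_mean[of K y] assms \<open>K \<noteq> {}\<close> by simp
  finally show ?thesis by (simp add: sum_divide_distrib)
qed

text \<open>Hoelder's inequality for \<open>d\<close> functions, all with exponent \<open>d\<close>.
  Once each function is divided by its sum, the arithmetic-geometric mean inequality at each
  \<open>t\<close> bounds the product by a mean whose sum over \<open>t\<close> is 1.\<close>

lemma sum_prod_root_le:
  fixes F :: "'j \<Rightarrow> 't \<Rightarrow> real"
  assumes "finite K" "card K = d" "d \<ge> 1" "finite T" "\<And>j t. F j t \<ge> 0"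
  shows "(\<Sum>t\<in>T. \<Prod>j\<in>K. root d (F j t)) \<le> (\<Prod>j\<in>K. root d (\<Sum>t\<in>T. F j t))"
proof (cases "\<exists>j\<in>K. (\<Sum>t\<in>T. F j t) = 0")
  \<comment> \<open>A vanishing sum cannot be normalised; the corresponding factor is then
    identically 0, and so is the left side.\<close>
  case True
  then obtain j where j: "j \<in> K" "(\<Sum>t\<in>T. F j t) = 0" by auto
  have "F j t = 0" if "t \<in> T" for t
    using j(2) assms that by (simp add: sum_nonneg_eq_0_iff)
  then have "(\<Prod>j\<in>K. root d (F j t)) = 0" if "t \<in> T" for t
    using that j(1) assms by (auto simp: prod_zero_iff)
  then have "(\<Sum>t\<in>T. \<Prod>j\<in>K. root d (F j t)) = 0"
    by (rule sum.neutral[OF ballI])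
  then show ?thesis
    using assms by (simp add: prod_nonneg sum_nonneg)
next
  case False
  define s where "s j = (\<Sum>t\<in>T. F j t)" for j
  have s: "s j > 0" if "j \<in> K" for j
    using False that assms(5) unfolding s_def by (metis order_le_less sum_nonneg)
  have "(\<Prod>j\<in>K. root d (F j t)) \<le> (\<Prod>j\<in>K. root d (s j)) * ((\<Sum>j\<in>K. F j t / s j) / d)" for t
  proof -
    have "(\<Prod>j\<in>K. root d (F j t)) = (\<Prod>j\<in>K. root d (s j) * root d (F j t / s j))"
      using s assms(3) by (intro prod.cong) (auto simp: less_imp_neq[THEN not_sym] simp flip: real_root_mult)
    also have "\<dots> = (\<Prod>j\<in>K. root d (s j)) * (\<Prod>j\<in>K. root d (F j t / s j))"
      by (rule prod.distrib)
    also have "\<dots> \<le> (\<Prod>j\<in>K. root d (s j)) * ((\<Sum>j\<in>K. F j t / s j) / d)"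
      using s assms by (intro mult_left_mono root_prod_le_mean prod_nonneg) (auto intro!: divide_nonneg_pos simp: less_imp_le)
    finally show ?thesis .
  qed
  then have "(\<Sum>t\<in>T. \<Prod>j\<in>K. root d (F j t)) \<le>
     (\<Sum>t\<in>T. (\<Prod>j\<in>K. root d (s j)) * ((\<Sum>j\<in>K. F j t / s j) / d))"
    by (intro sum_mono)
  also have "\<dots> = (\<Prod>j\<in>K. root d (s j)) * ((\<Sum>t\<in>T. \<Sum>j\<in>K. F j t / s j) / d)"
    by (simp add: sum_distrib_left sum_divide_distrib)
  also have "(\<Sum>t\<in>T. \<Sum>j\<in>K. F j t / s j) = (\<Sum>j\<in>K. s j / s j)"
    by (subst sum.swap) (simp add: s_def flip: sum_divide_distrib)
  also have "\<dots> = d"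
    using s assms by (simp add: less_imp_neq[THEN not_sym])
  finally show ?thesis using assms by (simp add: s_def)
qed

lemma sum_PiE_insert:
  fixes f :: "('i \<Rightarrow> 'b) \<Rightarrow> 'c::comm_monoid_add"
  assumes "i \<notin> S"
  shows "(\<Sum>v\<in>PiE (insert i S) B. f v) = (\<Sum>v\<in>PiE S B. \<Sum>t\<in>B i. f (v(i := t)))"
proof -
  have "(\<Sum>v\<in>PiE (insert i S) B. f v) = (\<Sum>(t, v)\<in>B i \<times> PiE S B. f (v(i := t)))"
    unfolding PiE_insert_eq using inj_combinator[OF assms, of B]
    by (subst sum.reindex) (auto simp: case_prod_unfold o_def)
  also have "\<dots> = (\<Sum>t\<in>B i. \<Sum>v\<in>PiE S B. f (v(i := t)))"
    by (simp add: sum.cartesian_product)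
  finally show ?thesis by (simp add: sum.swap[of _ "B i"])
qed

text \<open>The discrete inequality of Loomis--Whitney and Finner, obtained by summing out one
  coordinate at a time with Hoelder's inequality.\<close>

lemma sum_prod_root_projections_le:
  fixes F :: "'j \<Rightarrow> ('i \<Rightarrow> 'b) \<Rightarrow> real" and I :: "'j \<Rightarrow> 'i set"
  assumes "finite S" "finite J" "d \<ge> 1" "\<And>i. finite (B i)"
    and "\<And>j v. F j v \<ge> 0"
    and "\<And>j v w. (\<And>i. i \<in> I j \<Longrightarrow> v i = w i) \<Longrightarrow> F j v = F j w"
    and "\<And>i. i \<in> S \<Longrightarrow> card {j \<in> J. i \<in> I j} = d"
  shows "(\<Sum>v\<in>PiE S B. \<Prod>j\<in>J. root d (F j v)) \<le> (\<Prod>j\<in>J. root d (\<Sum>v\<in>PiE (S \<inter> I j) B. F j v))"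
  using assms
proof (induction S arbitrary: F I rule: finite_induct)
  case empty
  show ?case by simp
next
  case (insert i S)
  \<comment> \<open>\<open>K\<close> collects the factors that depend on coordinate
    \<open>i\<close>. In \<open>F'\<close> this coordinate is summed out of exactly these factors,
    and \<open>I'\<close> records the dependence that remains.\<close>
  define K where "K = {j \<in> J. i \<in> I j}"
  define F' where "F' j v = (if i \<in> I j then \<Sum>t\<in>B i. F j (v(i := t)) else F j v)" for j v
  define I' where "I' j = I j - {i}" for j
  have K: "finite K" "card K = d" "K \<subseteq> J"
  proof -
    show "card K = d" unfolding K_def by (rule insert.prems(6)) simp
  qed (use insert.prems(1) in \<open>auto simp: K_def\<close>)
  have dep: "F j v = F j w" if "\<And>l. l \<in> I j \<Longrightarrow> v l = w l" for j v w
    by (rule insert.prems(5)[OF that])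
  \<comment> \<open>Factors outside \<open>K\<close> are constant in \<open>t\<close> and come out
    of the sum; Hoelder's inequality applies to the \<open>d\<close> factors in
    \<open>K\<close>.\<close>
  have step: "(\<Sum>t\<in>B i. \<Prod>j\<in>J. root d (F j (v(i := t)))) \<le> (\<Prod>j\<in>J. root d (F' j v))" for v
  proof -
    have split: "(\<Prod>j\<in>J. g j) = (\<Prod>j\<in>J - K. g j) * (\<Prod>j\<in>K. g j)" for g :: "'j \<Rightarrow> real"
      using K insert.prems(1) by (metis prod.subset_diff)
    have "(\<Prod>j\<in>J - K. root d (F j (v(i := t)))) = (\<Prod>j\<in>J - K. root d (F' j v))" for t
    proof (intro prod.cong refl)
      fix j assume "j \<in> J - K"
      then have "i \<notin> I j" by (auto simp: K_def)
      then have "F j (v(i := t)) = F j v" by (intro dep) auto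
      with \<open>i \<notin> I j\<close> show "root d (F j (v(i := t))) = root d (F' j v)"
        by (simp add: F'_def)
    qed
    then have "(\<Sum>t\<in>B i. \<Prod>j\<in>J. root d (F j (v(i := t)))) =
        (\<Prod>j\<in>J - K. root d (F' j v)) * (\<Sum>t\<in>B i. \<Prod>j\<in>K. root d (F j (v(i := t))))"
      by (simp add: split sum_distrib_left)
    also have "\<dots> \<le> (\<Prod>j\<in>J - K. root d (F' j v)) * (\<Prod>j\<in>K. root d (\<Sum>t\<in>B i. F j (v(i := t))))"
      using K insert.prems(1-4)
      by (intro mult_left_mono sum_prod_root_le prod_nonneg) (auto simp: F'_def sum_nonneg)
    also have "(\<Prod>j\<in>K. root d (\<Sum>t\<in>B i. F j (v(i := t)))) = (\<Prod>j\<in>K. root d (F' j v))"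
      by (intro prod.cong) (auto simp: F'_def K_def)
    finally show ?thesis by (simp only: split)
  qed
  have "(\<Sum>v\<in>PiE (insert i S) B. \<Prod>j\<in>J. root d (F j v)) \<le> (\<Sum>v\<in>PiE S B. \<Prod>j\<in>J. root d (F' j v))"
    unfolding sum_PiE_insert[OF insert.hyps(2)] by (intro sum_mono step)
  also have "\<dots> \<le> (\<Prod>j\<in>J. root d (\<Sum>v\<in>PiE (S \<inter> I' j) B. F' j v))"
  proof (rule insert.IH)
    show "F' j v = F' j w" if *: "\<And>l. l \<in> I' j \<Longrightarrow> v l = w l" for j v w
    proof (cases "i \<in> I j")
      case True
      have "F j (v(i := t)) = F j (w(i := t))" for t
        by (rule dep) (use * in \<open>auto simp: I'_def\<close>)
      with True show ?thesis by (simp add: F'_def)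
    next
      case False
      then have "F j v = F j w" by (intro dep *) (auto simp: I'_def)
      with False show ?thesis by (simp add: F'_def)
    qed
    show "card {j \<in> J. l \<in> I' j} = d" if "l \<in> S" for l
    proof -
      have "{j \<in> J. l \<in> I' j} = {j \<in> J. l \<in> I j}"
        using that insert.hyps(2) by (auto simp: I'_def)
      then show ?thesis using insert.prems(6)[of l] that by simp
    qed
  qed (use insert.prems(1-4) in \<open>auto simp: F'_def sum_nonneg\<close>)
  also have "\<dots> = (\<Prod>j\<in>J. root d (\<Sum>v\<in>PiE (insert i S \<inter> I j) B. F j v))"
  proof (intro prod.cong refl arg_cong[where f = "root d"])
    fix j
    show "(\<Sum>v\<in>PiE (S \<inter> I' j) B. F' j v) = (\<Sum>v\<in>PiE (insert i S \<inter> I j) B. F j v)"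
    proof (cases "i \<in> I j")
      case True
      then have "insert i S \<inter> I j = insert i (S \<inter> I' j)" "i \<notin> S \<inter> I' j"
        using insert.hyps(2) by (auto simp: I'_def)
      then show ?thesis using True sum_PiE_insert[of i "S \<inter> I' j" "F j" B] by (simp add: F'_def)
    next
      case False
      then have "insert i S \<inter> I j = S \<inter> I' j" by (auto simp: I'_def)
      then show ?thesis using False by (simp add: F'_def)
    qed
  qed
  finally show ?case .
qed

text \<open>Gives the multiplicity of a coordinate in the cover by all sets of size
  \<open>d\<close>. Deleting \<open>i\<close> is a bijection onto the sets of size
  \<open>d - 1\<close> that avoid \<open>i\<close>.\<close>

lemma card_subsets_containing:
  fixes i :: "'n::finite"
  assumes "d \<ge> 1"
  shows "card {I :: 'n set. card I = d \<and> i \<in> I} = (CARD('n) - 1) choose (d - 1)"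
proof -
  have "bij_betw (insert i) {A. A \<subseteq> UNIV - {i} \<and> card A = d - 1} {I :: 'n set. card I = d \<and> i \<in> I}"
  proof (rule bij_betwI[where g = "\<lambda>I. I - {i}"])
    show "insert i \<in> {A. A \<subseteq> UNIV - {i} \<and> card A = d - 1} \<rightarrow> {I. card I = d \<and> i \<in> I}"
      using assms by (auto simp: card_insert_if)
    show "(\<lambda>I. I - {i}) \<in> {I. card I = d \<and> i \<in> I} \<rightarrow> {A. A \<subseteq> UNIV - {i} \<and> card A = d - 1}"
      by auto
  qed auto
  then have "card {I :: 'n set. card I = d \<and> i \<in> I} = card {A. A \<subseteq> UNIV - {i} \<and> card A = d - 1}"
    by (simp add: bij_betw_same_card)
  then show ?thesis by (simp add: n_subsets)
qed

text \<open>The cover of \<open>'n\<close> by all sets of size \<open>d\<close>, in which every coordinate has the same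
  multiplicity.\<close>

lemma sum_prod_root_subsets_le:
  fixes F :: "('n::finite) set \<Rightarrow> ('n \<Rightarrow> 'b) \<Rightarrow> real"
  assumes d: "1 \<le> d" "d \<le> CARD('n)" and "finite T"
    and "\<And>I v. F I v \<ge> 0"
    and "\<And>I v w. (\<And>i. i \<in> I \<Longrightarrow> v i = w i) \<Longrightarrow> F I v = F I w"
    and "\<And>I. card I = d \<Longrightarrow> (\<Sum>u\<in>PiE I (\<lambda>_. T). F I u) \<le> 1"
  shows "(\<Sum>v\<in>PiE UNIV (\<lambda>_. T). \<Prod>I | card I = d. root ((CARD('n) - 1) choose (d - 1)) (F I v)) \<le> 1"
proof -
  define D where "D = (CARD('n) - 1) choose (d - 1)"
  have D: "D \<ge> 1" using d by (simp add: D_def Suc_le_eq zero_less_binomial_iff)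
  have "(\<Sum>v\<in>PiE UNIV (\<lambda>_. T). \<Prod>I | card I = d. root D (F I v))
     \<le> (\<Prod>I | card I = d. root D (\<Sum>v\<in>PiE (UNIV \<inter> id I) (\<lambda>_. T). F I v))"
  proof (rule sum_prod_root_projections_le)
    show "F I v = F I w" if "\<And>i. i \<in> id I \<Longrightarrow> v i = w i" for I v w
      by (rule assms(5)) (use that in simp)
    show "card {I \<in> {I :: 'n set. card I = d}. i \<in> id I} = D" for i
      using card_subsets_containing[OF d(1), of i] by (simp add: D_def)
  qed (use D assms(3,4) in auto)
  also have "\<dots> \<le> (\<Prod>I\<in>{I::'n set. card I = d}. 1)"
  proof (rule prod_mono, safe)
    fix I :: "'n set" assume "d = card I"
    then show "root D (\<Sum>v\<in>PiE (UNIV \<inter> id I) (\<lambda>_. T). F I v) \<le> 1"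
      using assms(6)[of I] D by simp
    show "0 \<le> root D (\<Sum>v\<in>PiE (UNIV \<inter> id I) (\<lambda>_. T). F I v)"
      using assms(4) D by (simp add: sum_nonneg)
  qed
  finally show ?thesis by (simp add: D_def)
qed

text \<open>There are \<open>CARD('n) choose d\<close> factors, each under a root of index
  \<open>(CARD('n) - 1) choose (d - 1)\<close>, and the quotient of these two binomials is
  \<open>CARD('n) / d\<close>.\<close>

lemma powr_le_prod_root_subsets:
  fixes F :: "('n::finite) set \<Rightarrow> real"
  assumes d: "1 \<le> d" "d \<le> CARD('n)" and h: "h \<ge> 0" "\<And>I. card I = d \<Longrightarrow> h \<le> F I"
  shows "h powr (CARD('n) / d) \<le> (\<Prod>I | card I = d. root ((CARD('n) - 1) choose (d - 1)) (F I))"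
proof -
  define D where "D = (CARD('n) - 1) choose (d - 1)"
  have D: "D \<ge> 1" using d by (simp add: D_def Suc_le_eq zero_less_binomial_iff)
  \<comment> \<open>Both sides count the pairs of a set of size \<open>d\<close> and one of its
    elements.\<close>
  have "d * (CARD('n) choose d) = CARD('n) * D"
    unfolding D_def using d times_binomial_minus1_eq[of d "CARD('n)"] by simp
  then have eq: "real (CARD('n) choose d) / D = CARD('n) / d"
    using d D by (simp add: field_simps flip: of_nat_mult)
  have c: "card {I::'n set. card I = d} = CARD('n) choose d"
    using n_subsets[of "UNIV :: 'n set" d] by simp
  have "h powr (CARD('n) / d) = (\<Prod>I\<in>{I::'n set. card I = d}. root D h)"
  proof (cases "h = 0")
    \<comment> \<open>For \<open>h = 0\<close> the product is 0 only because it has at least one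
      factor.\<close>
    case True
    moreover have "{I::'n set. card I = d} \<noteq> {}"
      using c d by (metis card.empty binomial_eq_0_iff leD)
    ultimately show ?thesis using D d by (simp add: card_gt_0_iff power_0_left)
  next
    case False
    then show ?thesis using h D
      by (simp add: c root_powr_inverse powr_powr eq[symmetric] flip: powr_realpow)
  qed
  also have "\<dots> \<le> (\<Prod>I | card I = d. root D (F I))"
    using h D by (intro prod_mono) auto
  finally show ?thesis by (simp add: D_def)
qed

subsection \<open>Centers versus vertices of cubes\<close>

text \<open>A center \<open>w\<close> is determined by the endpoint \<open>w(j := w j + s w)\<close>
  and the \<open>j\<close>-th coordinate of the opposite endpoint, since \<open>w j\<close> is their
  midpoint. So the sum is dominated by that of \<open>g v * g (v(j := t)) / L v\<close> over all
  pairs \<open>(v, t)\<close>, where summation over \<open>t\<close> cancels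
  \<open>L v\<close>.\<close>

lemma sum_square_over_fibre_le:
  fixes g h :: "('n::finite \<Rightarrow> int) \<Rightarrow> real" and s :: "('n \<Rightarrow> int) \<Rightarrow> int"
  defines "W \<equiv> \<lambda>T. PiE (UNIV :: 'n set) (\<lambda>_. T :: int set)"
  assumes "finite T" and g: "\<And>v. g v \<ge> 0" "(\<Sum>v\<in>W T. g v) \<le> 1"
    and A: "finite A" 
    and mem: "\<And>w. w \<in> A \<Longrightarrow> w(j := w j + s w) \<in> W T" "\<And>w. w \<in> A \<Longrightarrow> w(j := w j - s w) \<in> W T"
    and h: "\<And>w. w \<in> A \<Longrightarrow> h w \<ge> 0" "\<And>w. w \<in> A \<Longrightarrow> h w \<le> g (w(j := w j + s w))"
      "\<And>w. w \<in> A \<Longrightarrow> h w \<le> g (w(j := w j - s w))"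
  shows "(\<Sum>w\<in>A. (h w)\<^sup>2 / (\<Sum>t\<in>T. g (w(j := t)))) \<le> 1"
proof -
  define L where "L w = (\<Sum>t\<in>T. g (w(j := t)))" for w
  define P where "P w = (w(j := w j + s w), w j - s w)" for w
  define F where "F = (\<lambda>(v, t). g v * g (v(j := t)) / L v)"
  have finW: "finite (W T)" unfolding W_def using assms by (intro finite_PiE) auto
  have L0: "L w \<ge> 0" for w by (simp add: L_def sum_nonneg g)
  have F0: "F x \<ge> 0" for x by (auto simp: F_def g L0 split: prod.split)
  have inj: "inj_on P A"
  proof (rule inj_onI)
    fix v w assume "P v = P w"
    then have eq: "v(j := v j + s v) = w(j := w j + s w)" "v j - s v = w j - s w"
      by (auto simp: P_def)
    have "v j = w j" using fun_cong[OF eq(1), of j] eq(2) by simp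
    moreover have "v i = w i" if "i \<noteq> j" for i using fun_cong[OF eq(1), of i] that by simp
    ultimately show "v = w" by (metis ext)
  qed
  have "(\<Sum>w\<in>A. (h w)\<^sup>2 / L w) \<le> (\<Sum>w\<in>A. F (P w))"
  proof (intro sum_mono)
    fix w assume w: "w \<in> A"
    have "(h w)\<^sup>2 \<le> g (w(j := w j + s w)) * g (w(j := w j - s w))"
      unfolding power2_eq_square using w g h by (intro mult_mono) auto
    moreover have "L (w(j := w j + s w)) = L w" by (simp add: L_def)
    ultimately show "(h w)\<^sup>2 / L w \<le> F (P w)"
      using L0[of w] by (simp add: F_def P_def divide_right_mono)
  qed
  also have "\<dots> = (\<Sum>x\<in>P ` A. F x)" using inj by (simp add: sum.reindex)
  also have "\<dots> \<le> (\<Sum>x\<in>W T \<times> T. F x)"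
  proof (rule sum_mono2)
    show "P ` A \<subseteq> W T \<times> T"
    proof safe
      fix a b w assume "(a, b) = P w" "w \<in> A"
      then have *: "a = w(j := w j + s w)" "b = w j - s w" by (auto simp: P_def)
      show "a \<in> W T" using * mem \<open>w \<in> A\<close> by simp
      have "(w(j := w j - s w)) j \<in> T" using mem(2)[OF \<open>w \<in> A\<close>] unfolding W_def by blast
      then show "b \<in> T" using * by simp
    qed
  next
    show "finite (W T \<times> T)" using finW \<open>finite T\<close> by (rule finite_cartesian_product)
  qed (rule F0)
  also have "\<dots> = (\<Sum>v\<in>W T. \<Sum>t\<in>T. F (v, t))" by (simp add: sum.cartesian_product)
  also have "\<dots> = (\<Sum>v\<in>W T. g v * (L v / L v))"
  proof (intro sum.cong refl)
    fix v
    have "(\<Sum>t\<in>T. F (v, t)) = g v * (\<Sum>t\<in>T. g (v(j := t))) / L v"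
      by (simp only: F_def case_prod_conv sum_distrib_left sum_divide_distrib)
    then show "(\<Sum>t\<in>T. F (v, t)) = g v * (L v / L v)" by (simp only: L_def times_divide_eq_right)
  qed
  \<comment> \<open>The quotient \<open>L v / L v\<close> is 1, or 0 by the convention
    \<open>0 / 0 = 0\<close>.\<close>
  also have "\<dots> \<le> (\<Sum>v\<in>W T. g v)" by (intro sum_mono) (simp add: g)
  also have "\<dots> \<le> 1" by (fact g)
  finally show ?thesis by (simp add: L_def)
qed

text \<open>The classical Loomis--Whitney inequality. A line sum in direction \<open>j\<close> does
  not depend on coordinate \<open>j\<close>, so each coordinate occurs in all but one of the
  factors; the sum of any factor over its own coordinates is the total mass of
  \<open>g\<close>.\<close>

lemma sum_prod_fibres_le:
  fixes g :: "('n::finite \<Rightarrow> int) \<Rightarrow> real"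
  assumes "finite T" and g: "\<And>v. g v \<ge> 0" "(\<Sum>v\<in>PiE UNIV (\<lambda>_. T). g v) \<le> 1" and n: "CARD('n) \<ge> 2"
  shows "(\<Sum>w\<in>PiE UNIV (\<lambda>_. T). \<Prod>j\<in>UNIV. root (CARD('n) - 1) (\<Sum>t\<in>T. g (w(j := t)))) \<le> 1"
proof -
  have "(\<Sum>w\<in>PiE UNIV (\<lambda>_. T). \<Prod>j\<in>UNIV. root (CARD('n) - 1) (\<Sum>t\<in>T. g (w(j := t))))
    \<le> (\<Prod>j\<in>UNIV. root (CARD('n) - 1) (\<Sum>w\<in>PiE (UNIV \<inter> (UNIV - {j})) (\<lambda>_. T). \<Sum>t\<in>T. g (w(j := t))))"
  proof (rule sum_prod_root_projections_le)
    show "(\<Sum>t\<in>T. g (v(j := t))) = (\<Sum>t\<in>T. g (w(j := t)))"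
      if "\<And>i. i \<in> UNIV - {j} \<Longrightarrow> v i = w i" for j v w
    proof -
      have "v(j := t) = w(j := t)" for t using that by auto
      then show ?thesis by simp
    qed
    show "card {j \<in> UNIV. i \<in> UNIV - {j}} = CARD('n) - 1" for i :: 'n
    proof -
      have "{j \<in> UNIV. i \<in> UNIV - {j}} = UNIV - {i}" by auto
      then show ?thesis by simp
    qed
  qed (use \<open>finite T\<close> g(1) n in \<open>auto intro: sum_nonneg\<close>)
  also have "\<dots> = (\<Prod>j\<in>(UNIV :: 'n set). root (CARD('n) - 1) (\<Sum>w\<in>PiE UNIV (\<lambda>_. T). g w))"
  proof (intro prod.cong refl arg_cong[where f = "root _"])
    fix j :: 'n
    have "insert j (UNIV - {j}) = UNIV" by auto
    then show "(\<Sum>w\<in>PiE (UNIV \<inter> (UNIV - {j})) (\<lambda>_. T). \<Sum>t\<in>T. g (w(j := t))) = (\<Sum>w\<in>PiE UNIV (\<lambda>_. T). g w)"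
      using sum_PiE_insert[of j "UNIV - {j}" g "\<lambda>_. T"] by simp
  qed
  also have "\<dots> \<le> (\<Prod>j\<in>(UNIV :: 'n set). 1)"
    using g n by (intro prod_mono) (auto simp: sum_nonneg)
  finally show ?thesis by simp
qed

text \<open>Write \<open>n\<close> for the dimension and compare the \<open>L j\<close> with the
  threshold \<open>b = h powr ((2 * n - 2) / (2 * n - 1))\<close>. If some \<open>L j\<close> is at
  most \<open>b\<close>, one square term is at least \<open>h\<^sup>2 / b\<close>; otherwise the
  product is at least \<open>b powr (n / (n - 1))\<close>. The threshold is chosen so that both
  values are the left side.\<close>

lemma powr_le_squares_plus_prod:
  fixes L :: "'n::finite \<Rightarrow> real"
  assumes h: "h > 0" and L: "\<And>j. L j > 0" and L1: "CARD('n) = 1 \<Longrightarrow> \<exists>j. L j \<le> 1"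
  shows "h powr (2 * real CARD('n) / (2 * real CARD('n) - 1))
     \<le> (\<Sum>j\<in>UNIV. h\<^sup>2 / L j) + (\<Prod>j\<in>UNIV. root (CARD('n) - 1) (L j))"
proof -
  define n where "n = CARD('n)"
  have n: "n \<ge> 1" by (simp add: n_def Suc_le_eq)
  define b where "b = h powr ((2 * real n - 2) / (2 * real n - 1))"
  have sq0: "(\<Sum>j\<in>UNIV. h\<^sup>2 / L j) \<ge> 0" using L by (intro sum_nonneg divide_nonneg_pos) auto
  have pr0: "(\<Prod>j\<in>UNIV. root (n - 1) (L j)) \<ge> 0" using L by (intro prod_nonneg real_root_ge_zero) (simp add: less_imp_le)
  show ?thesis
  proof (cases "\<exists>j. L j \<le> b")
    case True
    then obtain j where j: "L j \<le> b" by auto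
    have "h powr (2 * real n / (2 * real n - 1)) = h powr (2 - (2 * real n - 2) / (2 * real n - 1))"
      using n by (intro arg_cong2[where f = "(powr)"]) (auto simp: field_simps)
    also have "\<dots> = h\<^sup>2 / b"
      unfolding b_def powr_diff using h by (simp add: powr_numeral)
    also have "\<dots> \<le> h\<^sup>2 / L j"
      using j L[of j] h by (intro divide_left_mono) (auto simp: b_def)
    also have "\<dots> \<le> (\<Sum>j\<in>UNIV. h\<^sup>2 / L j)"
      using L by (intro member_le_sum) (auto simp: less_imp_le)
    finally show ?thesis using pr0 by (simp add: n_def)
  next
    case False
    then have big: "L j > b" for j by (simp add: not_le)
    \<comment> \<open>In dimension 1 the threshold is 1, and \<open>L1\<close> gives a line sum that
      does not exceed it. So the present case has a root of positive index.\<close>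
    have n2: "n \<ge> 2"
    proof (rule ccontr)
      assume "\<not> n \<ge> 2"
      then have "n = 1" using n by simp
      then obtain j where "L j \<le> 1" using L1 by (auto simp: n_def)
      moreover have "b = 1" using \<open>n = 1\<close> h by (simp add: b_def)
      ultimately show False using big[of j] by simp
    qed
    have "h powr (2 * real n / (2 * real n - 1)) = (root (n - 1) b) ^ n"
    proof -
      have "root (n - 1) b = h powr ((2 * real n - 2) / (2 * real n - 1) * (1 / real (n - 1)))"
        using n2 h by (simp add: b_def root_powr_inverse powr_powr)
      also have "(2 * real n - 2) / (2 * real n - 1) * (1 / real (n - 1)) = 2 / (2 * real n - 1)"
        using n2 by (simp add: of_nat_diff divide_simps)
      finally have "(root (n - 1) b) ^ n = (h powr (2 / (2 * real n - 1))) powr n"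
        using h by (simp add: powr_realpow)
      also have "\<dots> = h powr (2 * real n / (2 * real n - 1))"
        by (simp add: powr_powr)
      finally show ?thesis by simp
    qed
    also have "\<dots> = (\<Prod>j\<in>(UNIV :: 'n set). root (n - 1) b)" by (simp add: n_def)
    also have "\<dots> \<le> (\<Prod>j\<in>UNIV. root (n - 1) (L j))"
      using n2 big h by (intro prod_mono) (auto simp: b_def less_imp_le)
    finally show ?thesis using sq0 by (simp add: n_def)
  qed
qed

text \<open>The pointwise bound is summed over \<open>A\<close>. It produces one sum of squares over
  line sums for each direction and one Loomis--Whitney sum, each at most 1.\<close>

lemma sum_powr_axis_pairs_le:
  fixes g h :: "('n::finite \<Rightarrow> int) \<Rightarrow> real" and s :: "('n \<Rightarrow> int) \<Rightarrow> int"
  defines "W \<equiv> \<lambda>T. PiE (UNIV :: 'n set) (\<lambda>_. T :: int set)"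
  assumes "finite T" and g: "\<And>v. g v \<ge> 0" "(\<Sum>v\<in>W T. g v) \<le> 1"
    and A: "A \<subseteq> W T"
    and mem: "\<And>w j. w \<in> A \<Longrightarrow> w(j := w j + s w) \<in> W T" "\<And>w j. w \<in> A \<Longrightarrow> w(j := w j - s w) \<in> W T"
    and h: "\<And>w. w \<in> A \<Longrightarrow> h w \<ge> 0" "\<And>w j. w \<in> A \<Longrightarrow> h w \<le> g (w(j := w j + s w))"
      "\<And>w j. w \<in> A \<Longrightarrow> h w \<le> g (w(j := w j - s w))"
  shows "(\<Sum>w\<in>A. h w powr (2 * real CARD('n) / (2 * real CARD('n) - 1))) \<le> real CARD('n) + 1"
proof -
  define L where "L w j = (\<Sum>t\<in>T. g (w(j := t)))" for w j
  have finW: "finite (W T)" unfolding W_def using assms by (intro finite_PiE) auto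
  have finA: "finite A" using finW A by (rule finite_subset[rotated])
  have L0: "L w j \<ge> 0" for w j by (simp add: L_def sum_nonneg g)
  have in_T: "w j + s w \<in> T" if "w \<in> A" for w j
  proof -
    have "(w(j := w j + s w)) j \<in> T" using mem(1)[OF that] unfolding W_def by blast
    then show ?thesis by simp
  qed
  \<comment> \<open>In dimension 1 the root has index 0 and is 0 by convention; in its place stands
    \<open>1 / card A\<close>, whose sum over \<open>A\<close> is at most 1.\<close>
  have pw: "h w powr (2 * real CARD('n) / (2 * real CARD('n) - 1))
     \<le> (\<Sum>j\<in>UNIV. (h w)\<^sup>2 / L w j) + (if CARD('n) = 1 then 1 / real (card A) else \<Prod>j\<in>UNIV. root (CARD('n) - 1) (L w j))"
    if w: "w \<in> A" for w
  proof (cases "h w = 0")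
    case True
    then show ?thesis using L0 by (auto intro!: add_nonneg_nonneg sum_nonneg prod_nonneg real_root_ge_zero)
  next
    case False
    then have h0: "h w > 0" using h(1) w by fastforce
    have Lpos: "L w j > 0" for j
    proof -
      have "0 < g (w(j := w j + s w))" using h0 h(2)[OF w] by (rule order_less_le_trans)
      also have "\<dots> \<le> L w j"
        unfolding L_def using in_T[OF w] \<open>finite T\<close> g by (intro member_le_sum) auto
      finally show ?thesis .
    qed
    \<comment> \<open>In dimension 1 a line fills the whole box, so a line sum is at most the total
      mass of \<open>g\<close>.\<close>
    have L1: "L w j \<le> 1" if "CARD('n) = 1" for j
    proof -
      have j: "UNIV = {j}" using that by (metis card_1_singletonE UNIV_I singletonD)
      have "L w j = (\<Sum>v\<in>(\<lambda>t. w(j := t)) ` T. g v)"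
        unfolding L_def by (subst sum.reindex) (auto simp: inj_on_def fun_upd_eqD)
      also have "\<dots> \<le> (\<Sum>v\<in>W T. g v)"
        using finW g j unfolding W_def
        by (intro sum_mono2) (auto simp: PiE_iff extensional_def)
      finally show ?thesis using g by simp
    qed
    have "h w powr (2 * real CARD('n) / (2 * real CARD('n) - 1))
     \<le> (\<Sum>j\<in>UNIV. (h w)\<^sup>2 / L w j) + (\<Prod>j\<in>UNIV. root (CARD('n) - 1) (L w j))"
      using h0 Lpos L1 by (intro powr_le_squares_plus_prod) auto
    then show ?thesis by (auto intro: order_trans)
  qed
  have s2: "(\<Sum>w\<in>A. if CARD('n) = 1 then 1 / card A else \<Prod>j\<in>UNIV. root (CARD('n) - 1) (L w j)) \<le> 1"
  proof (cases "CARD('n) = 1")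
    case True
    then show ?thesis by simp
  next
    case False
    then have n2: "CARD('n) \<ge> 2" using zero_less_card_finite[where 'a='n] by linarith
    have "(\<Sum>w\<in>A. \<Prod>j\<in>UNIV. root (CARD('n) - 1) (L w j)) \<le> (\<Sum>w\<in>W T. \<Prod>j\<in>UNIV. root (CARD('n) - 1) (L w j))"
      using finW A L0 by (intro sum_mono2 prod_nonneg real_root_ge_zero) auto
    also have "\<dots> \<le> 1"
      using sum_prod_fibres_le[OF \<open>finite T\<close> g(1) _ n2] g(2) by (simp add: W_def L_def)
    finally show ?thesis using False by simp
  qed
  have "(\<Sum>w\<in>A. h w powr (2 * real CARD('n) / (2 * real CARD('n) - 1))) \<le>
    (\<Sum>w\<in>A. (\<Sum>j\<in>UNIV. (h w)\<^sup>2 / L w j) + (if CARD('n) = 1 then 1 / real (card A) else \<Prod>j\<in>UNIV. root (CARD('n) - 1) (L w j)))"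
    by (intro sum_mono pw)
  also have "\<dots> \<le> (\<Sum>j\<in>UNIV. \<Sum>w\<in>A. (h w)\<^sup>2 / L w j) + 1"
    unfolding sum.distrib using s2 by (subst sum.swap) simp
  also have "(\<Sum>j\<in>UNIV. \<Sum>w\<in>A. (h w)\<^sup>2 / L w j) \<le> (\<Sum>j\<in>(UNIV::'n set). 1)"
    unfolding L_def
  proof (intro sum_mono)
    fix j :: 'n
    show "(\<Sum>w\<in>A. (h w)\<^sup>2 / (\<Sum>t\<in>T. g (w(j := t)))) \<le> 1"
      by (rule sum_square_over_fibre_le[OF \<open>finite T\<close> g(1) g(2)[unfolded W_def] finA
            mem(1)[unfolded W_def] mem(2)[unfolded W_def] h])
  qed
  finally show ?thesis by simp
qed

text \<open>The directions \<open>(1, \<dots>, 1)\<close> and \<open>(1, \<dots>, 1) - 2 e\<^sub>j\<close> for \<open>j \<noteq> j\<^sub>0\<close> form a basis; the dual basis,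
  scaled by 2, sends each of them to twice a coordinate vector.\<close>

definition diagonal_coords :: "'n::finite \<Rightarrow> ('n \<Rightarrow> int) \<Rightarrow> 'n \<Rightarrow> int" where
  "diagonal_coords j0 x i =
     (if i = j0 then (\<Sum>l\<in>UNIV - {j0}. x l) + (3 - int CARD('n)) * x j0 else x j0 - x i)"

definition diagonal_sign :: "'n \<Rightarrow> 'n \<Rightarrow> 'n \<Rightarrow> int" where
  "diagonal_sign j0 j i = (if i = j \<and> j \<noteq> j0 then - 1 else 1)"

text \<open>Equal differences \<open>x j0 - x i\<close> leave only a common shift \<open>c\<close>
  of all coordinates. With \<open>n\<close> the dimension, coordinate \<open>j0\<close> of the image
  then changes by \<open>(n - 1) * c + (3 - n) * c = 2 * c\<close>, which forces
  \<open>c = 0\<close>.\<close>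

lemma inj_diagonal_coords: "inj (diagonal_coords j0)"
proof (rule injI)
  fix x y :: "'a \<Rightarrow> int"
  assume eq: "diagonal_coords j0 x = diagonal_coords j0 y"
  have off: "x j0 - x i = y j0 - y i" if "i \<noteq> j0" for i
    using fun_cong[OF eq, of i] that by (simp add: diagonal_coords_def)
  define c where "c = x j0 - y j0"
  have "(\<Sum>l\<in>UNIV - {j0}. x l) = (\<Sum>l\<in>UNIV - {j0}. y l + c)"
    using off by (intro sum.cong) (auto simp: c_def algebra_simps)
  also have "\<dots> = (\<Sum>l\<in>UNIV - {j0}. y l) + int (CARD('a) - 1) * c"
    by (simp add: sum.distrib)
  finally have "2 * c = 0"
    using fun_cong[OF eq, of j0]
    by (simp add: diagonal_coords_def c_def algebra_simps of_nat_diff Suc_le_eq)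
  then show "x = y" using off by (metis c_def diff_right_commute eq_iff_diff_eq_0 ext mult_eq_0_iff zero_neq_numeral diff_left_imp_eq)
qed

text \<open>A step along a main diagonal becomes a step along one coordinate axis. The factor 2
  comes from scaling the dual basis to make it integral.\<close>

lemma diagonal_coords_shift:
  fixes x :: "'n::finite \<Rightarrow> int"
  shows "diagonal_coords j0 (\<lambda>i. x i + diagonal_sign j0 j i * r) =
     (diagonal_coords j0 x)(j := diagonal_coords j0 x j + 2 * r)"
proof
  fix i
  have *: "(\<Sum>l\<in>UNIV - {j0}. diagonal_sign j0 j l) = int CARD('n) - 1 - (if j = j0 then 0 else 2)"
  proof (cases "j = j0")
    case True
    then show ?thesis by (simp add: diagonal_sign_def of_nat_diff Suc_le_eq)
  next
    case False
    have "(\<Sum>l\<in>UNIV - {j0}. diagonal_sign j0 j l) = (\<Sum>l\<in>UNIV - {j0}. 1 - (if l = j then 2 else 0))"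
      using False by (intro sum.cong) (auto simp: diagonal_sign_def)
    also have "\<dots> = int (CARD('n) - 1) - 2"
      using False by (subst sum_subtractf) (simp add: sum.delta)
    finally show ?thesis using False by (simp add: of_nat_diff Suc_le_eq)
  qed
  have "(\<Sum>l\<in>UNIV - {j0}. x l + diagonal_sign j0 j l * r) =
     (\<Sum>l\<in>UNIV - {j0}. x l) + (int CARD('n) - 1 - (if j = j0 then 0 else 2)) * r"
    by (simp add: sum.distrib flip: sum_distrib_right *)
  then show "diagonal_coords j0 (\<lambda>i. x i + diagonal_sign j0 j i * r) i =
     ((diagonal_coords j0 x)(j := diagonal_coords j0 x j + 2 * r)) i"
    by (auto simp: diagonal_coords_def diagonal_sign_def algebra_simps)
qed

text \<open>In diagonal coordinates the ends of each of the chosen main diagonals lie on a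
  coordinate line through the center, so \<open>sum_powr_axis_pairs_le\<close> applies. Only the
  vertices on these diagonals are used.\<close>

lemma sum_powr_cube_vertices_le:
  fixes g h :: "('n::finite \<Rightarrow> int) \<Rightarrow> real" and s :: "('n \<Rightarrow> int) \<Rightarrow> int"
  defines "B \<equiv> \<lambda>T. PiE (UNIV :: 'n set) (\<lambda>_. T :: int set)"
  assumes "finite T" and g: "\<And>v. g v \<ge> 0" "(\<Sum>v\<in>B T. g v) \<le> 1"
    and A: "A \<subseteq> B T"
    and mem: "\<And>m \<sigma>. m \<in> A \<Longrightarrow> range \<sigma> \<subseteq> {1, -1} \<Longrightarrow> (\<lambda>i. m i + \<sigma> i * s m) \<in> B T"
    and h: "\<And>m. m \<in> A \<Longrightarrow> h m \<ge> 0"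
       "\<And>m \<sigma>. m \<in> A \<Longrightarrow> range \<sigma> \<subseteq> {1, -1} \<Longrightarrow> h m \<le> g (\<lambda>i. m i + \<sigma> i * s m)"
  shows "(\<Sum>m\<in>A. h m powr (2 * real CARD('n) / (2 * real CARD('n) - 1))) \<le> real CARD('n) + 1"
proof -
  obtain j0 :: 'n where True by auto
  define \<phi> where "\<phi> = diagonal_coords j0"
  have inj: "inj \<phi>" by (simp add: \<phi>_def inj_diagonal_coords)
  define T' where "T' = (\<Union>i. (\<lambda>v. \<phi> v i) ` B T)"
  \<comment> \<open>The push-forward of \<open>g\<close> from the box, extended by 0 off the image
    of \<open>\<phi>\<close>; it has the same total mass.\<close>
  define g' where "g' w = (\<Sum>v | v \<in> B T \<and> \<phi> v = w. g v)" for w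
  have finB: "finite (B T)" unfolding B_def using assms by (intro finite_PiE) auto
  have im: "\<phi> v \<in> PiE UNIV (\<lambda>_. T')" if "v \<in> B T" for v
    using that by (auto simp: T'_def PiE_iff)
  have g'le: "g v \<le> g' (\<phi> v)" if "v \<in> B T" for v
    unfolding g'_def using that finB g by (intro member_le_sum) auto
  have sgn: "range (diagonal_sign j0 j) \<subseteq> {1, -1}" "range (\<lambda>i. - diagonal_sign j0 j i) \<subseteq> {1, -1}" for j :: 'n
    by (auto simp: diagonal_sign_def split: if_splits)
  have plus: "(\<phi> m)(j := \<phi> m j + 2 * r) = \<phi> (\<lambda>i. m i + diagonal_sign j0 j i * r)" for m j r
    by (simp add: \<phi>_def diagonal_coords_shift)
  have minus: "(\<phi> m)(j := \<phi> m j - 2 * r) = \<phi> (\<lambda>i. m i + (- diagonal_sign j0 j i) * r)" for m j r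
    using plus[of m j "- r"] by simp
  have "(\<Sum>w\<in>\<phi> ` A. h (inv \<phi> w) powr (2 * real CARD('n) / (2 * real CARD('n) - 1))) \<le> real CARD('n) + 1"
  proof (rule sum_powr_axis_pairs_le[where g = g' and T = T' and s = "\<lambda>w. 2 * s (inv \<phi> w)"])
    show "finite T'" using finB by (simp add: T'_def)
    show "g' v \<ge> 0" for v by (simp add: g'_def g sum_nonneg)
    have "(\<Sum>w\<in>PiE UNIV (\<lambda>_. T'). g' w) = (\<Sum>v\<in>B T. g v)"
      unfolding g'_def using finB im \<open>finite T'\<close>
      by (intro sum.group) (auto intro!: finite_PiE)
    then show "(\<Sum>w\<in>PiE UNIV (\<lambda>_. T'). g' w) \<le> 1" using g by simp
    show "\<phi> ` A \<subseteq> PiE UNIV (\<lambda>_. T')" using A im by auto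
  next
    fix w j assume "w \<in> \<phi> ` A"
    then obtain m where m: "m \<in> A" "w = \<phi> m" by auto
    have i: "inv \<phi> w = m" using inj m by simp
    show "w(j := w j + 2 * s (inv \<phi> w)) \<in> PiE UNIV (\<lambda>_. T')"
      unfolding i unfolding m(2) plus using m(1) sgn by (intro im mem) 
    show "w(j := w j - 2 * s (inv \<phi> w)) \<in> PiE UNIV (\<lambda>_. T')"
      unfolding i unfolding m(2) minus using m(1) sgn by (intro im mem)
    show "h (inv \<phi> w) \<ge> 0" using h m i by simp
    show "h (inv \<phi> w) \<le> g' (w(j := w j + 2 * s (inv \<phi> w)))"
      unfolding i unfolding m(2) plus
      using h(2)[OF m(1) sgn(1)] g'le[OF mem[OF m(1) sgn(1)]] by (rule order_trans)
    show "h (inv \<phi> w) \<le> g' (w(j := w j - 2 * s (inv \<phi> w)))"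
      unfolding i unfolding m(2) minus
      using h(2)[OF m(1) sgn(2)] g'le[OF mem[OF m(1) sgn(2)]] by (rule order_trans)
  qed
  then show ?thesis using inj by (subst (asm) sum.reindex) (auto intro: inj_on_subset)
qed

text \<open>Let \<open>g\<close> be the product of the roots of the \<open>F I / a\<close>. Finner's
  inequality bounds its mass by 1, while \<open>h / a\<close> to the power \<open>n / d\<close> is
  at most \<open>g\<close> at every vertex, with \<open>n\<close> the dimension. The vertex
  inequality then yields the exponent \<open>(n / d) * (2 * n / (2 * n - 1))\<close>, which is
  \<open>q_star n k\<close> for \<open>d = n - k\<close>.\<close>

lemma sum_powr_cube_skeletons_le:
  fixes F :: "('n::finite) set \<Rightarrow> ('n \<Rightarrow> int) \<Rightarrow> real" and h :: "('n \<Rightarrow> int) \<Rightarrow> real"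
    and s :: "('n \<Rightarrow> int) \<Rightarrow> int" and d :: nat
  defines "B \<equiv> \<lambda>T. PiE (UNIV :: 'n set) (\<lambda>_. T :: int set)"
  assumes d: "1 \<le> d" "d \<le> CARD('n)" and "finite T"
    and F: "\<And>I v. F I v \<ge> 0"
      "\<And>I v w. (\<And>i. i \<in> I \<Longrightarrow> v i = w i) \<Longrightarrow> F I v = F I w"
      "\<And>I. card I = d \<Longrightarrow> (\<Sum>u\<in>PiE I (\<lambda>_. T). F I u) \<le> a"
    and a: "a \<ge> 0"
    and A: "A \<subseteq> B T"
    and mem: "\<And>m \<sigma>. m \<in> A \<Longrightarrow> range \<sigma> \<subseteq> {1, -1} \<Longrightarrow> (\<lambda>i. m i + \<sigma> i * s m) \<in> B T"
    and h: "\<And>m. m \<in> A \<Longrightarrow> h m \<ge> 0"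
       "\<And>m I \<sigma>. m \<in> A \<Longrightarrow> card I = d \<Longrightarrow> range \<sigma> \<subseteq> {1, -1} \<Longrightarrow> h m \<le> F I (\<lambda>i. m i + \<sigma> i * s m)"
  shows "(\<Sum>m\<in>A. h m powr (2 * (real CARD('n))\<^sup>2 / (d * (2 * real CARD('n) - 1))))
    \<le> (real CARD('n) + 1) * a powr (2 * (real CARD('n))\<^sup>2 / (d * (2 * real CARD('n) - 1)))"
proof -
  define n where "n = real CARD('n)"
  have n1: "n \<ge> 1" by (simp add: n_def Suc_le_eq)
  define Q where "Q = 2 * n\<^sup>2 / (d * (2 * n - 1))"
  have finB: "finite (B T)" unfolding B_def using \<open>finite T\<close> by (intro finite_PiE) auto
  have Q: "Q = n / d * (2 * n / (2 * n - 1))"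
    by (simp add: Q_def power2_eq_square)
  show ?thesis
  proof (cases "a = 0")
    \<comment> \<open>For \<open>a = 0\<close> one cannot normalise, but then \<open>h m\<close> is
      bounded by a value of \<open>F I\<close> that is a term of a sum equal to 0.\<close>
    case True
    have "h m = 0" if m: "m \<in> A" for m
    proof -
      obtain I :: "'n set" where I: "card I = d"
        using obtain_subset_with_card_n[OF d(2)] by blast
      have *: "range (\<lambda>_. 1 :: int) \<subseteq> {1, -1}" by auto
      define v where "v = (\<lambda>i. m i + 1 * s m)"
      have v: "v \<in> B T" unfolding v_def using mem[OF m *] by simp
      have "h m \<le> F I v" unfolding v_def using h(2)[OF m I *] by simp
      also have "\<dots> = F I (restrict v I)" by (rule F(2)) simp
      also have "\<dots> \<le> (\<Sum>u\<in>PiE I (\<lambda>_. T). F I u)"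
        using v F(1) \<open>finite T\<close> by (intro member_le_sum) (auto simp: B_def intro!: finite_PiE)
      also have "\<dots> \<le> 0" using F(3)[OF I] True by simp
      finally show ?thesis using h(1)[OF m] by simp
    qed
    then show ?thesis using True by simp
  next
    case False
    then have a0: "a > 0" using a by simp
    define g where "g v = (\<Prod>I | card I = d. root ((CARD('n) - 1) choose (d - 1)) (F I v / a))" for v
    have D: "(CARD('n) - 1) choose (d - 1) \<ge> 1"
      using d by (simp add: Suc_le_eq zero_less_binomial_iff)
    have "(\<Sum>m\<in>A. ((h m / a) powr (n / d)) powr (2 * n / (2 * n - 1))) \<le> n + 1"
      unfolding n_def
    proof (rule sum_powr_cube_vertices_le[OF \<open>finite T\<close>, where g = g and s = s])
      show "g v \<ge> 0" for v unfolding g_def using F(1) a by (intro prod_nonneg real_root_ge_zero divide_nonneg_nonneg)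
      show "(\<Sum>v\<in>PiE UNIV (\<lambda>_. T). g v) \<le> 1"
        unfolding g_def
      proof (rule sum_prod_root_subsets_le)
        show "F I v / a = F I w / a" if "\<And>i. i \<in> I \<Longrightarrow> v i = w i" for I v w
          using F(2)[of I v w, OF that] by (rule arg_cong[where f = "\<lambda>x. x / a"])
        show "(\<Sum>u\<in>PiE I (\<lambda>_. T). F I u / a) \<le> 1" if "card I = d" for I
          using F(3)[OF that] a0 by (simp flip: sum_divide_distrib)
      qed (use d \<open>finite T\<close> F(1) a in auto)
      show "A \<subseteq> PiE UNIV (\<lambda>_. T)" using A by (simp add: B_def)
    next
      fix m and \<sigma> :: "'n \<Rightarrow> int" assume m: "m \<in> A" and \<sigma>: "range \<sigma> \<subseteq> {1, -1 :: int}"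
      show "(\<lambda>i. m i + \<sigma> i * s m) \<in> PiE UNIV (\<lambda>_. T)"
        using mem[OF m \<sigma>] by (simp add: B_def)
      show "(h m / a) powr (real CARD('n) / d) \<le> g (\<lambda>i. m i + \<sigma> i * s m)"
        unfolding g_def using d h(1)[OF m] h(2)[OF m _ \<sigma>] a0
        by (intro powr_le_prod_root_subsets) (auto simp: divide_right_mono)
    qed simp
    then have "(\<Sum>m\<in>A. (h m / a) powr Q) \<le> n + 1"
      by (simp add: Q powr_powr)
    moreover have "(h m / a) powr Q = h m powr Q / a powr Q" if "m \<in> A" for m
      using h(1)[OF that] a by (simp add: powr_divide)
    ultimately have "(\<Sum>m\<in>A. h m powr Q) / a powr Q \<le> n + 1"
      by (simp add: sum_divide_distrib)
    then show ?thesis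
      using a0 by (simp add: Q_def n_def field_simps)
  qed
qed

subsection \<open>Faces of cubes\<close>

text \<open>The differences from \<open>y\<close> span a unit vector for each \<open>j\<close> in
  \<open>J\<close>. This serves to compute the dimension of a coordinate face and to bound the
  number of free directions at a point of an arbitrary face.\<close>

lemma aff_dim_ge_card_directions:
  fixes S :: "(real ^ 'n) set"
  assumes y: "y \<in> S" and J: "\<And>j. j \<in> J \<Longrightarrow> \<exists>t. t \<noteq> 0 \<and> y + axis j t \<in> S"
  shows "aff_dim S \<ge> int (card J)"
proof -
  define V where "V = (+) (- y) ` S"
  have "axis j 1 \<in> span V" if j: "j \<in> J" for j
  proof -
    obtain t where t: "t \<noteq> 0" "y + axis j t \<in> S" using J[OF j] by auto
    then have "axis j t \<in> V" by (auto simp: V_def image_iff intro!: bexI[of _ "y + axis j t"])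
    then have "(1 / t) *\<^sub>R axis j t \<in> span V" by (intro span_scale span_base)
    moreover have "(1 / t) *\<^sub>R axis j t = axis j (1::real)" using t by (simp add: vec_eq_iff axis_def)
    ultimately show ?thesis by simp
  qed
  then have sub: "(\<lambda>j. axis j (1::real)) ` J \<subseteq> span V" by auto
  have "independent ((\<lambda>j. axis j (1::real)) ` J)"
    by (rule independent_mono[OF independent_Basis]) (auto simp: Basis_vec_def)
  then have "card ((\<lambda>j. axis j (1::real)) ` J) \<le> dim (span V)"
    using sub independent_card_le_dim by blast
  moreover have "card ((\<lambda>j. axis j (1::real)) ` J) = card J"
    by (rule card_image) (auto simp: inj_on_def axis_eq_axis)
  moreover have "aff_dim S = int (dim V)"
    unfolding V_def using y by (intro aff_dim_eq_dim hull_inc)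
  ultimately show ?thesis by simp
qed

lemma aff_dim_le_card_directions:
  fixes S :: "(real ^ 'n) set"
  assumes y: "y \<in> S" and J: "\<And>z i. z \<in> S \<Longrightarrow> i \<notin> J \<Longrightarrow> z $ i = y $ i"
  shows "aff_dim S \<le> int (card J)"
proof -
  have "(+) (- y) ` S \<subseteq> {x. \<forall>i. i \<notin> J \<longrightarrow> x $ i = 0}"
    using J by auto
  then have "dim ((+) (- y) ` S) \<le> dim {x :: real ^ 'n. \<forall>i. i \<notin> J \<longrightarrow> x $ i = 0}"
    by (rule dim_subset)
  also have "\<dots> = vec.dim {x :: real ^ 'n. \<forall>i. i \<notin> J \<longrightarrow> x $ i = 0}"
    by (simp only: dim_vec_eq)
  also have "\<dots> = card J"
    by (rule dim_substandard_cart)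
  finally show ?thesis
    using aff_dim_eq_dim[OF hull_inc[OF y]] by simp
qed

text \<open>Only the values of \<open>\<sigma>\<close> on \<open>I\<close> matter. It is defined on
  all coordinates so that one sign vector names a vertex together with all faces that contain
  it.\<close>

definition cube_face :: "'n set \<Rightarrow> ('n \<Rightarrow> int) \<Rightarrow> real ^ 'n \<Rightarrow> real \<Rightarrow> (real ^ 'n) set" where
  "cube_face I \<sigma> x r =
     cbox (\<chi> i. x $ i + (if i \<in> I then \<sigma> i else - 1) * r) (\<chi> i. x $ i + (if i \<in> I then \<sigma> i else 1) * r)"

lemma mem_cube_face:
  "y \<in> cube_face I \<sigma> x r \<longleftrightarrow>
    (\<forall>i\<in>I. y $ i = x $ i + \<sigma> i * r) \<and> (\<forall>i. i \<notin> I \<longrightarrow> \<bar>y $ i - x $ i\<bar> \<le> r)"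
  unfolding cube_face_def mem_box_cart by (auto simp: abs_le_iff algebra_simps)

lemma mem_axis_cube: "y \<in> axis_cube x r \<longleftrightarrow> (\<forall>i. \<bar>y $ i - x $ i\<bar> \<le> r)"
  unfolding axis_cube_def mem_box_cart by (auto simp: abs_le_iff algebra_simps)

lemma convex_combination_extreme:
  fixes a b r u :: real
  assumes "\<bar>a\<bar> \<le> r" "\<bar>b\<bar> \<le> r" "0 < u" "u < 1" "(1 - u) * a + u * b = s * r" "s = 1 \<or> s = -1"
  shows "a = s * r" "b = s * r"
proof -
  \<comment> \<open>As \<open>s * s = 1\<close>, the nonnegative gaps \<open>r - s * a\<close> and
    \<open>r - s * b\<close> have a vanishing combination with positive weights.\<close>
  have eq: "(1 - u) * (r - s * a) + u * (r - s * b) = 0"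
    using assms(5,6) by (auto simp: algebra_simps)
  have "r - s * a \<ge> 0" "r - s * b \<ge> 0" using assms(1,2,6) by auto
  then have "r - s * a = 0" "r - s * b = 0"
    using eq assms(3,4)
    by (smt (verit) mult_eq_0_iff mult_nonneg_nonneg)+
  then have "r = s * a" "r = s * b" by auto
  then show "a = s * r" "b = s * r" using assms(6) by auto
qed

text \<open>This inclusion serves the upper bound: the minimum over all faces is at most the average
  over any one of these.\<close>

lemma cube_face_in_skeleton:
  fixes x :: "real ^ 'n"
  assumes r: "r > 0" and \<sigma>: "range \<sigma> \<subseteq> {1, -1}" and I: "card I + k = CARD('n)"
  shows "cube_face I \<sigma> x r \<in> skeleton_faces k x r"
proof -
  have s: "\<sigma> i = 1 \<or> \<sigma> i = -1" for i using \<sigma> by auto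
  have k: "card (- I) = k"
    using I by (simp add: Compl_eq_Diff_UNIV card_Diff_subset)
  define c where "c = (\<chi> i. x $ i + \<sigma> i * r)"
  have c: "c \<in> cube_face I \<sigma> x r"
    using s r by (auto simp: mem_cube_face c_def abs_mult) (smt (verit) of_int_1 of_int_minus mult_minus1 mult_1)
  have "aff_dim (cube_face I \<sigma> x r) = int k"
  proof (rule antisym)
    show "aff_dim (cube_face I \<sigma> x r) \<le> int k"
      unfolding k[symmetric] using c by (rule aff_dim_le_card_directions) (use c in \<open>auto simp: mem_cube_face\<close>)
    show "int k \<le> aff_dim (cube_face I \<sigma> x r)"
      unfolding k[symmetric] using c
    proof (rule aff_dim_ge_card_directions)
      fix j assume "j \<in> - I"
      \<comment> \<open>From the vertex \<open>c\<close>, a step of length \<open>r\<close> into the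
        cube along a free direction stays on the face.\<close>
      then have "c + axis j (- \<sigma> j * r) \<in> cube_face I \<sigma> x r"
        using c r by (auto simp: mem_cube_face c_def axis_def)
      then show "\<exists>t. t \<noteq> 0 \<and> c + axis j t \<in> cube_face I \<sigma> x r"
        using r s[of j] by (intro exI[of _ "- \<sigma> j * r"]) auto
    qed
  qed
  moreover have "cube_face I \<sigma> x r face_of axis_cube x r"
    unfolding face_of_def
  proof (intro conjI ballI impI)
    show "cube_face I \<sigma> x r \<subseteq> axis_cube x r"
    proof
      fix y assume y: "y \<in> cube_face I \<sigma> x r"
      have "\<bar>y $ i - x $ i\<bar> \<le> r" for i
        using y s[of i] r by (cases "i \<in> I") (auto simp: mem_cube_face)
      then show "y \<in> axis_cube x r" by (simp add: mem_axis_cube)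
    qed
    show "convex (cube_face I \<sigma> x r)" by (simp add: cube_face_def)
  next
    fix a b y assume a: "a \<in> axis_cube x r" and b: "b \<in> axis_cube x r"
      and y: "y \<in> cube_face I \<sigma> x r" and seg: "y \<in> open_segment a b"
    obtain u where u: "0 < u" "u < 1" "y = (1 - u) *\<^sub>R a + u *\<^sub>R b"
      using seg by (auto simp: in_segment)
    have *: "a $ i - x $ i = \<sigma> i * r \<and> b $ i - x $ i = \<sigma> i * r" if i: "i \<in> I" for i
    proof -
      have "(1 - u) * (a $ i - x $ i) + u * (b $ i - x $ i) = of_int (\<sigma> i) * r"
        using y i u(3) by (auto simp: mem_cube_face algebra_simps)
      moreover have "of_int (\<sigma> i) = (1::real) \<or> of_int (\<sigma> i) = (- 1::real)" using s[of i] by auto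
      moreover have "\<bar>a $ i - x $ i\<bar> \<le> r" "\<bar>b $ i - x $ i\<bar> \<le> r" using a b by (auto simp: mem_axis_cube)
      ultimately show ?thesis
        using convex_combination_extreme[of "a $ i - x $ i" r "b $ i - x $ i" u "of_int (\<sigma> i)"] u(1,2)
        by blast
    qed
    then show "a \<in> cube_face I \<sigma> x r" "b \<in> cube_face I \<sigma> x r"
      using a b by (auto simp: mem_cube_face mem_axis_cube algebra_simps)
  qed
  ultimately show ?thesis by (simp add: skeleton_faces_def)
qed

text \<open>If coordinate \<open>j\<close> of \<open>y\<close> is not extreme, then \<open>y\<close>
  is interior to a segment in direction \<open>j\<close> inside the cube, and the face contains its
  ends. So there are at most \<open>k\<close> such coordinates. For the lower bounds this controls
  every face without a classification of faces.\<close>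

lemma card_extreme_coords_ge:
  fixes x :: "real ^ 'n"
  assumes F: "F \<in> skeleton_faces k x r" and y: "y \<in> F"
  shows "CARD('n) \<le> card {i. \<bar>y $ i - x $ i\<bar> = r} + k"
proof -
  define J where "J = {i. \<bar>y $ i - x $ i\<bar> \<noteq> r}"
  have face: "F face_of axis_cube x r" and dim: "aff_dim F = int k"
    using F by (auto simp: skeleton_faces_def)
  have "y \<in> axis_cube x r" using face_of_imp_subset[OF face] y by blast
  then have yc: "\<bar>y $ i - x $ i\<bar> \<le> r" for i by (simp add: mem_axis_cube)
  have "int (card J) \<le> aff_dim F"
    using y
  proof (rule aff_dim_ge_card_directions)
    fix j assume "j \<in> J"
    then have lt: "\<bar>y $ j - x $ j\<bar> < r" using yc[of j] by (auto simp: J_def)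
    \<comment> \<open>The distance from \<open>y\<close> to the nearer of the two facets in
      direction \<open>j\<close>.\<close>
    define t where "t = r - \<bar>y $ j - x $ j\<bar>"
    have t: "t > 0" using lt by (simp add: t_def)
    have in_cube: "y + axis j s \<in> axis_cube x r" if "\<bar>s\<bar> = t" for s
      using yc that by (auto simp: mem_axis_cube axis_def t_def)
    have "y \<in> open_segment (y + axis j t) (y + axis j (-t))"
    proof -
      have "y + axis j t \<noteq> y + axis j (-t)"
        using t by (auto simp: axis_eq_axis)
      moreover have "y = (1 - 1/2) *\<^sub>R (y + axis j t) + (1/2) *\<^sub>R (y + axis j (-t))"
        by (simp add: vec_eq_iff axis_def field_simps)
      moreover have "0 < (1/2::real)" "1/2 < (1::real)" by simp_all
      ultimately show ?thesis unfolding in_segment by blast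
    qed
    then have "y + axis j t \<in> F"
      using face_ofD[OF face _ in_cube in_cube y] t by simp
    then show "\<exists>t. t \<noteq> 0 \<and> y + axis j t \<in> F" using t by (intro exI[of _ t]) auto
  qed
  then have "card J \<le> k" using dim by simp
  moreover have "J = - {i. \<bar>y $ i - x $ i\<bar> = r}" by (auto simp: J_def)
  ultimately show ?thesis
    by (simp add: Compl_eq_Diff_UNIV card_Diff_subset card_mono)
qed

section \<open>Neighborhoods of faces and their measure\<close>

lemma open_nbhd: "open (nbhd \<delta> S)"
  unfolding nbhd_def by auto

lemma nbhd_lebesgue [measurable]: "nbhd \<delta> S \<in> sets lebesgue"
  using open_nbhd by (metis borel_open sets_completionI_sets sets_lborel)

lemma mem_nbhd: "y \<in> nbhd \<delta> S \<longleftrightarrow> (\<exists>z\<in>S. dist z y < \<delta>)"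
  by (auto simp: nbhd_def)

lemma emeasure_nbhd_pos:
  assumes "S \<noteq> {}" "\<delta> > 0"
  shows "emeasure lebesgue (nbhd \<delta> S) > 0"
proof -
  obtain y where "y \<in> S" using assms by auto
  then have "y \<in> nbhd \<delta> S" using assms by (auto simp: mem_nbhd intro!: bexI[of _ y])
  then have "nbhd \<delta> S \<noteq> {}" by auto
  then have "\<not> negligible (nbhd \<delta> S)"
    using open_not_negligible open_nbhd by blast
  then show ?thesis by (simp add: negligible_iff_emeasure0 zero_less_iff_neq_zero)
qed

lemma emeasure_nbhd_finite:
  assumes "bounded S"
  shows "emeasure lebesgue (nbhd \<delta> S) < \<infinity>"
proof -
  obtain B where B: "\<And>y. y \<in> S \<Longrightarrow> norm y \<le> B" using assms unfolding bounded_iff by auto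
  have "norm y \<le> B + \<delta>" if "y \<in> nbhd \<delta> S" for y
  proof -
    obtain z where "z \<in> S" "dist z y < \<delta>" using \<open>y \<in> nbhd \<delta> S\<close> by (auto simp: mem_nbhd)
    then show ?thesis using B[of z] norm_triangle_ineq2[of y z] by (simp add: dist_norm norm_minus_commute)
  qed
  then have "bounded (nbhd \<delta> S)" unfolding bounded_iff by auto
  then show ?thesis using emeasure_bounded_finite[of "nbhd \<delta> S"] open_nbhd[of \<delta> S] by simp
qed

lemma emeasure_lebesgue_cbox_cart:
  fixes a b :: "real ^ 'n"
  assumes "\<And>i. a $ i \<le> b $ i"
  shows "emeasure lebesgue (cbox a b) = ennreal (\<Prod>i\<in>UNIV. b $ i - a $ i)"
proof -
  have "cbox a b \<noteq> {}" using assms by (auto simp: interval_ne_empty_cart)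
  then have "measure lborel (cbox a b) = (\<Prod>i\<in>UNIV. b $ i - a $ i)" by (rule content_cbox_cart)
  then show ?thesis
    using emeasure_eq_ennreal_measure[of lborel "cbox a b"] emeasure_lborel_cbox_finite[of a b] by simp
qed

text \<open>The neighborhood contains a box of half-width \<open>\<delta> / (2 * n)\<close> in the
  directions of \<open>I\<close>, with \<open>n\<close> the dimension: the coordinate deviations
  from the face then add up to at most \<open>\<delta> / 2\<close>. The remaining sides have length
  \<open>2 * r \<ge> 1\<close>.\<close>

lemma emeasure_nbhd_cube_face_ge:
  fixes x :: "real ^ 'n"
  assumes r: "1 \<le> r" and \<delta>: "\<delta> > 0" 
  shows "emeasure lebesgue (nbhd \<delta> (cube_face I \<sigma> x r)) \<ge> ennreal ((\<delta> / CARD('n)) ^ card I)"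
proof -
  define n where "n = real CARD('n)"
  have n: "n > 0" by (simp add: n_def)
  define a where "a = (\<chi> i. if i \<in> I then x $ i + \<sigma> i * r - \<delta> / (2 * n) else x $ i - r)"
  define b where "b = (\<chi> i. if i \<in> I then x $ i + \<sigma> i * r + \<delta> / (2 * n) else x $ i + r)"
  have "cbox a b \<subseteq> nbhd \<delta> (cube_face I \<sigma> x r)"
  proof
    fix y assume y: "y \<in> cbox a b"
    define z where "z = (\<chi> i. if i \<in> I then x $ i + \<sigma> i * r else y $ i)"
    have "z \<in> cube_face I \<sigma> x r"
      using y by (auto simp: mem_cube_face z_def mem_box_cart a_def b_def abs_le_iff split: if_splits)
    moreover have "dist z y < \<delta>"
    proof -
      have "\<bar>(z - y) $ i\<bar> \<le> \<delta> / (2 * n)" for i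
        using y[unfolded mem_box_cart, rule_format, of i] \<delta> n by (auto simp: z_def a_def b_def abs_le_iff split: if_splits)
      then have "norm (z - y) \<le> (\<Sum>i\<in>(UNIV::'n set). \<delta> / (2 * n))"
        using norm_le_l1_cart[of "z - y"] by (meson order_trans sum_mono)
      also have "\<dots> = \<delta> / 2" using n by (simp add: n_def)
      finally show ?thesis using \<delta> by (simp add: dist_norm)
    qed
    ultimately show "y \<in> nbhd \<delta> (cube_face I \<sigma> x r)" by (auto simp: mem_nbhd)
  qed
  then have "emeasure lebesgue (cbox a b) \<le> emeasure lebesgue (nbhd \<delta> (cube_face I \<sigma> x r))"
    by (rule emeasure_mono) simp
  moreover have "emeasure lebesgue (cbox a b) = ennreal (\<Prod>i\<in>UNIV. b $ i - a $ i)"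
    using n \<delta> r by (intro emeasure_lebesgue_cbox_cart) (auto simp: a_def b_def)
  moreover have "(\<delta> / n) ^ card I \<le> (\<Prod>i\<in>UNIV. b $ i - a $ i)"
  proof -
    have "(\<delta> / n) ^ card I = (\<Prod>i\<in>UNIV. if i \<in> I then \<delta> / n else 1)"
      by (simp add: prod.If_cases)
    also have "\<dots> \<le> (\<Prod>i\<in>UNIV. b $ i - a $ i)"
      using n \<delta> r by (intro prod_mono) (auto simp: a_def b_def field_simps)
    finally show ?thesis .
  qed
  ultimately show ?thesis
    by (metis ennreal_leI n_def order_trans)
qed

lemma nbhd_cube_face_subset:
  fixes x :: "real ^ 'n"
  assumes r: "r \<ge> 0" and \<sigma>: "range \<sigma> \<subseteq> {1, -1}"
  shows "nbhd \<delta> (cube_face I \<sigma> x r) \<subseteq>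
    {y. (\<forall>i\<in>I. \<bar>y $ i - (x $ i + \<sigma> i * r)\<bar> < \<delta>) \<and> (\<forall>i. \<bar>y $ i - x $ i\<bar> < r + \<delta>)}"
proof (intro subsetI CollectI conjI allI ballI)
  fix y i assume y: "y \<in> nbhd \<delta> (cube_face I \<sigma> x r)"
  obtain z where z: "z \<in> cube_face I \<sigma> x r" "dist z y < \<delta>" using y by (auto simp: mem_nbhd)
  have d: "\<bar>z $ i - y $ i\<bar> < \<delta>" for i
    using component_le_norm_cart[of "z - y" i] z(2) by (simp add: dist_norm)
  show "\<bar>y $ i - (x $ i + \<sigma> i * r)\<bar> < \<delta>" if "i \<in> I"
    using z(1) that d[of i] by (auto simp: mem_cube_face)
  have "\<sigma> i = 1 \<or> \<sigma> i = -1" using \<sigma> by auto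
  then have "\<bar>z $ i - x $ i\<bar> \<le> r"
    using z(1) r by (cases "i \<in> I") (auto simp: mem_cube_face)
  then show "\<bar>y $ i - x $ i\<bar> < r + \<delta>" using d[of i] by linarith
qed

subsection \<open>Lower bounds\<close>

lemma ennpowr_ennreal: "x \<ge> 0 \<Longrightarrow> ennpowr (ennreal x) a = ennreal (x powr a)"
  by (simp add: ennpowr_def)

lemma ennpowr_simps [simp]: "ennpowr 0 a = 0" "ennpowr 1 a = 1" "ennpowr \<infinity> a = \<infinity>" "ennpowr top a = top"
  by (simp_all add: ennpowr_def)

lemma ennpowr_mono: "a \<ge> 0 \<Longrightarrow> s \<le> t \<Longrightarrow> ennpowr s a \<le> ennpowr t a"
  by (cases s; cases t) (auto simp: ennpowr_ennreal powr_mono2 top_unique intro!: ennreal_leI)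

lemma ennpowr_mult: "a > 0 \<Longrightarrow> ennpowr (s * t) a = ennpowr s a * ennpowr t a"
proof (cases s; cases t)
  fix x y :: real assume "a > 0" "s = ennreal x" "0 \<le> x" "t = ennreal y" "0 \<le> y"
  then show ?thesis by (simp add: ennpowr_ennreal powr_mult flip: ennreal_mult)
qed (auto simp: ennpowr_ennreal ennreal_mult_top ennreal_top_mult)

lemma ennpowr_ennpowr: "ennpowr (ennpowr t a) b = ennpowr t (a * b)"
  by (cases t) (auto simp: ennpowr_ennreal powr_powr)

lemma measurable_ennpowr [measurable]: "(\<lambda>t. ennpowr t a) \<in> borel_measurable borel"
  unfolding ennpowr_def by measurable

text \<open>Lebesgue measure is by definition the image of a product measure indexed by
  \<open>Basis\<close>. The preimage of the set is again a product, and \<open>ix\<close> translates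
  basis vectors back into coordinates.\<close>

lemma emeasure_lborel_vec_product:
  fixes S :: "'n::finite \<Rightarrow> real set"
  assumes S: "\<And>i. S i \<in> sets borel"
  shows "{y :: real ^ 'n. \<forall>i. y $ i \<in> S i} \<in> sets borel"
    and "emeasure lborel {y :: real ^ 'n. \<forall>i. y $ i \<in> S i} = (\<Prod>i\<in>UNIV. emeasure lborel (S i))"
proof -
  let ?A = "{y :: real ^ 'n. \<forall>i. y $ i \<in> S i}"
  have eq: "?A = (\<Inter>i. (\<lambda>y. y $ i) -` S i)" by auto
  have "(\<lambda>y :: real ^ 'n. y $ i) \<in> borel_measurable borel" for i
    by (intro borel_measurable_continuous_onI continuous_intros)
  then have "(\<lambda>y :: real ^ 'n. y $ i) -` S i \<inter> space borel \<in> sets borel" for i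
    using S by (rule measurable_sets)
  then show meas: "?A \<in> sets borel"
    unfolding eq by (intro sets.countable_INT) auto
  define ix where "ix b = (SOME i. b = axis i (1::real))" for b :: "real ^ 'n"
  have ix: "ix (axis i 1) = i" for i
    unfolding ix_def by (rule some_equality) (auto simp: axis_eq_axis)
  let ?f = "\<lambda>f. \<Sum>b\<in>Basis. f b *\<^sub>R (b :: real ^ 'n)"
  have comp: "?f f $ i = f (axis i 1)" for f i
  proof -
    have "?f f $ i = ?f f \<bullet> axis i 1" by (simp add: inner_axis)
    also have "\<dots> = f (axis i 1)" by (rule inner_sum_left_Basis) (auto simp: Basis_vec_def)
    finally show ?thesis .
  qed
  have pre: "?f -` ?A \<inter> space (PiM Basis (\<lambda>b. interval_measure (\<lambda>x. x))) = PiE Basis (\<lambda>b. S (ix b))"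
  proof (intro equalityI subsetI)
    fix f assume f: "f \<in> ?f -` ?A \<inter> space (PiM Basis (\<lambda>b. interval_measure (\<lambda>x. x)))"
    then have "?f f $ i \<in> S i" for i by blast
    then have *: "f (axis i 1) \<in> S i" for i unfolding comp .
    have "f b \<in> S (ix b)" if "b \<in> Basis" for b
      using that * by (auto simp: Basis_vec_def ix)
    then show "f \<in> PiE Basis (\<lambda>b. S (ix b))" using f by (auto simp: space_PiM PiE_iff)
  next
    fix f assume f: "f \<in> PiE Basis (\<lambda>b. S (ix b))"
    have "f (axis i 1) \<in> S i" for i
      using PiE_mem[OF f, of "axis i 1"] by (auto simp: ix Basis_vec_def)
    then show "f \<in> ?f -` ?A \<inter> space (PiM Basis (\<lambda>b. interval_measure (\<lambda>x. x)))"
      using f comp by (auto simp: space_PiM PiE_iff)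
  qed
  interpret product_sigma_finite "\<lambda>b::real ^ 'n. interval_measure (\<lambda>x. x)"
    by (intro product_sigma_finite.intro sigma_finite_interval_measure) auto
  have "emeasure lborel ?A = emeasure (PiM Basis (\<lambda>b. interval_measure (\<lambda>x. x))) (PiE Basis (\<lambda>b. S (ix b)))"
  proof -
    have f: "?f \<in> measurable (PiM Basis (\<lambda>b. interval_measure (\<lambda>x. x))) borel" by simp
    show ?thesis
      unfolding lborel_def emeasure_distr[OF f meas] pre ..
  qed
  also have "\<dots> = (\<Prod>b\<in>(Basis :: (real ^ 'n) set). emeasure (interval_measure (\<lambda>x. x)) (S (ix b)))"
    using S by (intro emeasure_PiM) auto
  also have "\<dots> = (\<Prod>i\<in>UNIV. emeasure (interval_measure (\<lambda>x. x)) (S i))"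
  proof -
    have "(Basis :: (real ^ 'n) set) = range (\<lambda>i. axis i 1)" by (auto simp: Basis_vec_def)
    moreover have "inj (\<lambda>i::'n. axis i (1::real))" by (simp add: inj_on_def axis_eq_axis)
    ultimately have "bij_betw (\<lambda>i::'n. axis i (1::real)) UNIV Basis" by (simp add: bij_betw_def)
    from prod.reindex_bij_betw[OF this, of "\<lambda>b. emeasure (interval_measure (\<lambda>x. x)) (S (ix b))"]
    show ?thesis by (simp only: ix)
  qed
  finally show "emeasure lborel ?A = (\<Prod>i\<in>UNIV. emeasure lborel (S i))"
    by (simp add: lborel_eq_real)
qed

section \<open>Testing the operator on indicator functions\<close>

lemma skeleton_faces_nonempty:
  fixes x :: "real ^ 'n"
  assumes "k \<le> CARD('n)" "r > 0"
  shows "skeleton_faces k x r \<noteq> {}"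
proof -
  obtain I :: "'n set" where "card I = CARD('n) - k"
    using obtain_subset_with_card_n[of "CARD('n) - k" "UNIV :: 'n set"] by auto
  then have "cube_face I (\<lambda>_. 1) x r \<in> skeleton_faces k x r"
    using assms by (intro cube_face_in_skeleton) auto
  then show ?thesis by auto
qed

lemma one_le_skeleton_maximal_indicator:
  fixes x :: "real ^ 'n"
  assumes k: "k \<le> CARD('n)" and r: "1 \<le> r" "r \<le> 2" and \<delta>: "\<delta> > 0"
    and sub: "\<And>F. F \<in> skeleton_faces k x r \<Longrightarrow> nbhd \<delta> F \<subseteq> E"
  shows "1 \<le> skeleton_maximal k \<delta> (indicat_real E) x"
proof -
  have one: "average_on (nbhd \<delta> F) (indicat_real E) = 1" if F: "F \<in> skeleton_faces k x r" for F
  proof -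
    have "F \<noteq> {}" using F by (auto simp: skeleton_faces_def)
    then have pos: "emeasure lebesgue (nbhd \<delta> F) > 0" using \<delta> by (rule emeasure_nbhd_pos)
    have "F \<subseteq> axis_cube x r" using F by (auto simp: skeleton_faces_def dest: face_of_imp_subset)
    then have "bounded F" unfolding axis_cube_def by (rule bounded_subset[OF bounded_cbox])
    then have fin: "emeasure lebesgue (nbhd \<delta> F) < \<infinity>" by (rule emeasure_nbhd_finite)
    have "(\<integral>\<^sup>+y\<in>nbhd \<delta> F. ennreal \<bar>indicat_real E y\<bar> \<partial>lebesgue) = (\<integral>\<^sup>+y. indicator (nbhd \<delta> F) y \<partial>lebesgue)"
      using sub[OF F] by (intro nn_integral_cong) (auto simp: indicator_def)
    then have "(\<integral>\<^sup>+y\<in>nbhd \<delta> F. ennreal \<bar>indicat_real E y\<bar> \<partial>lebesgue) = emeasure lebesgue (nbhd \<delta> F)"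
      by simp
    then show ?thesis unfolding average_on_def
      using pos fin by (simp add: ennreal_divide_self)
  qed
  have ne: "skeleton_faces k x r \<noteq> {}" using skeleton_faces_nonempty[OF k] r by simp
  have "Min ((\<lambda>F. average_on (nbhd \<delta> F) (indicat_real E)) ` skeleton_faces k x r) = 1"
    using ne one by (intro Min_eqI) (auto simp: finite_skeleton_faces image_iff)
  then show ?thesis
    unfolding skeleton_maximal_def using r by (intro SUP_upper2[of r]) auto
qed

text \<open>The norm of the indicator is the measure of \<open>E\<close> to the power
  \<open>1 / p\<close>, and the maximal function dominates the indicator of \<open>X\<close>.
  Positive measure of \<open>E\<close> makes the test function a nonzero element.\<close>

lemma skeleton_op_norm_ge:
  fixes E X :: "(real ^ 'n) set"
  assumes pq: "p > 0" "q > 0" and E: "E \<in> sets lebesgue" "emeasure lebesgue E > 0"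
      "emeasure lebesgue E \<le> ennreal \<beta>" and \<beta>: "\<beta> > 0"
    and X: "X \<in> sets lebesgue" "emeasure lebesgue X \<ge> ennreal \<mu>" "\<mu> \<ge> 0"
    and M: "\<And>x. x \<in> X \<Longrightarrow> 1 \<le> skeleton_maximal k \<delta> (indicat_real E) x"
  shows "skeleton_op_norm TYPE('n) k \<delta> p q \<ge> ennreal (\<mu> powr (1 / q) / \<beta> powr (1 / p))"
proof -
  define e where "e = measure lebesgue E"
  have fin: "emeasure lebesgue E < \<infinity>" using E(3) by (simp add: le_less_trans)
  then have e: "emeasure lebesgue E = ennreal e"
    unfolding e_def by (intro emeasure_eq_ennreal_measure) auto
  have e0: "e > 0" using E(2) e by simp
  have e\<beta>: "e \<le> \<beta>" using E(3) \<beta> e by simp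
  have norm_f: "Lp_norm p (\<lambda>x. ennreal \<bar>indicat_real E x\<bar>) = ennreal (e powr (1 / p))"
  proof -
    have "(\<integral>\<^sup>+x. ennpowr (ennreal \<bar>indicat_real E x\<bar>) p \<partial>lebesgue) = (\<integral>\<^sup>+x. indicator E x \<partial>lebesgue)"
      by (intro nn_integral_cong) (auto simp: indicator_def)
    then show ?thesis unfolding Lp_norm_def using E(1) e e0 by (simp add: ennpowr_ennreal)
  qed
  have norm_M: "Lp_norm q (skeleton_maximal k \<delta> (indicat_real E)) \<ge> ennreal (\<mu> powr (1 / q))"
  proof -
    have "ennreal \<mu> \<le> (\<integral>\<^sup>+x. indicator X x \<partial>lebesgue)" using X by simp
    also have "\<dots> \<le> (\<integral>\<^sup>+x. ennpowr (skeleton_maximal k \<delta> (indicat_real E) x) q \<partial>lebesgue)"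
    proof (intro nn_integral_mono)
      fix x
      show "indicator X x \<le> ennpowr (skeleton_maximal k \<delta> (indicat_real E) x) q"
        using ennpowr_mono[of q 1] M[of x] pq by (auto simp: indicator_def)
    qed
    finally have "ennpowr (ennreal \<mu>) (1 / q) \<le> Lp_norm q (skeleton_maximal k \<delta> (indicat_real E))"
      unfolding Lp_norm_def using pq by (intro ennpowr_mono) auto
    then show ?thesis using X by (simp add: ennpowr_ennreal)
  qed
  have "\<not> (AE x in lebesgue. indicat_real E x = 0)"
  proof
    assume "AE x in lebesgue. indicat_real E x = 0"
    then have "AE x in lebesgue. x \<notin> E" by (auto simp: indicator_def elim: AE_mp)
    then have "emeasure lebesgue E = 0" using E(1) by (simp add: AE_iff_null_sets null_setsD1)
    then show False using E(2) by simp
  qed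
  then have f: "indicat_real E \<in> nonzero_Lp p"
    unfolding nonzero_Lp_def using E(1) norm_f by simp
  have "ennreal (\<mu> powr (1 / q) / \<beta> powr (1 / p)) \<le> ennreal (\<mu> powr (1 / q) / e powr (1 / p))"
    using e0 e\<beta> pq by (intro ennreal_leI divide_left_mono powr_mono2) auto
  also have "\<dots> = ennreal (\<mu> powr (1 / q)) / ennreal (e powr (1 / p))"
    using e0 by (simp add: divide_ennreal)
  also have "\<dots> \<le> Lp_norm q (skeleton_maximal k \<delta> (indicat_real E)) / Lp_norm p (\<lambda>x. ennreal \<bar>indicat_real E x\<bar>)"
    unfolding norm_f by (intro divide_right_mono_ennreal norm_M)
  also have "\<dots> \<le> skeleton_op_norm TYPE('n) k \<delta> p q"
    unfolding skeleton_op_norm_def using f by (intro SUP_upper)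
  finally show ?thesis .
qed

text \<open>The test set of both lower bounds: near a \<open>k\<close>-face of a cube, at least
  \<open>n - k\<close> coordinates of a point are close to numbers \<open>x_i + r\<close> or
  \<open>x_i - r\<close>. The bound 5 leaves room for \<open>1 + 2 + \<delta>\<close>, the
  contributions of center, radius and neighborhood.\<close>

definition coord_set :: "nat \<Rightarrow> real set \<Rightarrow> (real ^ 'n) set" where
  "coord_set d D = {y. (\<forall>i. \<bar>y $ i\<bar> \<le> 5) \<and> (\<exists>I. card I = d \<and> (\<forall>i\<in>I. y $ i \<in> D))}"

text \<open>The set is a union of at most \<open>2 ^ n\<close> products, in dimension
  \<open>n\<close>. In each, \<open>d\<close> sides have measure at most \<open>\<beta>\<close> and
  the others have length 10; this gives \<open>2 ^ n * 10 ^ n = 20 ^ n\<close>.\<close>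

lemma emeasure_coord_set_le:
  assumes D: "D \<in> sets borel" "emeasure lborel (D \<inter> {-5..5}) \<le> ennreal \<beta>" and \<beta>: "\<beta> \<ge> 0"
  shows "(coord_set d D :: (real ^ 'n) set) \<in> sets lebesgue"
    and "emeasure lebesgue (coord_set d D :: (real ^ 'n) set) \<le> ennreal (20 ^ CARD('n) * \<beta> ^ d)"
proof -
  define S where "S I i = (if i \<in> I then D \<inter> {-5..5} else {-5..5::real})" for I and i :: 'n
  define P where "P I = {y :: real ^ 'n. \<forall>i. y $ i \<in> S I i}" for I
  have eq: "coord_set d D = (\<Union>I\<in>{I. card I = d}. P I)"
    unfolding coord_set_def P_def S_def by (auto simp: abs_le_iff minus_le_iff)
  have SB: "S I i \<in> sets borel" for I i using D by (auto simp: S_def)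
  have PB: "P I \<in> sets borel" for I unfolding P_def by (rule emeasure_lborel_vec_product(1)[OF SB])
  have B: "(coord_set d D :: (real ^ 'n) set) \<in> sets borel" unfolding eq using PB by auto
  then show "(coord_set d D :: (real ^ 'n) set) \<in> sets lebesgue" by simp
  have "emeasure lborel (P I) \<le> ennreal (10 ^ CARD('n) * \<beta> ^ d)" if I: "card I = d" for I
  proof -
    have "emeasure lborel (P I) = (\<Prod>i\<in>UNIV. emeasure lborel (S I i))"
      unfolding P_def by (rule emeasure_lborel_vec_product(2)[OF SB])
    also have "\<dots> \<le> (\<Prod>i\<in>UNIV. ennreal (if i \<in> I then \<beta> else 10))"
      using D(2) by (intro prod_mono_ennreal) (auto simp: S_def)
    also have "\<dots> = ennreal (\<Prod>i\<in>UNIV. if i \<in> I then \<beta> else 10)"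
      using \<beta> by (intro prod_ennreal) auto
    also have "(\<Prod>i\<in>UNIV. if i \<in> I then \<beta> else 10) = \<beta> ^ d * 10 ^ card (- I)"
      using I by (simp add: prod.If_cases)
    also have "ennreal \<dots> \<le> ennreal (10 ^ CARD('n) * \<beta> ^ d)"
      using \<beta> card_mono[of "UNIV :: 'n set" "- I"]
      by (intro ennreal_leI) (auto simp: mult.commute[of "10 ^ _"] intro!: mult_left_mono power_increasing)
    finally show ?thesis .
  qed
  then have "emeasure lborel (coord_set d D :: (real ^ 'n) set) \<le> (\<Sum>I\<in>{I::'n set. card I = d}. ennreal (10 ^ CARD('n) * \<beta> ^ d))"
    unfolding eq using PB by (intro order_trans[OF emeasure_subadditive_finite] sum_mono) auto
  also have "\<dots> = ennreal (card {I::'n set. card I = d} * (10 ^ CARD('n) * \<beta> ^ d))"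
    using \<beta> by (simp add: ennreal_mult ennreal_of_nat_eq_real_of_nat)
  also have "\<dots> \<le> ennreal (2 ^ CARD('n) * (10 ^ CARD('n) * \<beta> ^ d))"
  proof -
    have "card {I::'n set. card I = d} \<le> card (Pow (UNIV :: 'n set))"
      by (rule card_mono) auto
    then have "card {I::'n set. card I = d} \<le> 2 ^ CARD('n)" by (simp add: card_Pow)
    then have "real (card {I::'n set. card I = d}) \<le> 2 ^ CARD('n)"
      by (metis of_nat_le_iff of_nat_numeral of_nat_power)
    then show ?thesis using \<beta> by (intro ennreal_leI mult_right_mono) auto
  qed
  also have "2 ^ CARD('n) * (10 ^ CARD('n) * \<beta> ^ d) = 20 ^ CARD('n) * \<beta> ^ d"
    by (simp flip: power_mult_distrib mult.assoc)
  finally show "emeasure lebesgue (coord_set d D :: (real ^ 'n) set) \<le> ennreal (20 ^ CARD('n) * \<beta> ^ d)"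
    using B by simp
qed

lemma nbhd_skeleton_face_subset_coord_set:
  fixes x :: "real ^ 'n"
  assumes F: "F \<in> skeleton_faces k x r" and d: "d + k = CARD('n)"
    and x: "\<And>i. \<bar>x $ i\<bar> \<le> 1" and r: "1 \<le> r" "r \<le> 2" and \<delta>: "\<delta> < 1"
    and D: "\<And>i t. \<bar>t - (x $ i + r)\<bar> < \<delta> \<Longrightarrow> t \<in> D" "\<And>i t. \<bar>t - (x $ i - r)\<bar> < \<delta> \<Longrightarrow> t \<in> D"
  shows "nbhd \<delta> F \<subseteq> coord_set d D"
proof
  fix y assume "y \<in> nbhd \<delta> F"
  then obtain z where z: "z \<in> F" "dist z y < \<delta>" by (auto simp: mem_nbhd)
  have dz: "\<bar>z $ i - y $ i\<bar> < \<delta>" for i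
    using component_le_norm_cart[of "z - y" i] z(2) by (simp add: dist_norm)
  have "z \<in> axis_cube x r" using F z(1) by (auto simp: skeleton_faces_def dest: face_of_imp_subset)
  then have zx: "\<bar>z $ i - x $ i\<bar> \<le> r" for i by (simp add: mem_axis_cube)
  have "\<bar>y $ i\<bar> \<le> 5" for i using dz[of i] zx[of i] x[of i] r \<delta> by linarith
  moreover have "d \<le> card {i. \<bar>z $ i - x $ i\<bar> = r}"
    using card_extreme_coords_ge[OF F z(1)] d by simp
  then obtain I where I: "I \<subseteq> {i. \<bar>z $ i - x $ i\<bar> = r}" "card I = d"
    using obtain_subset_with_card_n by metis
  moreover have "y $ i \<in> D" if "i \<in> I" for i
  proof -
    have "\<bar>z $ i - x $ i\<bar> = r" using I that by auto
    then have "z $ i = x $ i + r \<or> z $ i = x $ i - r" by linarith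
    then show ?thesis using D[of "y $ i" i] dz[of i] by (auto simp: abs_minus_commute)
  qed
  ultimately show "y \<in> coord_set d D" by (auto simp: coord_set_def)
qed

text \<open>Reduces a lower bound to one-dimensional data: a set \<open>D\<close> and, for each
  center in \<open>X\<close>, one radius for which the \<open>\<delta>\<close>-neighborhoods of all
  the numbers \<open>x_i + r\<close> and \<open>x_i - r\<close> lie in \<open>D\<close>.\<close>

lemma skeleton_op_norm_ge_coord_set:
  fixes X :: "(real ^ 'n) set"
  assumes pq: "p > 0" "q > 0" and d: "d + k = CARD('n)" and \<delta>: "0 < \<delta>" "\<delta> < 1"
    and D: "D \<in> sets borel" "emeasure lborel (D \<inter> {-5..5}) \<le> ennreal \<beta>" "\<beta> > 0"
    and X: "X \<in> sets lebesgue" "emeasure lebesgue X \<ge> ennreal \<mu>" "\<mu> \<ge> 0" "X \<noteq> {}"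
    and x: "\<And>x i. x \<in> X \<Longrightarrow> \<bar>x $ i\<bar> \<le> 1"
    and r: "\<And>x. x \<in> X \<Longrightarrow> \<exists>r. 1 \<le> r \<and> r \<le> 2 \<and>
        (\<forall>i t. \<bar>t - (x $ i + r)\<bar> < \<delta> \<or> \<bar>t - (x $ i - r)\<bar> < \<delta> \<longrightarrow> t \<in> D)"
  shows "skeleton_op_norm TYPE('n) k \<delta> p q \<ge> ennreal (\<mu> powr (1 / q) / (20 ^ CARD('n) * \<beta> ^ d) powr (1 / p))"
proof -
  have ok: "\<exists>r. 1 \<le> r \<and> r \<le> 2 \<and> (\<forall>F\<in>skeleton_faces k x r. nbhd \<delta> F \<subseteq> coord_set d D)" if xX: "x \<in> X" for x
  proof -
    obtain r where r12: "1 \<le> r" "r \<le> 2"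
      and rD: "\<forall>i t. \<bar>t - (x $ i + r)\<bar> < \<delta> \<or> \<bar>t - (x $ i - r)\<bar> < \<delta> \<longrightarrow> t \<in> D"
      using r[OF xX] by blast
    have "nbhd \<delta> F \<subseteq> coord_set d D" if F: "F \<in> skeleton_faces k x r" for F
      by (rule nbhd_skeleton_face_subset_coord_set[OF F d x[OF xX] r12 \<delta>(2)]) (use rD in blast)+
    with r12 show ?thesis by blast
  qed
  have k: "k \<le> CARD('n)" using d by simp
  \<comment> \<open>The test set contains a face neighborhood of a cube centered in the nonempty set
    \<open>X\<close>, hence has positive measure.\<close>
  have "emeasure lebesgue (coord_set d D :: (real ^ 'n) set) > 0"
  proof -
    obtain x where "x \<in> X" using X(4) by auto
    then obtain r where r: "1 \<le> r" "\<forall>F\<in>skeleton_faces k x r. nbhd \<delta> F \<subseteq> coord_set d D"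
      using ok by blast
    obtain F where F: "F \<in> skeleton_faces k x r" using skeleton_faces_nonempty[OF k, of r x] r by auto
    then have "F \<noteq> {}" by (auto simp: skeleton_faces_def)
    then have "0 < emeasure lebesgue (nbhd \<delta> F)" using \<delta> by (intro emeasure_nbhd_pos) auto
    also have "\<dots> \<le> emeasure lebesgue (coord_set d D :: (real ^ 'n) set)"
      using r F D by (intro emeasure_mono emeasure_coord_set_le(1)[of D \<beta>]) auto
    finally show ?thesis .
  qed
  note pos = this
  have \<beta>: "\<beta> \<ge> 0" "20 ^ CARD('n) * \<beta> ^ d > 0" using D(3) by auto
  show ?thesis
  proof (rule skeleton_op_norm_ge[OF pq emeasure_coord_set_le(1)[OF D(1,2) \<beta>(1)] pos
        emeasure_coord_set_le(2)[OF D(1,2) \<beta>(1)] \<beta>(2) X(1-3)])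
    fix x assume "x \<in> X"
    then obtain r where "1 \<le> r" "r \<le> 2" "\<forall>F\<in>skeleton_faces k x r. nbhd \<delta> F \<subseteq> coord_set d D"
      using ok by blast
    then show "1 \<le> skeleton_maximal k \<delta> (indicat_real (coord_set d D)) x"
      by (intro one_le_skeleton_maximal_indicator[OF k _ _ \<delta>(1)]) auto
  qed
qed

text \<open>The radius 1 serves all centers within \<open>\<delta>\<close> of the origin in each
  coordinate. These have measure \<open>(2 * \<delta>) ^ n\<close>, while the test set has measure
  of order at most \<open>\<delta> ^ (n - k)\<close>.\<close>

lemma skeleton_op_norm_lower_ball:
  assumes k: "k < CARD('n::finite)" and pq: "p > 0" "q > 0"
  shows "\<exists>c>0. \<forall>\<delta>\<in>{0<..<1}. ennreal (c * \<delta> powr (real CARD('n) / q - (real CARD('n) - real k) / p))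
    \<le> skeleton_op_norm TYPE('n) k \<delta> p q"
proof -
  define n where "n = CARD('n)"
  define d where "d = n - k"
  have d: "d + k = CARD('n)" "d \<ge> 1" "real d = real n - real k" using k by (auto simp: d_def n_def)
  define c where "c = (2 powr (real n / q)) / (20 ^ n * 8 ^ d) powr (1 / p)"
  have "ennreal (c * \<delta> powr (real n / q - (real n - real k) / p)) \<le> skeleton_op_norm TYPE('n) k \<delta> p q"
    if \<delta>: "\<delta> \<in> {0<..<1}" for \<delta>
  proof -
    have \<delta>01: "0 < \<delta>" "\<delta> < 1" using \<delta> by auto
    \<comment> \<open>One \<open>\<delta>\<close> accounts for the position of the center and one
      for the neighborhood; the total length is at most \<open>8 * \<delta>\<close>.\<close>
    define D where "D = {1 - 2 * \<delta>..1 + 2 * \<delta>} \<union> {-1 - 2 * \<delta>..-1 + 2 * \<delta>}"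
    define X where "X = (cbox (\<chi> i. - \<delta>) (\<chi> i. \<delta>) :: (real ^ 'n) set)"
    have "ennreal (((2 * \<delta>) ^ n) powr (1 / q) / (20 ^ CARD('n) * (8 * \<delta>) ^ d) powr (1 / p)) \<le> skeleton_op_norm TYPE('n) k \<delta> p q"
    proof (rule skeleton_op_norm_ge_coord_set[OF pq d(1) \<delta>01, of D "8 * \<delta>" X])
      show "D \<in> sets borel" by (simp add: D_def)
      have "emeasure lborel (D \<inter> {-5..5}) \<le> emeasure lborel D"
        by (intro emeasure_mono) (auto simp: D_def)
      also have "\<dots> \<le> emeasure lborel {1 - 2 * \<delta>..1 + 2 * \<delta>} + emeasure lborel {-1 - 2 * \<delta>..-1 + 2 * \<delta>}"
        unfolding D_def by (intro emeasure_subadditive) auto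
      also have "\<dots> = ennreal (8 * \<delta>)"
        using \<delta>01 by (simp flip: ennreal_plus)
      finally show "emeasure lborel (D \<inter> {-5..5}) \<le> ennreal (8 * \<delta>)" .
      show "emeasure lebesgue X \<ge> ennreal ((2 * \<delta>) ^ n)"
        unfolding X_def using \<delta>01 by (subst emeasure_lebesgue_cbox_cart) (auto simp: n_def)
      show "X \<noteq> {}" unfolding X_def using \<delta>01 by (auto simp: interval_ne_empty_cart)
      fix x assume x: "x \<in> X"
      then have x\<delta>: "\<bar>x $ i\<bar> \<le> \<delta>" for i by (auto simp: X_def mem_box_cart abs_le_iff minus_le_iff)
      show "\<bar>x $ i\<bar> \<le> 1" for i using x\<delta>[of i] \<delta>01 by linarith
      have "t \<in> D" if "\<bar>t - (x $ i + 1)\<bar> < \<delta> \<or> \<bar>t - (x $ i - 1)\<bar> < \<delta>" for i t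
        using that x\<delta>[of i] by (auto simp: D_def)
      then show "\<exists>r\<ge>1. r \<le> 2 \<and> (\<forall>i t. \<bar>t - (x $ i + r)\<bar> < \<delta> \<or> \<bar>t - (x $ i - r)\<bar> < \<delta> \<longrightarrow> t \<in> D)"
        by (intro exI[of _ 1]) auto
    qed (use \<delta>01 in \<open>auto simp: X_def\<close>)
    moreover have "((2 * \<delta>) ^ n) powr (1 / q) / (20 ^ CARD('n) * (8 * \<delta>) ^ d) powr (1 / p) =
       c * \<delta> powr (real n / q - (real n - real k) / p)"
      using \<delta>01 by (simp add: c_def n_def d(3)[symmetric, unfolded n_def] power_mult_distrib powr_mult powr_diff powr_powr flip: powr_realpow)
    ultimately show ?thesis by simp
  qed
  moreover have "c > 0" by (simp add: c_def)
  ultimately show ?thesis unfolding n_def by blast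
qed

text \<open>Choosing the radius greedily from coarse to fine scales, each later step moves the earlier
  sums by at most twice the spacing of the next lattice.\<close>

lemma radius_near_nested_lattices:
  fixes s :: "nat \<Rightarrow> real"
  assumes b: "b \<ge> 2" and h: "h > 0"
  shows "\<exists>r. r0 \<le> r \<and> r \<le> r0 + 2 * h \<and>
    (\<forall>j<N. \<exists>m::int. \<bar>r + s j - m * (h / b ^ j)\<bar> \<le> 2 * (h / b ^ j) / b)"
  using h
proof (induction N arbitrary: r0 h s)
  case 0
  then show ?case by (intro exI[of _ r0]) auto
next
  case (Suc N)
  \<comment> \<open>Rounding up to the coarsest lattice: \<open>r1 + s 0\<close> is a lattice point,
    and \<open>r1\<close> exceeds \<open>r0\<close> by at most \<open>h\<close>.\<close>
  define m where "m = \<lceil>(r0 + s 0) / h\<rceil>"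
  define r1 where "r1 = m * h - s 0"
  have "(r0 + s 0) / h \<le> m" "m < (r0 + s 0) / h + 1" unfolding m_def by linarith+
  then have r1: "r0 \<le> r1" "r1 \<le> r0 + h"
    using Suc.prems by (auto simp: r1_def field_simps)
  \<comment> \<open>The finer scales move the radius by at most \<open>2 * (h / b) \<le> h\<close>.
    This yields both the total bound \<open>2 * h\<close> and the distance of \<open>r + s 0\<close>
    from the coarsest lattice.\<close>
  have hb: "h / b > 0" "2 * (h / b) \<le> h" using b Suc.prems by (auto simp: field_simps)
  obtain r where r: "r1 \<le> r" "r \<le> r1 + 2 * (h / b)"
    "\<forall>j<N. \<exists>m::int. \<bar>r + s (Suc j) - m * (h / b / b ^ j)\<bar> \<le> 2 * (h / b / b ^ j) / b"
    using Suc.IH[OF hb(1), of r1 "\<lambda>j. s (Suc j)"] by blast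
  have "\<exists>m::int. \<bar>r + s j - m * (h / b ^ j)\<bar> \<le> 2 * (h / b ^ j) / b" if "j < Suc N" for j
  proof (cases j)
    case 0
    have "\<bar>r + s 0 - m * h\<bar> \<le> 2 * h / b"
      using r(1,2) by (simp add: r1_def)
    then show ?thesis using 0 by (intro exI[of _ m]) simp
  next
    case (Suc i)
    then show ?thesis using r(3) that by (simp add: divide_divide_eq_left)
  qed
  then show ?case using r(1,2) r1 hb by (intro exI[of _ r]) auto
qed

text \<open>At most \<open>2 * ((5 + W) / h) + 1\<close> intervals of length \<open>2 * w\<close>
  meet \<open>{-5..5}\<close>. As \<open>1 \<le> 1 / h\<close>, this gives the constant
  \<open>2 * (10 + 2 * W + 1) = 4 * W + 22\<close>.\<close>

lemma emeasure_lattice_nbhd_le: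
  fixes h w W :: real
  assumes h: "0 < h" "h \<le> 1" and w: "0 \<le> w" "w \<le> W"
  shows "{t. \<exists>m::int. \<bar>t - m * h\<bar> \<le> w} \<in> sets borel"
    and "emeasure lborel ({t. \<exists>m::int. \<bar>t - m * h\<bar> \<le> w} \<inter> {-5..5}) \<le> ennreal ((4 * W + 22) * w / h)"
proof -
  let ?I = "\<lambda>m::int. {m * h - w..m * h + w}"
  have eq: "{t. \<exists>m::int. \<bar>t - m * h\<bar> \<le> w} = (\<Union>m. ?I m)"
    by (auto simp: abs_le_iff algebra_simps)
  show B: "{t. \<exists>m::int. \<bar>t - m * h\<bar> \<le> w} \<in> sets borel"
    unfolding eq by (intro sets.countable_UN) auto
  define M where "M = \<lfloor>(5 + W) / h\<rfloor>"
  have M0: "M \<ge> 0" using h w by (simp add: M_def)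
  have M: "real_of_int M \<le> (5 + W) / h" by (simp add: M_def)
  have "{t. \<exists>m::int. \<bar>t - m * h\<bar> \<le> w} \<inter> {-5..5} \<subseteq> (\<Union>m\<in>{-M..M}. ?I m)"
  proof
    fix t assume "t \<in> {t. \<exists>m::int. \<bar>t - m * h\<bar> \<le> w} \<inter> {-5..5}"
    then obtain m :: int where m: "\<bar>t - m * h\<bar> \<le> w" "\<bar>t\<bar> \<le> 5" by auto
    then have "\<bar>m * h\<bar> \<le> 5 + W" using w by linarith
    then have "real_of_int \<bar>m\<bar> * h \<le> 5 + W" using h by (simp add: abs_mult)
    then have "real_of_int \<bar>m\<bar> \<le> (5 + W) / h" using h by (simp add: field_simps)
    then have "\<bar>m\<bar> \<le> M" unfolding M_def by (simp add: le_floor_iff)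
    then show "t \<in> (\<Union>m\<in>{-M..M}. ?I m)"
      using m(1) by (intro UN_I[of m]) (auto simp: abs_le_iff)
  qed
  then have "emeasure lborel ({t. \<exists>m::int. \<bar>t - m * h\<bar> \<le> w} \<inter> {-5..5}) \<le> emeasure lborel (\<Union>m\<in>{-M..M}. ?I m)"
    by (intro emeasure_mono) auto
  also have "\<dots> \<le> (\<Sum>m\<in>{-M..M}. emeasure lborel (?I m))"
    by (intro emeasure_subadditive_finite) auto
  also have "\<dots> = (\<Sum>m\<in>{-M..M}. ennreal (2 * w))"
    using w by (intro sum.cong) auto
  also have "\<dots> = ennreal (real (nat (2 * M + 1)) * (2 * w))"
    using w by (simp add: ennreal_mult ennreal_of_nat_eq_real_of_nat)
  also have "\<dots> \<le> ennreal ((4 * W + 22) * w / h)"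
  proof (intro ennreal_leI)
    have "real (nat (2 * M + 1)) * (2 * w) \<le> (2 * ((5 + W) / h) + 1 / h) * (2 * w)"
    proof (intro mult_right_mono)
      have "real (nat (2 * M + 1)) = 2 * M + 1" using M0 by simp
      also have "\<dots> \<le> 2 * ((5 + W) / h) + 1 / h" 
      proof -
        have "1 \<le> 1 / h" using h by simp
        moreover have "2 * real_of_int M \<le> 2 * ((5 + W) / h)" using M by (rule mult_left_mono) simp
        ultimately show ?thesis by linarith
      qed
      finally show "real (nat (2 * M + 1)) \<le> 2 * ((5 + W) / h) + 1 / h" .
    qed (use w in auto)
    also have "\<dots> = (4 * W + 22) * w / h" using h by (simp add: field_simps)
    finally show "real (nat (2 * M + 1)) * (2 * w) \<le> (4 * W + 22) * w / h" .
  qed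
  finally show "emeasure lborel ({t. \<exists>m::int. \<bar>t - m * h\<bar> \<le> w} \<inter> {-5..5}) \<le> ennreal ((4 * W + 22) * w / h)" .
qed

text \<open>At each scale the lattice neighborhood has density of order at most
  \<open>1 / b\<close>, so \<open>D\<close> has measure of order at most
  \<open>\<delta> powr (1 / (2 * n))\<close> in the bounded window. Every center in the unit cube
  admits a good radius, so \<open>X\<close> has measure 1 and \<open>q\<close> drops out of the
  bound.\<close>

lemma skeleton_op_norm_lower_lattice:
  assumes k: "k < CARD('n::finite)" and pq: "p > 0" "q > 0"
  shows "\<exists>c>0. \<forall>\<delta>\<in>{0<..<1}. ennreal (c * \<delta> powr ((real k - real CARD('n)) / (2 * real CARD('n) * p)))
    \<le> skeleton_op_norm TYPE('n) k \<delta> p q"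
proof -
  define n where "n = CARD('n)"
  have n1: "n \<ge> 1" by (simp add: n_def Suc_le_eq)
  define d where "d = n - k"
  have d: "d + k = CARD('n)" "d \<ge> 1" "real d = real n - real k" using k by (auto simp: d_def n_def)
  \<comment> \<open>The summand 2 covers the error \<open>2 * h j / b\<close> of the greedy radius;
    the other covers the neighborhood, since
    \<open>\<delta> \<le> 4 ^ n / b ^ Suc j = 2 * 4 ^ n * h j / b\<close>.\<close>
  define C where "C = (2 + 2 * 4 ^ n :: real)"
  have C: "C > 0" by (simp add: C_def add_pos_pos)
  define K where "K = (4 * C + 22) * C * real n"
  have K: "K > 0" using C n1 by (simp add: K_def add_pos_pos)
  define c where "c = 1 / (20 ^ n * K ^ d) powr (1 / p)"
  have c: "c > 0" using K by (simp add: c_def)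
  have "ennreal (c * \<delta> powr ((real k - real n) / (2 * real n * p))) \<le> skeleton_op_norm TYPE('n) k \<delta> p q"
    if \<delta>: "\<delta> \<in> {0<..<1}" for \<delta>
  proof -
    have \<delta>01: "0 < \<delta>" "\<delta> < 1" using \<delta> by auto
    \<comment> \<open>The factor 2 secures \<open>b \<ge> 2\<close> for the greedy choice; the
      exponent makes \<open>b ^ (2 * n)\<close> comparable to \<open>1 / \<delta>\<close>, so that
      even the finest of the \<open>2 * n\<close> widths is at least
      \<open>\<delta>\<close>.\<close>
    define b where "b = 2 * \<delta> powr (- 1 / (2 * n))"
    have "1 \<le> \<delta> powr (- 1 / (2 * n))" using \<delta>01 n1 powr_mono2[of "1 / (2 * n)" \<delta> 1]
      by (simp add: powr_minus_divide)
    then have b: "b \<ge> 2" by (simp add: b_def)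
    have bn: "b ^ (2 * n) = 4 ^ n / \<delta>"
    proof -
      have "b ^ (2 * n) = 2 ^ (2 * n) * (\<delta> powr (- 1 / (2 * n))) powr (real (2 * n))"
        using \<delta>01 by (simp add: b_def power_mult_distrib flip: powr_realpow)
      also have "(\<delta> powr (- 1 / (2 * n))) powr (real (2 * n)) = 1 / \<delta>"
      proof -
        have "(- 1 / (2 * n)) * real (2 * n) = - 1" using n1 by simp
        then show ?thesis using \<delta>01 by (simp only: powr_powr) (simp add: powr_minus_divide)
      qed
      finally show ?thesis by (simp add: power_mult)
    qed
    define h where "h j = (1 / 2) / b ^ j" for j :: nat
    have h: "0 < h j" "h j \<le> 1" for j
    proof -
      have "1 \<le> b ^ j" using b by (intro one_le_power) simp
      then show "0 < h j" "h j \<le> 1" by (auto simp: h_def field_simps)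
    qed
    define w where "w j = C * h j / b" for j :: nat
    have w: "0 \<le> w j" "w j \<le> C" for j
    proof -
      show "0 \<le> w j" using C h[of j] b by (simp add: w_def)
      have "h j / b \<le> 1 / 1" using h[of j] b by (intro frac_le) auto
      then show "w j \<le> C" using C mult_left_mono[of "h j / b" 1 C] by (simp add: w_def)
    qed
    have fat: "2 * h j / b + \<delta> \<le> w j" if "j < 2 * n" for j
    proof -
      have "b ^ Suc j \<le> b ^ (2 * n)" using that b by (intro power_increasing) auto
      then have "\<delta> \<le> 4 ^ n / b ^ Suc j"
        unfolding bn using \<delta>01 b by (simp add: field_simps)
      also have "\<dots> = 2 * 4 ^ n * h j / b" by (simp add: h_def)
      finally show ?thesis by (simp add: w_def C_def add_divide_distrib ring_distribs)
    qed
    define Dj where "Dj j = {t. \<exists>m::int. \<bar>t - m * h j\<bar> \<le> w j}" for j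
    define D where "D = (\<Union>j<2 * n. Dj j)"
    have Dj: "Dj j \<in> sets borel" "emeasure lborel (Dj j \<inter> {-5..5}) \<le> ennreal ((4 * C + 22) * C / b)" for j
    proof -
      show "Dj j \<in> sets borel" unfolding Dj_def by (rule emeasure_lattice_nbhd_le(1)[OF h w])
      have "(4 * C + 22) * w j / h j = (4 * C + 22) * C / b" using h(1)[of j] by (simp add: w_def)
      then show "emeasure lborel (Dj j \<inter> {-5..5}) \<le> ennreal ((4 * C + 22) * C / b)"
        unfolding Dj_def using emeasure_lattice_nbhd_le(2)[OF h w, of j j] by simp
    qed
    define \<beta> where "\<beta> = K * \<delta> powr (1 / (2 * n))"
    have b_inv: "1 / b = \<delta> powr (1 / (2 * n)) / 2" using \<delta>01 by (simp add: b_def powr_minus_divide)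
    define X where "X = (cbox 0 (\<chi> i. 1) :: (real ^ 'n) set)"
    have "ennreal (1 powr (1 / q) / (20 ^ CARD('n) * \<beta> ^ d) powr (1 / p)) \<le> skeleton_op_norm TYPE('n) k \<delta> p q"
    proof (rule skeleton_op_norm_ge_coord_set[OF pq d(1) \<delta>01, of D \<beta> X])
      show "D \<in> sets borel" unfolding D_def using Dj(1) by auto
      have "D \<inter> {-5..5} = (\<Union>j<2 * n. Dj j \<inter> {-5..5})" by (auto simp: D_def)
      moreover have "emeasure lborel (\<Union>j<2 * n. Dj j \<inter> {-5..5}) \<le> (\<Sum>j<2 * n. emeasure lborel (Dj j \<inter> {-5..5}))"
        using Dj(1) by (intro emeasure_subadditive_finite) auto
      ultimately have "emeasure lborel (D \<inter> {-5..5}) \<le> (\<Sum>j<2 * n. emeasure lborel (Dj j \<inter> {-5..5}))"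
        by simp
      also have "\<dots> \<le> (\<Sum>j<2 * n. ennreal ((4 * C + 22) * C / b))" by (intro sum_mono Dj)
      also have "\<dots> = ennreal (2 * n * ((4 * C + 22) * C / b))"
        using C b by (subst sum_ennreal) auto
      also have "2 * n * ((4 * C + 22) * C / b) = \<beta>"
      proof -
        have "2 * n * ((4 * C + 22) * C / b) = 2 * K * (1 / b)" by (simp add: K_def)
        then show ?thesis unfolding b_inv by (simp add: \<beta>_def)
      qed
      finally show "emeasure lborel (D \<inter> {-5..5}) \<le> ennreal \<beta>" .
      show "\<beta> > 0" using K \<delta>01 by (simp add: \<beta>_def)
      show "emeasure lebesgue X \<ge> ennreal 1"
        unfolding X_def by (subst emeasure_lebesgue_cbox_cart) auto
      show "X \<noteq> {}" unfolding X_def by (auto simp: interval_ne_empty_cart)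
      fix x assume x: "x \<in> X"
      then show "\<bar>x $ i\<bar> \<le> 1" for i by (auto simp: X_def mem_box_cart)
      obtain e :: "nat \<Rightarrow> 'n" where e: "bij_betw e {0..<n} UNIV"
        using ex_bij_betw_nat_finite[of "UNIV :: 'n set"] by (auto simp: n_def)
      \<comment> \<open>The first \<open>n\<close> entries prescribe \<open>r + x_i\<close>, the
        last \<open>n\<close> prescribe \<open>r - x_i\<close>, the negative of the lower end
        \<open>x_i - r\<close>. Each of the \<open>2 * n\<close> entries receives a scale of its
        own.\<close>
      define s where "s j = (if j < n then x $ e j else - x $ e (j - n))" for j
      \<comment> \<open>Start 1 and coarsest spacing \<open>1 / 2\<close> keep the radius between 1
        and 2.\<close>
      obtain r where r: "1 \<le> r" "r \<le> 1 + 2 * (1 / 2)"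
          "\<And>j. j < 2 * n \<Longrightarrow> \<exists>m::int. \<bar>r + s j - m * h j\<bar> \<le> 2 * h j / b"
        using radius_near_nested_lattices[OF b, of "1/2" 1 "2 * n" s] unfolding h_def by auto
      have "t \<in> D" if t: "\<bar>t - (x $ i + r)\<bar> < \<delta> \<or> \<bar>t - (x $ i - r)\<bar> < \<delta>" for i t
      proof -
        obtain l where l: "l < n" "e l = i" using e by (metis UNIV_I atLeastLessThan_iff bij_betw_iff_bijections)
        from t show ?thesis
        proof
          assume t1: "\<bar>t - (x $ i + r)\<bar> < \<delta>"
          obtain m :: int where "\<bar>r + s l - m * h l\<bar> \<le> 2 * h l / b" using r(3)[of l] l by auto
          then have "\<bar>t - m * h l\<bar> \<le> w l" using t1 fat[of l] l by (simp add: s_def)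
          then show ?thesis using l by (auto simp: D_def Dj_def intro!: bexI[of _ l])
        next
          assume t2: "\<bar>t - (x $ i - r)\<bar> < \<delta>"
          obtain m :: int where "\<bar>r + s (n + l) - m * h (n + l)\<bar> \<le> 2 * h (n + l) / b"
            using r(3)[of "n + l"] l by auto
          \<comment> \<open>The lattice is symmetric: if \<open>r - x_i\<close> is close to
            \<open>m * h (n + l)\<close>, then \<open>x_i - r\<close> is close to its
            negative.\<close>
          then have "\<bar>t - of_int (- m) * h (n + l)\<bar> \<le> w (n + l)" using t2 fat[of "n + l"] l by (simp add: s_def)
          then have "t \<in> Dj (n + l)" unfolding Dj_def by blast
          then show ?thesis using l unfolding D_def by (intro UN_I[of "n + l"]) auto
        qed
      qed
      then show "\<exists>r\<ge>1. r \<le> 2 \<and> (\<forall>i t. \<bar>t - (x $ i + r)\<bar> < \<delta> \<or> \<bar>t - (x $ i - r)\<bar> < \<delta> \<longrightarrow> t \<in> D)"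
        using r(1,2) by (intro exI[of _ r]) auto
    qed (auto simp: X_def)
    moreover have "1 powr (1 / q) / (20 ^ CARD('n) * \<beta> ^ d) powr (1 / p) =
       c * \<delta> powr ((real k - real n) / (2 * real n * p))"
    proof -
      have "(\<delta> powr (1 / (2 * n))) ^ d = \<delta> powr (d / (2 * n))"
        using \<delta>01 by (simp add: powr_powr flip: powr_realpow)
      then have "(20 ^ CARD('n) * \<beta> ^ d) powr (1 / p) = (20 ^ n * K ^ d) powr (1 / p) * \<delta> powr (d / (2 * n * p))"
        using K \<delta>01 by (simp add: \<beta>_def n_def power_mult_distrib powr_mult powr_powr flip: mult.assoc)
      moreover have "(real k - real n) / (2 * real n * p) = - (d / (2 * n * p))"
        unfolding d(3) by (simp add: minus_divide_left)
      ultimately show ?thesis by (simp add: c_def powr_minus_divide)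
    qed
    ultimately show ?thesis by simp
  qed
  then show ?thesis using c unfolding n_def by blast
qed

subsection \<open>Discretisation of the maximal operator\<close>

text \<open>Up to the factor 2 this is Jensen's inequality; it follows from
  \<open>t \<le> c + t\<^sup>p c\<^sup>1\<^sup>-\<^sup>p\<close> with \<open>c\<close> the mean of order \<open>p\<close>.\<close>

lemma average_on_le_power_mean:
  fixes f :: "real ^ 'n \<Rightarrow> real"
  assumes A: "A \<in> sets lebesgue" "emeasure lebesgue A > 0" "emeasure lebesgue A < \<infinity>"
    and f: "f \<in> borel_measurable lebesgue" and p: "p \<ge> 1"
  shows "average_on A f \<le>
    2 * ennpowr ((\<integral>\<^sup>+y\<in>A. ennpowr (ennreal \<bar>f y\<bar>) p \<partial>lebesgue) / emeasure lebesgue A) (1 / p)"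
proof -
  define B where "B = (\<integral>\<^sup>+y\<in>A. ennpowr (ennreal \<bar>f y\<bar>) p \<partial>lebesgue) / emeasure lebesgue A"
  \<comment> \<open>The height \<open>c\<close> stays free until the end. For \<open>B = 0\<close>
    it tends to 0; for finite positive \<open>B\<close> the choice \<open>B powr (1 / p)\<close>
    makes the two terms equal, whence the factor 2.\<close>
  have main: "average_on A f \<le> ennreal c + ennreal (c powr (1 - p)) * B" if c: "c > 0" for c
  proof -
    have pw: "ennreal \<bar>f y\<bar> \<le> ennreal c + ennreal (c powr (1 - p)) * ennpowr (ennreal \<bar>f y\<bar>) p" for y
    proof (cases "\<bar>f y\<bar> \<le> c")
      case True
      then show ?thesis by (simp add: add_increasing2 ennreal_leI)
    next
      case False
      define t where "t = \<bar>f y\<bar>"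
      have t: "t > c" "t > 0" using False c by (auto simp: t_def)
      have "1 \<le> (t / c) powr (p - 1)" using t c p by (intro ge_one_powr_ge_zero) auto
      then have "t * 1 \<le> t * (t / c) powr (p - 1)" using t by (intro mult_left_mono) auto
      also have "\<dots> = c powr (1 - p) * t powr p"
        using t c by (simp add: powr_divide powr_diff powr_minus field_simps)
      finally have "ennreal t \<le> ennreal (c powr (1 - p)) * ennpowr (ennreal t) p"
        using t by (simp add: ennpowr_ennreal ennreal_leI flip: ennreal_mult)
      then show ?thesis unfolding t_def by (simp add: add_increasing)
    qed
    have "(\<integral>\<^sup>+y\<in>A. ennreal \<bar>f y\<bar> \<partial>lebesgue) \<le>
      (\<integral>\<^sup>+y. ennreal c * indicator A y + ennreal (c powr (1 - p)) * (ennpowr (ennreal \<bar>f y\<bar>) p * indicator A y) \<partial>lebesgue)"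
    proof (intro nn_integral_mono)
      fix y
      show "ennreal \<bar>f y\<bar> * indicator A y \<le>
        ennreal c * indicator A y + ennreal (c powr (1 - p)) * (ennpowr (ennreal \<bar>f y\<bar>) p * indicator A y)"
        using pw[of y] by (auto simp: indicator_def)
    qed
    also have "\<dots> = ennreal c * emeasure lebesgue A +
        ennreal (c powr (1 - p)) * (\<integral>\<^sup>+y\<in>A. ennpowr (ennreal \<bar>f y\<bar>) p \<partial>lebesgue)"
      using A f by (subst nn_integral_add) (auto simp: nn_integral_cmult)
    finally have "average_on A f \<le> (ennreal c * emeasure lebesgue A +
        ennreal (c powr (1 - p)) * (\<integral>\<^sup>+y\<in>A. ennpowr (ennreal \<bar>f y\<bar>) p \<partial>lebesgue)) / emeasure lebesgue A"
      unfolding average_on_def by (rule divide_right_mono_ennreal)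
    also have "\<dots> = ennreal c + ennreal (c powr (1 - p)) * B"
      using A by (simp add: add_divide_distrib_ennreal B_def ennreal_times_divide ennreal_mult_divide_eq)
    finally show ?thesis .
  qed
  show ?thesis
  proof (cases "B = \<infinity>")
    case True
    then show ?thesis unfolding B_def[symmetric] by (simp add: ennreal_mult_top)
  next
    case False
    then obtain b where b: "B = ennreal b" "b \<ge> 0" by (cases B) auto
    show ?thesis
    proof (cases "b = 0")
      case True
      have "average_on A f \<le> 0 + ennreal e" if "e > 0" for e
        using main[OF that] unfolding b(1) True by simp
      then have "average_on A f \<le> 0" by (rule ennreal_le_epsilon)
      then show ?thesis by simp
    next
      case False
      then have b0: "b > 0" using b by simp
      have "(b powr (1 / p)) powr (1 - p) * b = b powr ((1 / p) * (1 - p) + 1)"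
        using b0 by (simp add: powr_powr powr_add)
      also have "(1 / p) * (1 - p) + 1 = 1 / p" using p by (simp add: field_simps)
      finally have "average_on A f \<le> ennreal (b powr (1 / p)) + ennreal (b powr (1 / p))"
        using main[of "b powr (1 / p)"] b b0 by (simp flip: ennreal_mult)
      also have "\<dots> = 2 * ennpowr B (1 / p)"
        using b by (simp add: ennpowr_ennreal mult_2)
      finally show ?thesis unfolding B_def .
    qed
  qed
qed

section \<open>Cells, slabs and the mass that they carry\<close>

definition unit_cell :: "('n \<Rightarrow> int) \<Rightarrow> (real ^ 'n) set" where
  "unit_cell z = {x. \<forall>i. of_int (z i) \<le> x $ i \<and> x $ i < of_int (z i) + 1}"

text \<open>The margin 3 exceeds \<open>r + \<delta>\<close>, so this box contains the face
  neighborhoods of all admissible cubes centered in the unit cell.\<close>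

definition big_cell :: "('n \<Rightarrow> int) \<Rightarrow> (real ^ 'n) set" where
  "big_cell z = cbox (\<chi> i. of_int (z i) - 3) (\<chi> i. of_int (z i) + 4)"

text \<open>The width \<open>3 * \<delta>\<close> adds up \<open>\<delta>\<close> for the
  neighborhood, \<open>\<delta>\<close> for rounding the center and \<open>\<delta>\<close> for
  rounding the radius.\<close>

definition slab :: "real \<Rightarrow> 'n set \<Rightarrow> ('n \<Rightarrow> int) \<Rightarrow> (real ^ 'n) set" where
  "slab \<delta> I u = {y. \<forall>i\<in>I. \<bar>y $ i - \<delta> * of_int (u i)\<bar> < 3 * \<delta>}"

definition slab_mass ::
    "(real ^ 'n \<Rightarrow> ennreal) \<Rightarrow> real \<Rightarrow> ('n \<Rightarrow> int) \<Rightarrow> 'n set \<Rightarrow> ('n \<Rightarrow> int) \<Rightarrow> ennreal" where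
  "slab_mass \<phi> \<delta> z I u = (\<integral>\<^sup>+y\<in>big_cell z \<inter> slab \<delta> I u. \<phi> y \<partial>lebesgue)"

definition cell_mass :: "(real ^ 'n \<Rightarrow> ennreal) \<Rightarrow> ('n \<Rightarrow> int) \<Rightarrow> ennreal" where
  "cell_mass \<phi> z = (\<integral>\<^sup>+y\<in>big_cell z. \<phi> y \<partial>lebesgue)"

lemma measurable_vec_nth_borel [measurable]: "(\<lambda>y :: real ^ 'n. y $ i) \<in> borel_measurable borel"
  by (intro borel_measurable_continuous_onI continuous_intros)

lemma slab_sets [measurable]: "slab \<delta> I u \<in> sets lebesgue"
proof -
  have "{y \<in> space borel. \<forall>i\<in>I. \<bar>y $ i - \<delta> * of_int (u i)\<bar> < 3 * \<delta>} \<in> sets borel" by measurable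
  then show ?thesis by (simp add: slab_def)
qed

lemma big_cell_sets [measurable]: "big_cell z \<in> sets lebesgue"
  by (simp add: big_cell_def)

lemma slab_mass_le_cell_mass: "slab_mass \<phi> \<delta> z I u \<le> cell_mass \<phi> z"
  unfolding slab_mass_def cell_mass_def by (intro nn_integral_mono) (auto simp: indicator_def)

lemma slab_mass_cong: "(\<And>i. i \<in> I \<Longrightarrow> u i = v i) \<Longrightarrow> slab_mass \<phi> \<delta> z I u = slab_mass \<phi> \<delta> z I v"
  by (simp add: slab_mass_def slab_def)

text \<open>Bounded overlap: if \<open>y\<close> lies in the slab of \<open>u\<close>, then each
  \<open>u i\<close> is within 3 of \<open>y $ i / \<delta>\<close>, hence in a window of 7
  integers.\<close>

lemma sum_slab_mass_le:
  fixes \<phi> :: "real ^ 'n \<Rightarrow> ennreal"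
  assumes \<phi>: "\<phi> \<in> borel_measurable lebesgue" and \<delta>: "\<delta> > 0" and T: "finite T"
  shows "(\<Sum>u\<in>PiE I (\<lambda>_. T). slab_mass \<phi> \<delta> z I u) \<le> 7 ^ card I * cell_mass \<phi> z"
proof -
  have count: "(\<Sum>u\<in>PiE I (\<lambda>_. T). indicator (slab \<delta> I u) y) \<le> (7 ^ card I :: ennreal)" for y
  proof -
    have "u i \<in> {\<lfloor>y $ i / \<delta>\<rfloor> - 3..\<lfloor>y $ i / \<delta>\<rfloor> + 3}" if "y \<in> slab \<delta> I u" "i \<in> I" for u i
    proof -
      have "\<bar>y $ i - \<delta> * of_int (u i)\<bar> < 3 * \<delta>" using that by (auto simp: slab_def)
      then have "\<bar>y $ i / \<delta> - of_int (u i)\<bar> < 3" using \<delta> by (simp add: abs_less_iff field_simps)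
      then show ?thesis by simp linarith
    qed
    then have "{u \<in> PiE I (\<lambda>_. T). y \<in> slab \<delta> I u} \<subseteq> PiE I (\<lambda>i. {\<lfloor>y $ i / \<delta>\<rfloor> - 3..\<lfloor>y $ i / \<delta>\<rfloor> + 3})"
      by (auto simp: PiE_iff extensional_def)
    then have "card {u \<in> PiE I (\<lambda>_. T). y \<in> slab \<delta> I u} \<le> card (PiE I (\<lambda>i. {\<lfloor>y $ i / \<delta>\<rfloor> - 3..\<lfloor>y $ i / \<delta>\<rfloor> + 3}))"
      by (intro card_mono finite_PiE) auto
    also have "\<dots> = 7 ^ card I" by (simp add: card_PiE)
    finally have "of_nat (card {u \<in> PiE I (\<lambda>_. T). y \<in> slab \<delta> I u}) \<le> (of_nat (7 ^ card I) :: ennreal)"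
      by (intro of_nat_mono)
    moreover have "(\<Sum>u\<in>PiE I (\<lambda>_. T). indicator (slab \<delta> I u) y) = (of_nat (card {u \<in> PiE I (\<lambda>_. T). y \<in> slab \<delta> I u}) :: ennreal)"
      using T by (simp add: indicator_def sum.If_cases finite_PiE Int_def)
    ultimately show ?thesis by simp
  qed
  have "(\<Sum>u\<in>PiE I (\<lambda>_. T). slab_mass \<phi> \<delta> z I u) =
    (\<integral>\<^sup>+y. (\<Sum>u\<in>PiE I (\<lambda>_. T). \<phi> y * indicator (big_cell z \<inter> slab \<delta> I u) y) \<partial>lebesgue)"
    unfolding slab_mass_def using \<phi> by (subst nn_integral_sum) auto
  also have "\<dots> \<le> (\<integral>\<^sup>+y. 7 ^ card I * (\<phi> y * indicator (big_cell z) y) \<partial>lebesgue)"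
  proof (intro nn_integral_mono)
    fix y
    have "(\<Sum>u\<in>PiE I (\<lambda>_. T). \<phi> y * indicator (big_cell z \<inter> slab \<delta> I u) y) =
        \<phi> y * indicator (big_cell z) y * (\<Sum>u\<in>PiE I (\<lambda>_. T). indicator (slab \<delta> I u) y)"
      unfolding sum_distrib_left by (intro sum.cong) (auto simp: indicator_def)
    also have "\<dots> \<le> \<phi> y * indicator (big_cell z) y * 7 ^ card I"
      by (intro mult_left_mono count) simp
    finally show "(\<Sum>u\<in>PiE I (\<lambda>_. T). \<phi> y * indicator (big_cell z \<inter> slab \<delta> I u) y)
      \<le> 7 ^ card I * (\<phi> y * indicator (big_cell z) y)" by (simp add: mult.commute)
  qed
  also have "\<dots> = 7 ^ card I * cell_mass \<phi> z"
    unfolding cell_mass_def using \<phi> by (intro nn_integral_cmult) auto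
  finally show ?thesis .
qed

definition grid_pt :: "real \<Rightarrow> real ^ 'n \<Rightarrow> 'n \<Rightarrow> int" where
  "grid_pt \<delta> x i = \<lfloor>x $ i / \<delta>\<rfloor>"

lemma floor_scaled:
  fixes t \<delta> :: real
  assumes "\<delta> > 0"
  shows "0 \<le> t - \<delta> * of_int \<lfloor>t / \<delta>\<rfloor>" "t - \<delta> * of_int \<lfloor>t / \<delta>\<rfloor> < \<delta>"
proof -
  have "\<delta> * of_int \<lfloor>t / \<delta>\<rfloor> \<le> \<delta> * (t / \<delta>)" using assms by (intro mult_left_mono) auto
  moreover have "\<delta> * (t / \<delta>) < \<delta> * (of_int \<lfloor>t / \<delta>\<rfloor> + 1)" using assms by (intro mult_strict_left_mono) linarith+
  ultimately show "0 \<le> t - \<delta> * of_int \<lfloor>t / \<delta>\<rfloor>" "t - \<delta> * of_int \<lfloor>t / \<delta>\<rfloor> < \<delta>"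
    using assms by (simp_all add: ring_distribs)
qed

lemma nbhd_cube_face_subset_slab:
  fixes x :: "real ^ 'n"
  assumes x: "x \<in> unit_cell z" and r: "1 \<le> r" "r \<le> 2" and \<delta>: "0 < \<delta>" "\<delta> < 1"
    and \<sigma>: "range \<sigma> \<subseteq> {1, -1}"
  shows "nbhd \<delta> (cube_face I \<sigma> x r) \<subseteq> big_cell z \<inter> slab \<delta> I (\<lambda>i. grid_pt \<delta> x i + \<sigma> i * \<lfloor>r / \<delta>\<rfloor>)"
proof
  fix y assume "y \<in> nbhd \<delta> (cube_face I \<sigma> x r)"
  moreover have "r \<ge> 0" using r by simp
  ultimately have "(\<forall>i\<in>I. \<bar>y $ i - (x $ i + \<sigma> i * r)\<bar> < \<delta>) \<and> (\<forall>i. \<bar>y $ i - x $ i\<bar> < r + \<delta>)"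
    using nbhd_cube_face_subset[OF _ \<sigma>] by blast
  then have y: "i \<in> I \<Longrightarrow> \<bar>y $ i - (x $ i + \<sigma> i * r)\<bar> < \<delta>" "\<bar>y $ i - x $ i\<bar> < r + \<delta>" for i
    by blast+
  note fl = floor_scaled[OF \<delta>(1)]
  have "y \<in> big_cell z"
    unfolding big_cell_def mem_box_cart
  proof
    fix i
    have "of_int (z i) \<le> x $ i" "x $ i < of_int (z i) + 1" using x by (auto simp: unit_cell_def)
    then show "(\<chi> i. of_int (z i) - 3) $ i \<le> y $ i \<and> y $ i \<le> (\<chi> i. of_int (z i) + 4) $ i"
      using y(2)[of i] r \<delta> by simp linarith
  qed
  moreover have "y \<in> slab \<delta> I (\<lambda>i. grid_pt \<delta> x i + \<sigma> i * \<lfloor>r / \<delta>\<rfloor>)"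
    unfolding slab_def
  proof safe
    fix i assume i: "i \<in> I"
    have "\<sigma> i = 1 \<or> \<sigma> i = -1" using \<sigma> by auto
    then show "\<bar>y $ i - \<delta> * of_int (grid_pt \<delta> x i + \<sigma> i * \<lfloor>r / \<delta>\<rfloor>)\<bar> < 3 * \<delta>"
      using y(1)[OF i] fl[of "x $ i"] fl[of r] by (auto simp: grid_pt_def ring_distribs)
  qed
  ultimately show "y \<in> big_cell z \<inter> slab \<delta> I (\<lambda>i. grid_pt \<delta> x i + \<sigma> i * \<lfloor>r / \<delta>\<rfloor>)" by simp
qed

lemma emeasure_nbhd_cube_face_finite:
  "emeasure lebesgue (nbhd \<delta> (cube_face I \<sigma> x r)) < \<infinity>"
  by (rule emeasure_nbhd_finite) (simp add: cube_face_def)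

text \<open>Jensen's inequality replaces the average by the mean of \<open>|f|^p\<close>. Its
  integral is enlarged to the slab, and the measure below it is reduced to
  \<open>(\<delta> / CARD('n)) ^ card I\<close>.\<close>

lemma average_cube_face_le:
  fixes f :: "real ^ 'n \<Rightarrow> real"
  assumes x: "x \<in> unit_cell z" and r: "1 \<le> r" "r \<le> 2" and \<delta>: "0 < \<delta>" "\<delta> < 1"
    and \<sigma>: "range \<sigma> \<subseteq> {1, -1}"
    and f: "f \<in> borel_measurable lebesgue" and p: "p \<ge> 1"
  shows "average_on (nbhd \<delta> (cube_face I \<sigma> x r)) f \<le>
    2 * ennpowr (ennreal ((CARD('n) / \<delta>) ^ card I) *
      slab_mass (\<lambda>y. ennpowr (ennreal \<bar>f y\<bar>) p) \<delta> z I (\<lambda>i. grid_pt \<delta> x i + \<sigma> i * \<lfloor>r / \<delta>\<rfloor>)) (1 / p)"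
proof -
  let ?N = "nbhd \<delta> (cube_face I \<sigma> x r)"
  let ?S = "slab_mass (\<lambda>y. ennpowr (ennreal \<bar>f y\<bar>) p) \<delta> z I (\<lambda>i. grid_pt \<delta> x i + \<sigma> i * \<lfloor>r / \<delta>\<rfloor>)"
  define v where "v = (\<delta> / CARD('n)) ^ card I"
  have v: "v > 0" using \<delta> by (simp add: v_def)
  have Nv: "emeasure lebesgue ?N \<ge> ennreal v"
    unfolding v_def using emeasure_nbhd_cube_face_ge[OF r(1) \<delta>(1)] .
  then have N0: "emeasure lebesgue ?N > 0" using v by (metis ennreal_less_zero_iff order_less_le_trans)
  obtain \<mu> where \<mu>: "emeasure lebesgue ?N = ennreal \<mu>" "\<mu> \<ge> 0"
    using emeasure_nbhd_cube_face_finite[of \<delta> I \<sigma> x r] by (cases "emeasure lebesgue ?N") auto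
  then have "v \<le> \<mu>" using Nv by simp
  then have inv: "inverse (emeasure lebesgue ?N) \<le> inverse (ennreal v)"
    using v \<mu> by (simp add: inverse_ennreal ennreal_leI)
  have "(\<integral>\<^sup>+y\<in>?N. ennpowr (ennreal \<bar>f y\<bar>) p \<partial>lebesgue) \<le> ?S"
    unfolding slab_mass_def using nbhd_cube_face_subset_slab[OF x r \<delta> \<sigma>, of I]
    by (intro nn_integral_mono) (auto simp: indicator_def)
  then have "(\<integral>\<^sup>+y\<in>?N. ennpowr (ennreal \<bar>f y\<bar>) p \<partial>lebesgue) / emeasure lebesgue ?N \<le> ?S / ennreal v"
    unfolding divide_ennreal_def using inv by (intro mult_mono) auto
  also have "\<dots> = ennreal ((CARD('n) / \<delta>) ^ card I) * ?S"
    unfolding divide_ennreal_def using v by (simp add: inverse_ennreal mult.commute v_def power_divide)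
  finally have "2 * ennpowr ((\<integral>\<^sup>+y\<in>?N. ennpowr (ennreal \<bar>f y\<bar>) p \<partial>lebesgue) / emeasure lebesgue ?N) (1 / p)
      \<le> 2 * ennpowr (ennreal ((CARD('n) / \<delta>) ^ card I) * ?S) (1 / p)"
    using p by (intro mult_left_mono ennpowr_mono) auto
  then show ?thesis
    using average_on_le_power_mean[OF nbhd_lebesgue N0 emeasure_nbhd_cube_face_finite f p] by (rule order_trans[rotated])
qed

section \<open>The maximal operator on the grid\<close>

definition cube_labels :: "nat \<Rightarrow> ('n set \<times> ('n \<Rightarrow> int)) set" where
  "cube_labels d = {I. card I = d} \<times> {\<sigma>. range \<sigma> \<subseteq> {1, -1}}"

text \<open>The radii start at 0 rather than \<open>1 / \<delta>\<close>; they include every rounded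
  radius, and more of them only increase the maximum. Labels that agree on \<open>I\<close> give the
  same slab, which leaves the minimum unchanged. The masses are not divided by the measures of the
  neighborhoods.\<close>

definition grid_maximal ::
    "(real ^ 'n \<Rightarrow> ennreal) \<Rightarrow> real \<Rightarrow> nat \<Rightarrow> ('n \<Rightarrow> int) \<Rightarrow> ('n \<Rightarrow> int) \<Rightarrow> ennreal" where
  "grid_maximal \<phi> \<delta> d z m = Max ((\<lambda>\<rho>. Min ((\<lambda>(I, \<sigma>). slab_mass \<phi> \<delta> z I (\<lambda>i. m i + \<sigma> i * \<rho>)) ` cube_labels d))
     ` {0..\<lfloor>2 / \<delta>\<rfloor>})"

lemma finite_cube_labels: "finite (cube_labels d :: ('n::finite set \<times> ('n \<Rightarrow> int)) set)"
proof -
  have "{\<sigma> :: 'n \<Rightarrow> int. range \<sigma> \<subseteq> {1, -1}} \<subseteq> PiE UNIV (\<lambda>_. {1, -1})" by (auto simp: PiE_iff)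
  then have "finite {\<sigma> :: 'n \<Rightarrow> int. range \<sigma> \<subseteq> {1, -1}}"
    by (rule finite_subset) (intro finite_PiE, auto)
  then show ?thesis by (simp add: cube_labels_def)
qed

lemma cube_labels_nonempty:
  assumes "d \<le> CARD('n::finite)"
  shows "(cube_labels d :: ('n set \<times> ('n \<Rightarrow> int)) set) \<noteq> {}"
proof -
  obtain I :: "'n set" where "card I = d" using obtain_subset_with_card_n[OF assms] by blast
  then have "(I, \<lambda>_. 1) \<in> cube_labels d" by (auto simp: cube_labels_def)
  then show ?thesis by blast
qed

text \<open>For each radius take the label at which the slab mass is minimal. The minimum over the
  true faces is at most the average over the face with this label.\<close>

lemma skeleton_maximal_le_grid_maximal:
  fixes f :: "real ^ 'n \<Rightarrow> real"
  assumes d: "d + k = CARD('n)"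
    and x: "x \<in> unit_cell z" and \<delta>: "0 < \<delta>" "\<delta> < 1"
    and f: "f \<in> borel_measurable lebesgue" and p: "p \<ge> 1"
  shows "skeleton_maximal k \<delta> f x \<le>
    2 * ennpowr (ennreal ((CARD('n) / \<delta>) ^ d) *
      grid_maximal (\<lambda>y. ennpowr (ennreal \<bar>f y\<bar>) p) \<delta> d z (grid_pt \<delta> x)) (1 / p)"
  unfolding skeleton_maximal_def
proof (rule SUP_least)
  fix r :: real assume "r \<in> {1..2}"
  then have r: "1 \<le> r" "r \<le> 2" by auto
  define S where "S = (\<lambda>(I, \<sigma>). slab_mass (\<lambda>y. ennpowr (ennreal \<bar>f y\<bar>) p) \<delta> z I (\<lambda>i. grid_pt \<delta> x i + \<sigma> i * \<lfloor>r / \<delta>\<rfloor>))"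
  have "Min (S ` cube_labels d) \<in> S ` cube_labels d"
    using d by (intro Min_in finite_imageI finite_cube_labels) (simp add: cube_labels_nonempty)
  then obtain l where l: "l \<in> cube_labels d" and min': "Min (S ` cube_labels d) = S l"
    by (rule imageE)
  obtain I \<sigma> where l_eq: "l = (I, \<sigma>)" by (cases l)
  have I: "card I = d" and \<sigma>: "range \<sigma> \<subseteq> {1, -1}" using l by (auto simp: l_eq cube_labels_def)
  have min: "Min (S ` cube_labels d) = S (I, \<sigma>)" using min' by (simp only: l_eq)
  have \<rho>: "\<lfloor>r / \<delta>\<rfloor> \<in> {0..\<lfloor>2 / \<delta>\<rfloor>}"
    using r \<delta> by (auto intro!: floor_mono divide_right_mono)
  have "Min (S ` cube_labels d) \<le> grid_maximal (\<lambda>y. ennpowr (ennreal \<bar>f y\<bar>) p) \<delta> d z (grid_pt \<delta> x)"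
    unfolding grid_maximal_def S_def
  proof (rule Max_ge)
    show "Min ((\<lambda>(I, \<sigma>). slab_mass (\<lambda>y. ennpowr (ennreal \<bar>f y\<bar>) p) \<delta> z I (\<lambda>i. grid_pt \<delta> x i + \<sigma> i * \<lfloor>r / \<delta>\<rfloor>)) ` cube_labels d)
      \<in> (\<lambda>\<rho>. Min ((\<lambda>(I, \<sigma>). slab_mass (\<lambda>y. ennpowr (ennreal \<bar>f y\<bar>) p) \<delta> z I (\<lambda>i. grid_pt \<delta> x i + \<sigma> i * \<rho>)) ` cube_labels d)) ` {0..\<lfloor>2 / \<delta>\<rfloor>}"
      by (rule imageI[OF \<rho>])
  qed simp
  then have "S (I, \<sigma>) \<le> grid_maximal (\<lambda>y. ennpowr (ennreal \<bar>f y\<bar>) p) \<delta> d z (grid_pt \<delta> x)"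
    by (simp only: min)
  then have "2 * ennpowr (ennreal ((CARD('n) / \<delta>) ^ d) * S (I, \<sigma>)) (1 / p) \<le>
     2 * ennpowr (ennreal ((CARD('n) / \<delta>) ^ d) *
      grid_maximal (\<lambda>y. ennpowr (ennreal \<bar>f y\<bar>) p) \<delta> d z (grid_pt \<delta> x)) (1 / p)"
    using p by (intro mult_left_mono ennpowr_mono) auto
  moreover have "Min ((\<lambda>F. average_on (nbhd \<delta> F) f) ` skeleton_faces k x r) \<le> average_on (nbhd \<delta> (cube_face I \<sigma> x r)) f"
    using cube_face_in_skeleton[OF _ \<sigma>, of r I k x] r I d
    by (intro Min_le finite_imageI finite_skeleton_faces) auto
  moreover have "average_on (nbhd \<delta> (cube_face I \<sigma> x r)) f \<le> 2 * ennpowr (ennreal ((CARD('n) / \<delta>) ^ d) * S (I, \<sigma>)) (1 / p)"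
    using average_cube_face_le[OF x r \<delta> \<sigma> f p, of I] I by (simp add: S_def)
  ultimately show "Min ((\<lambda>F. average_on (nbhd \<delta> F) f) ` skeleton_faces k x r) \<le>
    2 * ennpowr (ennreal ((CARD('n) / \<delta>) ^ d) *
      grid_maximal (\<lambda>y. ennpowr (ennreal \<bar>f y\<bar>) p) \<delta> d z (grid_pt \<delta> x)) (1 / p)"
    by (meson order_trans)
qed

subsection \<open>Upper bounds\<close>

definition grid_cells :: "real \<Rightarrow> ('n \<Rightarrow> int) \<Rightarrow> ('n \<Rightarrow> int) set" where
  "grid_cells \<delta> z = PiE UNIV (\<lambda>i. {\<lfloor>of_int (z i) / \<delta>\<rfloor>..\<lfloor>(of_int (z i) + 1) / \<delta>\<rfloor>})"

lemma finite_grid_cells: "finite (grid_cells \<delta> (z :: 'n::finite \<Rightarrow> int))"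
  unfolding grid_cells_def by (intro finite_PiE) auto

lemma grid_pt_in_grid_cells:
  assumes "x \<in> unit_cell z" "\<delta> > 0"
  shows "grid_pt \<delta> x \<in> grid_cells \<delta> z"
proof -
  have "\<lfloor>of_int (z i) / \<delta>\<rfloor> \<le> grid_pt \<delta> x i \<and> grid_pt \<delta> x i \<le> \<lfloor>(of_int (z i) + 1) / \<delta>\<rfloor>" for i
  proof -
    have "of_int (z i) \<le> x $ i" "x $ i \<le> of_int (z i) + 1" using assms by (auto simp: unit_cell_def less_imp_le)
    then show ?thesis unfolding grid_pt_def using assms by (intro conjI floor_mono divide_right_mono) auto
  qed
  then show ?thesis by (auto simp: grid_cells_def)
qed

lemma card_grid_cells_le:
  assumes "0 < \<delta>" "\<delta> < 1"
  shows "real (card (grid_cells \<delta> (z :: 'n::finite \<Rightarrow> int))) \<le> 3 ^ CARD('n) * \<delta> powr (- real CARD('n))"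
proof -
  have *: "real (card {\<lfloor>of_int t / \<delta>\<rfloor>..\<lfloor>(of_int t + 1) / \<delta>\<rfloor>}) \<le> 3 / \<delta>" for t :: int
  proof -
    have fl: "\<lfloor>of_int t / \<delta>\<rfloor> \<le> \<lfloor>(of_int t + 1) / \<delta>\<rfloor>"
      using assms by (intro floor_mono divide_right_mono) auto
    then have "real (card {\<lfloor>of_int t / \<delta>\<rfloor>..\<lfloor>(of_int t + 1) / \<delta>\<rfloor>}) =
        real_of_int \<lfloor>(of_int t + 1) / \<delta>\<rfloor> - real_of_int \<lfloor>of_int t / \<delta>\<rfloor> + 1" by simp
    also have "\<dots> \<le> (of_int t + 1) / \<delta> - (of_int t / \<delta> - 1) + 1"
      by linarith
    also have "\<dots> = 1 / \<delta> + 2" by (simp add: add_divide_distrib)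
    also have "\<dots> \<le> 3 / \<delta>" using assms by (simp add: field_simps)
    finally show ?thesis .
  qed
  have "real (card (grid_cells \<delta> z)) = (\<Prod>i\<in>UNIV. real (card {\<lfloor>of_int (z i) / \<delta>\<rfloor>..\<lfloor>(of_int (z i) + 1) / \<delta>\<rfloor>}))"
    unfolding grid_cells_def by (subst card_PiE) (simp_all only: finite of_nat_prod)
  also have "\<dots> \<le> (\<Prod>i\<in>(UNIV :: 'n set). 3 / \<delta>)" by (intro prod_mono conjI * of_nat_0_le_iff)
  also have "\<dots> = 3 ^ CARD('n) * \<delta> powr (- real CARD('n))"
    using assms by (simp add: power_divide powr_minus_divide powr_realpow)
  finally show ?thesis .
qed

text \<open>The maximising radius at \<open>m\<close> supplies the radius function \<open>s\<close>
  required by \<open>sum_powr_cube_skeletons_le\<close>.\<close>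

lemma grid_maximal_attained:
  fixes z m :: "'n::finite \<Rightarrow> int"
  assumes d: "d \<le> CARD('n)" and \<delta>: "0 < \<delta>"
  obtains \<rho> where "0 \<le> \<rho>" "\<rho> \<le> \<lfloor>2 / \<delta>\<rfloor>"
    "\<And>I \<sigma>. card I = d \<Longrightarrow> range \<sigma> \<subseteq> {1, -1} \<Longrightarrow>
      grid_maximal \<phi> \<delta> d z m \<le> slab_mass \<phi> \<delta> z I (\<lambda>i. m i + \<sigma> i * \<rho>)"
proof -
  define g where "g \<rho> = Min ((\<lambda>(I, \<sigma>). slab_mass \<phi> \<delta> z I (\<lambda>i. m i + \<sigma> i * \<rho>)) ` cube_labels d)" for \<rho>
  have "grid_maximal \<phi> \<delta> d z m \<in> g ` {0..\<lfloor>2 / \<delta>\<rfloor>}"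
    unfolding grid_maximal_def g_def using \<delta> by (intro Max_in) auto
  then obtain \<rho> where \<rho>: "\<rho> \<in> {0..\<lfloor>2 / \<delta>\<rfloor>}" "grid_maximal \<phi> \<delta> d z m = g \<rho>" by (rule imageE)
  have "g \<rho> \<le> slab_mass \<phi> \<delta> z I (\<lambda>i. m i + \<sigma> i * \<rho>)" if "card I = d" "range \<sigma> \<subseteq> {1, -1}" for I \<sigma>
  proof -
    have "(I, \<sigma>) \<in> cube_labels d" using that by (simp add: cube_labels_def)
    then have "(\<lambda>(I, \<sigma>). slab_mass \<phi> \<delta> z I (\<lambda>i. m i + \<sigma> i * \<rho>)) (I, \<sigma>)
      \<in> (\<lambda>(I, \<sigma>). slab_mass \<phi> \<delta> z I (\<lambda>i. m i + \<sigma> i * \<rho>)) ` cube_labels d" by (rule imageI)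
    then show ?thesis unfolding g_def by (intro Min_le finite_imageI finite_cube_labels) simp
  qed
  then show thesis using \<rho> by (intro that[of \<rho>]) auto
qed

lemma grid_maximal_le_cell_mass:
  fixes z m :: "'n::finite \<Rightarrow> int"
  assumes d: "d \<le> CARD('n)" and \<delta>: "0 < \<delta>"
  shows "grid_maximal \<phi> \<delta> d z m \<le> cell_mass \<phi> z"
proof -
  obtain \<rho> where *: "\<And>I \<sigma>. card I = d \<Longrightarrow> range \<sigma> \<subseteq> {1, -1} \<Longrightarrow>
      grid_maximal \<phi> \<delta> d z m \<le> slab_mass \<phi> \<delta> z I (\<lambda>i. m i + \<sigma> i * \<rho>)"
    using grid_maximal_attained[OF d \<delta>, where \<phi> = \<phi> and z = z and m = m] by blast
  obtain I :: "'n set" where I: "card I = d" using obtain_subset_with_card_n[OF d] by blast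
  have "grid_maximal \<phi> \<delta> d z m \<le> slab_mass \<phi> \<delta> z I (\<lambda>i. m i + (\<lambda>_. 1) i * \<rho>)"
    by (rule *[OF I]) auto
  also have "\<dots> \<le> cell_mass \<phi> z" by (rule slab_mass_le_cell_mass)
  finally show ?thesis .
qed

text \<open>The bound at the critical exponent on one unit cell: the discrete inequality applies
  with the slab masses as \<open>F I\<close> and, by their bounded overlap, with \<open>a\<close>
  equal to \<open>7 ^ d\<close> times the cell mass.\<close>

lemma sum_grid_maximal_powr_le:
  fixes z :: "'n::finite \<Rightarrow> int"
  assumes d: "1 \<le> d" "d \<le> CARD('n)" and \<delta>: "0 < \<delta>"
    and \<phi>: "\<phi> \<in> borel_measurable lebesgue" and fin: "cell_mass \<phi> z < \<infinity>"
  defines "Q \<equiv> 2 * (real CARD('n))\<^sup>2 / (d * (2 * real CARD('n) - 1))"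
  shows "(\<Sum>m\<in>grid_cells \<delta> z. enn2real (grid_maximal \<phi> \<delta> d z m) powr Q)
    \<le> (real CARD('n) + 1) * (7 ^ d * enn2real (cell_mass \<phi> z)) powr Q"
proof -
  have "\<exists>\<rho>. 0 \<le> \<rho> \<and> \<rho> \<le> \<lfloor>2 / \<delta>\<rfloor> \<and> (\<forall>I \<sigma>. card I = d \<longrightarrow> range \<sigma> \<subseteq> {1, -1} \<longrightarrow>
      grid_maximal \<phi> \<delta> d z m \<le> slab_mass \<phi> \<delta> z I (\<lambda>i. m i + \<sigma> i * \<rho>))" for m
    by (rule grid_maximal_attained[OF d(2) \<delta>, where \<phi> = \<phi> and z = z and m = m]) blast
  then obtain s where s: "\<And>m. 0 \<le> s m" "\<And>m. s m \<le> \<lfloor>2 / \<delta>\<rfloor>"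
    "\<And>m I \<sigma>. card I = d \<Longrightarrow> range \<sigma> \<subseteq> {1, -1} \<Longrightarrow>
      grid_maximal \<phi> \<delta> d z m \<le> slab_mass \<phi> \<delta> z I (\<lambda>i. m i + \<sigma> i * s m)"
    by metis
  \<comment> \<open>One finite range for all coordinates, wide enough for the grid points of the
    cell and for the vertices of all cubes around them.\<close>
  define T where "T = (\<Union>i. {\<lfloor>of_int (z i) / \<delta>\<rfloor> - \<lfloor>2 / \<delta>\<rfloor>..\<lfloor>(of_int (z i) + 1) / \<delta>\<rfloor> + \<lfloor>2 / \<delta>\<rfloor>})"
  have T: "finite T" by (simp add: T_def)
  have R: "\<lfloor>2 / \<delta>\<rfloor> \<ge> 0" using \<delta> by simp
  have slab_fin: "slab_mass \<phi> \<delta> z I u < \<infinity>" for I u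
    using slab_mass_le_cell_mass fin by (rule le_less_trans)
  show ?thesis
    unfolding Q_def
  proof (rule sum_powr_cube_skeletons_le[OF d T, where F = "\<lambda>I u. enn2real (slab_mass \<phi> \<delta> z I u)" and s = s])
    show "enn2real (slab_mass \<phi> \<delta> z I v) = enn2real (slab_mass \<phi> \<delta> z I w)"
      if "\<And>i. i \<in> I \<Longrightarrow> v i = w i" for I v w
      by (rule arg_cong[OF slab_mass_cong]) (rule that)
    show "(\<Sum>u\<in>PiE I (\<lambda>_. T). enn2real (slab_mass \<phi> \<delta> z I u)) \<le> 7 ^ d * enn2real (cell_mass \<phi> z)"
      if "card I = d" for I
    proof -
      have "(\<Sum>u\<in>PiE I (\<lambda>_. T). enn2real (slab_mass \<phi> \<delta> z I u)) = enn2real (\<Sum>u\<in>PiE I (\<lambda>_. T). slab_mass \<phi> \<delta> z I u)"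
        using slab_fin by (subst enn2real_sum) (auto simp: less_top)
      also have "\<dots> \<le> enn2real (7 ^ card I * cell_mass \<phi> z)"
        using sum_slab_mass_le[OF \<phi> \<delta> T] fin
        by (intro enn2real_mono) (auto simp: ennreal_mult_less_top power_less_top_ennreal)
      also have "\<dots> = 7 ^ d * enn2real (cell_mass \<phi> z)"
      proof -
        have "enn2real (7 ^ d) = 7 ^ d" by (induction d) (simp_all add: enn2real_mult)
        then show ?thesis by (simp add: enn2real_mult that)
      qed
      finally show ?thesis .
    qed
    show "grid_cells \<delta> z \<subseteq> PiE UNIV (\<lambda>_. T)"
      unfolding grid_cells_def
    proof (rule PiE_mono)
      fix i
      have "{\<lfloor>of_int (z i) / \<delta>\<rfloor>..\<lfloor>(of_int (z i) + 1) / \<delta>\<rfloor>} \<subseteq>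
        {\<lfloor>of_int (z i) / \<delta>\<rfloor> - \<lfloor>2 / \<delta>\<rfloor>..\<lfloor>(of_int (z i) + 1) / \<delta>\<rfloor> + \<lfloor>2 / \<delta>\<rfloor>}"
        using R by auto
      then show "{\<lfloor>of_int (z i) / \<delta>\<rfloor>..\<lfloor>(of_int (z i) + 1) / \<delta>\<rfloor>} \<subseteq> T"
        unfolding T_def by blast
    qed
    show "(\<lambda>i. m i + \<sigma> i * s m) \<in> PiE UNIV (\<lambda>_. T)"
      if m: "m \<in> grid_cells \<delta> z" and \<sigma>: "range \<sigma> \<subseteq> {1, -1}" for m \<sigma>
    proof -
      have "m i + \<sigma> i * s m \<in> T" for i
      proof -
        have "m i \<in> {\<lfloor>of_int (z i) / \<delta>\<rfloor>..\<lfloor>(of_int (z i) + 1) / \<delta>\<rfloor>}"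
          using m unfolding grid_cells_def by (rule PiE_mem) simp
        moreover have "\<sigma> i = 1 \<or> \<sigma> i = -1" using \<sigma> by auto
        ultimately have "m i + \<sigma> i * s m \<in> {\<lfloor>of_int (z i) / \<delta>\<rfloor> - \<lfloor>2 / \<delta>\<rfloor>..\<lfloor>(of_int (z i) + 1) / \<delta>\<rfloor> + \<lfloor>2 / \<delta>\<rfloor>}"
          using s(1,2)[of m] by auto
        then show ?thesis unfolding T_def by blast
      qed
      then show ?thesis by auto
    qed
    show "enn2real (grid_maximal \<phi> \<delta> d z m) \<le> enn2real (slab_mass \<phi> \<delta> z I (\<lambda>i. m i + \<sigma> i * s m))"
      if "card I = d" "range \<sigma> \<subseteq> {1, -1}" for m I \<sigma>
      using s(3)[OF that] slab_fin by (intro enn2real_mono) auto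
  qed auto
qed

section \<open>From the critical exponent to all others\<close>

lemma sum_powr_le_of_sum_powr_le_large:
  fixes H :: "'a \<Rightarrow> real"
  assumes "finite A" "\<And>m. m \<in> A \<Longrightarrow> 0 \<le> H m" "\<And>m. m \<in> A \<Longrightarrow> H m \<le> a"
    and sum: "(\<Sum>m\<in>A. H m powr Q) \<le> c * a powr Q" and s: "Q \<le> s" "0 < Q"
  shows "(\<Sum>m\<in>A. H m powr s) \<le> c * a powr s"
proof -
  \<comment> \<open>Above the critical exponent the surplus power is bounded by the maximal value
    \<open>a\<close>.\<close>
  have "H m powr s \<le> a powr (s - Q) * H m powr Q" if m: "m \<in> A" for m
  proof (cases "H m = 0")
    case False
    then have "H m > 0" using assms(2)[OF m] by simp
    then have "H m powr s = H m powr (s - Q) * H m powr Q" by (simp flip: powr_add)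
    also have "\<dots> \<le> a powr (s - Q) * H m powr Q"
      using assms(2,3)[OF m] s by (intro mult_right_mono powr_mono2) auto
    finally show ?thesis .
  qed simp
  then have "(\<Sum>m\<in>A. H m powr s) \<le> a powr (s - Q) * (\<Sum>m\<in>A. H m powr Q)"
    by (simp add: sum_distrib_left sum_mono)
  also have "\<dots> \<le> a powr (s - Q) * (c * a powr Q)" by (intro mult_left_mono sum) simp
  also have "\<dots> = c * a powr s" by (simp flip: powr_add)
  finally show ?thesis .
qed

text \<open>Below the critical exponent, split the sum at the height \<open>a \<delta>\<^bsup>n/Q\<^esup>\<close>.\<close>

lemma sum_powr_le_of_sum_powr_le_small:
  fixes H :: "'a \<Rightarrow> real"
  assumes A: "finite A" and H: "\<And>m. m \<in> A \<Longrightarrow> 0 \<le> H m" "\<And>m. m \<in> A \<Longrightarrow> H m \<le> a"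
    and sum: "(\<Sum>m\<in>A. H m powr Q) \<le> c * a powr Q" and s: "s \<le> Q" "0 < s"
    and card: "real (card A) \<le> b * \<delta> powr (- n)" and \<delta>: "\<delta> > 0" and a: "a \<ge> 0"
  shows "(\<Sum>m\<in>A. H m powr s) \<le> (b + c) * \<delta> powr (n * s / Q - n) * a powr s"
proof (cases "a = 0")
  case True
  then have "H m = 0" if "m \<in> A" for m using H[OF that] by simp
  then show ?thesis using True by simp
next
  case False
  then have a0: "a > 0" using a by simp
  \<comment> \<open>At this height the contribution \<open>\<delta> powr (- n) * t powr s\<close> of
    the small values balances the contribution \<open>t powr (s - Q) * a powr Q\<close> of the large
    ones.\<close>
  define t where "t = a * \<delta> powr (n / Q)"
  have t: "t > 0" using a0 \<delta> by (simp add: t_def)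
  have "H m powr s \<le> t powr s + t powr (s - Q) * H m powr Q" if m: "m \<in> A" for m
  proof (cases "H m \<le> t")
    case True
    then have "H m powr s \<le> t powr s" using H(1)[OF m] s by (intro powr_mono2) auto
    then show ?thesis by (simp add: add_increasing2)
  next
    case False
    then have "H m powr s = H m powr (s - Q) * H m powr Q" using t by (simp flip: powr_add)
    also have "\<dots> \<le> t powr (s - Q) * H m powr Q"
      using False t s by (intro mult_right_mono powr_mono2') auto
    finally show ?thesis by (simp add: add_increasing)
  qed
  then have "(\<Sum>m\<in>A. H m powr s) \<le> (\<Sum>m\<in>A. t powr s + t powr (s - Q) * H m powr Q)"
    by (rule sum_mono)
  also have "\<dots> = real (card A) * t powr s + t powr (s - Q) * (\<Sum>m\<in>A. H m powr Q)"
    by (simp add: sum.distrib sum_distrib_left)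
  also have "\<dots> \<le> b * \<delta> powr (- n) * t powr s + t powr (s - Q) * (c * a powr Q)"
    by (intro add_mono mult_right_mono mult_left_mono card sum) auto
  also have "\<dots> = (b + c) * \<delta> powr (n * s / Q - n) * a powr s"
  proof -
    have ts: "t powr s = a powr s * \<delta> powr (n * s / Q)"
      using a0 \<delta> by (simp add: t_def powr_mult powr_powr)
    have e: "n / Q * (s - Q) = n * s / Q - n" using s by (simp add: field_simps)
    have "t powr (s - Q) = a powr (s - Q) * \<delta> powr (n * s / Q - n)"
      using a0 \<delta> unfolding e[symmetric] by (simp add: t_def powr_mult powr_powr)
    moreover have "a powr (s - Q) * a powr Q = a powr s" by (simp flip: powr_add)
    moreover have "\<delta> powr (- n) * \<delta> powr (n * s / Q) = \<delta> powr (n * s / Q - n)" by (simp flip: powr_add)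
    ultimately show ?thesis unfolding ts by (simp add: algebra_simps) 
  qed
  finally show ?thesis .
qed

lemma sum_ennpowr_grid_maximal_le:
  fixes \<phi> :: "real ^ 'n \<Rightarrow> ennreal"
  assumes d: "1 \<le> d" "d \<le> CARD('n)" and s: "s > 0"
    and \<phi>: "\<phi> \<in> borel_measurable lebesgue"
  defines "Q \<equiv> 2 * (real CARD('n))\<^sup>2 / (d * (2 * real CARD('n) - 1))"
  defines "C \<equiv> 3 ^ CARD('n) + (real CARD('n) + 1) * (7 ^ d) powr Q"
  assumes \<delta>: "0 < \<delta>" "\<delta> < 1"
  shows "s \<le> Q \<Longrightarrow> (\<Sum>m\<in>grid_cells \<delta> z. ennpowr (grid_maximal \<phi> \<delta> d z m) s)
      \<le> ennreal (C * \<delta> powr (real CARD('n) * s / Q - real CARD('n))) * ennpowr (cell_mass \<phi> z) s"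
    and "Q \<le> s \<Longrightarrow> (\<Sum>m\<in>grid_cells \<delta> z. ennpowr (grid_maximal \<phi> \<delta> d z m) s)
      \<le> ennreal C * ennpowr (cell_mass \<phi> z) s"
proof -
  define n where "n = real CARD('n)"
  have n: "n \<ge> 1" by (simp add: n_def Suc_le_eq)
  have Q: "Q > 0" using d n unfolding Q_def n_def[symmetric] by auto
  define c where "c = (n + 1) * (7 ^ d) powr Q"
  have c: "c \<ge> 0" using n by (simp add: c_def)
  have C_eq: "C = 3 ^ CARD('n) + c" by (simp add: C_def c_def n_def)
  then have C: "C > 0" using c by (simp add: add_pos_nonneg)
  define a where "a = enn2real (cell_mass \<phi> z)"
  define H where "H m = enn2real (grid_maximal \<phi> \<delta> d z m)" for m
  have H: "grid_maximal \<phi> \<delta> d z m = ennreal (H m)" "H m \<le> a" if "cell_mass \<phi> z < \<infinity>" for m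
  proof -
    have "grid_maximal \<phi> \<delta> d z m \<le> cell_mass \<phi> z" using d(2) \<delta>(1) by (rule grid_maximal_le_cell_mass)
    then show "grid_maximal \<phi> \<delta> d z m = ennreal (H m)" "H m \<le> a"
      using that by (auto simp: H_def a_def less_top le_less_trans intro: enn2real_mono)
  qed
  \<comment> \<open>Reduction to real numbers: if the cell mass is infinite, so is the right side,
    because \<open>K > 0\<close>.\<close>
  have red: "(\<Sum>m\<in>grid_cells \<delta> z. ennpowr (grid_maximal \<phi> \<delta> d z m) s) \<le> ennreal K * ennpowr (cell_mass \<phi> z) s"
    if K: "K > 0" and *: "cell_mass \<phi> z < \<infinity> \<Longrightarrow> (\<Sum>m\<in>grid_cells \<delta> z. H m powr s) \<le> K * a powr s" for K
  proof (cases "cell_mass \<phi> z < \<infinity>")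
    case False
    then show ?thesis using K by (simp add: not_less top_unique ennreal_mult_top)
  next
    case True
    have "ennpowr (grid_maximal \<phi> \<delta> d z m) s = ennreal (H m powr s)" for m
      by (subst H(1)[OF True]) (simp add: ennpowr_ennreal H_def)
    then have "(\<Sum>m\<in>grid_cells \<delta> z. ennpowr (grid_maximal \<phi> \<delta> d z m) s) = ennreal (\<Sum>m\<in>grid_cells \<delta> z. H m powr s)"
      by simp
    also have "\<dots> \<le> ennreal (K * a powr s)" by (intro ennreal_leI * True)
    also have "\<dots> = ennreal K * ennpowr (ennreal a) s"
      using K by (simp add: ennpowr_ennreal a_def ennreal_mult)
    also have "ennreal a = cell_mass \<phi> z" using True by (simp add: a_def)
    finally show ?thesis .
  qed
  have base: "(\<Sum>m\<in>grid_cells \<delta> z. H m powr Q) \<le> c * a powr Q" if "cell_mass \<phi> z < \<infinity>"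
    using sum_grid_maximal_powr_le[OF d \<delta>(1) \<phi> that]
    by (simp add: H_def a_def c_def Q_def n_def powr_mult)
  show "(\<Sum>m\<in>grid_cells \<delta> z. ennpowr (grid_maximal \<phi> \<delta> d z m) s)
      \<le> ennreal (C * \<delta> powr (real CARD('n) * s / Q - real CARD('n))) * ennpowr (cell_mass \<phi> z) s"
    if sQ: "s \<le> Q"
  proof (rule red)
    assume fin: "cell_mass \<phi> z < \<infinity>"
    show "(\<Sum>m\<in>grid_cells \<delta> z. H m powr s) \<le> C * \<delta> powr (real CARD('n) * s / Q - real CARD('n)) * a powr s"
      unfolding C_eq
      by (rule sum_powr_le_of_sum_powr_le_small[OF finite_grid_cells _ H(2)[OF fin] base[OF fin] sQ s
            card_grid_cells_le[OF \<delta>] \<delta>(1)]) (simp_all add: H_def a_def)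
  qed (use C \<delta> in auto)
  show "(\<Sum>m\<in>grid_cells \<delta> z. ennpowr (grid_maximal \<phi> \<delta> d z m) s) \<le> ennreal C * ennpowr (cell_mass \<phi> z) s"
    if sQ: "Q \<le> s"
  proof (rule red[OF C])
    assume fin: "cell_mass \<phi> z < \<infinity>"
    have "(\<Sum>m\<in>grid_cells \<delta> z. H m powr s) \<le> c * a powr s"
      by (rule sum_powr_le_of_sum_powr_le_large[OF finite_grid_cells _ H(2)[OF fin] base[OF fin] sQ Q])
        (simp add: H_def)
    also have "\<dots> \<le> C * a powr s" by (intro mult_right_mono) (auto simp: C_eq)
    finally show "(\<Sum>m\<in>grid_cells \<delta> z. H m powr s) \<le> C * a powr s" .
  qed
qed

section \<open>Summation over all unit cells\<close>

lemma suminf_indicator_big_cell_le: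
  fixes e :: "nat \<Rightarrow> 'n::finite \<Rightarrow> int" and y :: "real ^ 'n"
  assumes e: "inj e"
  shows "(\<Sum>k. indicator (big_cell (e k)) y) \<le> (8 ^ CARD('n) :: ennreal)"
proof -
  \<comment> \<open>The enlarged cells have side 7 and are closed; those containing \<open>y\<close>
    have each index in a window of 8 integers.\<close>
  define Z where "Z = PiE UNIV (\<lambda>i. {\<lfloor>y $ i\<rfloor> - 4..\<lfloor>y $ i\<rfloor> + 3})"
  have "z \<in> Z" if "y \<in> big_cell z" for z
  proof -
    have "z i \<in> {\<lfloor>y $ i\<rfloor> - 4..\<lfloor>y $ i\<rfloor> + 3}" for i
    proof -
      have "real_of_int (z i) - 3 \<le> y $ i" "y $ i \<le> real_of_int (z i) + 4"
        using that by (auto simp: big_cell_def mem_box_cart)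
      then show ?thesis by simp linarith
    qed
    then show ?thesis by (auto simp: Z_def)
  qed
  then have sub: "{k. y \<in> big_cell (e k)} \<subseteq> e -` Z" by auto
  have finZ: "finite Z" unfolding Z_def by (intro finite_PiE) auto
  have fin: "finite (e -` Z)" using finZ e by (rule finite_vimageI)
  have "card (e -` Z) \<le> card Z" using card_vimage_inj_on_le[OF e finZ] by simp
  also have "card Z = 8 ^ CARD('n)" by (simp add: Z_def card_PiE)
  finally have card: "card (e -` Z) \<le> 8 ^ CARD('n)" .
  have "(\<Sum>k. indicator (big_cell (e k)) y :: ennreal) = (\<Sum>k\<in>e -` Z. indicator (big_cell (e k)) y)"
    using fin sub by (intro suminf_finite) (auto simp: indicator_def)
  also have "\<dots> \<le> (\<Sum>k\<in>e -` Z. 1)" by (intro sum_mono) (auto simp: indicator_def)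
  also have "\<dots> = of_nat (card (e -` Z))" by simp
  also have "\<dots> \<le> of_nat (8 ^ CARD('n))" using card by (rule of_nat_mono)
  finally show ?thesis by simp
qed

lemma suminf_cell_mass_le:
  fixes e :: "nat \<Rightarrow> 'n::finite \<Rightarrow> int" and \<phi> :: "real ^ 'n \<Rightarrow> ennreal"
  assumes e: "inj e" and \<phi>: "\<phi> \<in> borel_measurable lebesgue"
  shows "(\<Sum>k. cell_mass \<phi> (e k)) \<le> 8 ^ CARD('n) * (\<integral>\<^sup>+y. \<phi> y \<partial>lebesgue)"
proof -
  have "(\<Sum>k. cell_mass \<phi> (e k)) = (\<integral>\<^sup>+y. (\<Sum>k. \<phi> y * indicator (big_cell (e k)) y) \<partial>lebesgue)"
    unfolding cell_mass_def using \<phi> by (intro nn_integral_suminf[symmetric]) auto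
  also have "\<dots> \<le> (\<integral>\<^sup>+y. 8 ^ CARD('n) * \<phi> y \<partial>lebesgue)"
  proof (intro nn_integral_mono)
    fix y
    have "(\<Sum>k. \<phi> y * indicator (big_cell (e k)) y) = \<phi> y * (\<Sum>k. indicator (big_cell (e k)) y)"
      by (rule ennreal_suminf_cmult)
    also have "\<dots> \<le> \<phi> y * 8 ^ CARD('n)"
      by (intro mult_left_mono suminf_indicator_big_cell_le e) simp
    finally show "(\<Sum>k. \<phi> y * indicator (big_cell (e k)) y) \<le> 8 ^ CARD('n) * \<phi> y" by (simp add: mult.commute)
  qed
  also have "\<dots> = 8 ^ CARD('n) * (\<integral>\<^sup>+y. \<phi> y \<partial>lebesgue)"
    using \<phi> by (rule nn_integral_cmult)
  finally show ?thesis .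
qed

text \<open>Each cell mass is at most the total mass \<open>A\<close>, so its power \<open>s\<close>
  is at most \<open>A powr (s - 1)\<close> times the mass itself. With \<open>s = q / p\<close>,
  this is where \<open>p \<le> q\<close> enters.\<close>

lemma suminf_ennpowr_cell_mass_le:
  fixes e :: "nat \<Rightarrow> 'n::finite \<Rightarrow> int" and \<phi> :: "real ^ 'n \<Rightarrow> ennreal"
  assumes e: "inj e" and \<phi>: "\<phi> \<in> borel_measurable lebesgue"
    and fin: "(\<integral>\<^sup>+y. \<phi> y \<partial>lebesgue) < \<infinity>" and s: "s \<ge> 1"
  shows "(\<Sum>k. ennpowr (cell_mass \<phi> (e k)) s) \<le> 8 ^ CARD('n) * ennpowr (\<integral>\<^sup>+y. \<phi> y \<partial>lebesgue) s"
proof -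
  obtain A where A: "(\<integral>\<^sup>+y. \<phi> y \<partial>lebesgue) = ennreal A" "A \<ge> 0"
    using fin by (cases "\<integral>\<^sup>+y. \<phi> y \<partial>lebesgue") auto
  have "ennpowr (cell_mass \<phi> z) s \<le> ennreal (A powr (s - 1)) * cell_mass \<phi> z" for z
  proof -
    have "cell_mass \<phi> z \<le> ennreal A"
      unfolding cell_mass_def A(1)[symmetric] by (intro nn_integral_mono) (auto simp: indicator_def)
    then obtain a where a: "cell_mass \<phi> z = ennreal a" "0 \<le> a" "a \<le> A"
      using A(2) by (cases "cell_mass \<phi> z") (auto simp: top_unique)
    have "a powr s \<le> A powr (s - 1) * a"
    proof (cases "a = 0")
      case False
      then have "a powr s = a powr (s - 1) * a" using a(2) by (simp add: powr_diff)
      also have "\<dots> \<le> A powr (s - 1) * a" using a s by (auto intro!: mult_right_mono powr_mono2)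
      finally show ?thesis .
    qed (use s in simp)
    then show ?thesis using a by (simp add: ennpowr_ennreal ennreal_leI flip: ennreal_mult)
  qed
  then have "(\<Sum>k. ennpowr (cell_mass \<phi> (e k)) s) \<le> (\<Sum>k. ennreal (A powr (s - 1)) * cell_mass \<phi> (e k))"
    by (intro suminf_le) auto
  also have "\<dots> = ennreal (A powr (s - 1)) * (\<Sum>k. cell_mass \<phi> (e k))"
    by (rule ennreal_suminf_cmult)
  also have "\<dots> \<le> ennreal (A powr (s - 1)) * (8 ^ CARD('n) * ennreal A)"
    using suminf_cell_mass_le[OF e \<phi>] A by (intro mult_left_mono) auto
  also have "\<dots> = 8 ^ CARD('n) * (ennreal (A powr (s - 1)) * ennreal A)" by (simp add: ac_simps)
  also have "ennreal (A powr (s - 1)) * ennreal A = ennpowr (ennreal A) s"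
  proof (cases "A = 0")
    case False
    then have "A powr (s - 1) * A = A powr s" using A(2) by (simp add: powr_diff)
    then show ?thesis using A(2) by (simp add: ennpowr_ennreal flip: ennreal_mult)
  qed simp
  finally show ?thesis unfolding A .
qed

definition grid_cube :: "real \<Rightarrow> ('n \<Rightarrow> int) \<Rightarrow> (real ^ 'n) set" where
  "grid_cube \<delta> m = cbox (\<chi> i. \<delta> * of_int (m i)) (\<chi> i. \<delta> * of_int (m i) + \<delta>)"

lemma mem_grid_cube_grid_pt:
  assumes "\<delta> > 0"
  shows "x \<in> grid_cube \<delta> (grid_pt \<delta> x)"
  unfolding grid_cube_def mem_box_cart
proof
  fix i
  show "(\<chi> i. \<delta> * of_int (grid_pt \<delta> x i)) $ i \<le> x $ i \<and>
      x $ i \<le> (\<chi> i. \<delta> * of_int (grid_pt \<delta> x i) + \<delta>) $ i"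
    using floor_scaled[OF assms, of "x $ i"] by (simp add: grid_pt_def)
qed

lemma emeasure_grid_cube:
  assumes "\<delta> > 0"
  shows "emeasure lebesgue (grid_cube \<delta> m :: (real ^ 'n) set) = ennreal (\<delta> ^ CARD('n))"
  unfolding grid_cube_def using assms by (subst emeasure_lebesgue_cbox_cart) auto

text \<open>The maximal function is dominated by a countable combination of indicators of grid
  cubes, which is integrated term by term. Each cube contributes \<open>\<delta> ^ CARD('n)\<close>,
  and the normalisation of the averages contributes the negative power of
  \<open>\<delta>\<close>.\<close>

lemma nn_integral_skeleton_maximal_le:
  fixes f :: "real ^ 'n \<Rightarrow> real" and e :: "nat \<Rightarrow> 'n \<Rightarrow> int"
  assumes e: "bij e" and d: "d + k = CARD('n)" and \<delta>: "0 < \<delta>" "\<delta> < 1"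
    and f: "f \<in> borel_measurable lebesgue" and p: "p \<ge> 1" and q: "q > 0"
  defines "\<phi> \<equiv> \<lambda>y. ennpowr (ennreal \<bar>f y\<bar>) p"
  shows "(\<integral>\<^sup>+x. ennpowr (skeleton_maximal k \<delta> f x) q \<partial>lebesgue) \<le>
     ennreal (2 powr q * real CARD('n) powr (d * q / p) * \<delta> powr (real CARD('n) - d * q / p)) *
     (\<Sum>k. \<Sum>m\<in>grid_cells \<delta> (e k). ennpowr (grid_maximal \<phi> \<delta> d (e k) m) (q / p))"
proof -
  define n where "n = real CARD('n)"
  have n: "n > 0" by (simp add: n_def)
  define K where "K = ennreal (2 powr q * (n / \<delta>) powr (d * q / p))"
  define G where "G z m = ennpowr (grid_maximal \<phi> \<delta> d z m) (q / p)" for z m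
  \<comment> \<open>The term with the unit cell of \<open>x\<close> and the grid point of
    \<open>x\<close> already bounds the left side; all other terms are nonnegative.\<close>
  have pw: "ennpowr (skeleton_maximal k \<delta> f x) q \<le>
     (\<Sum>k. \<Sum>m\<in>grid_cells \<delta> (e k). K * G (e k) m * indicator (grid_cube \<delta> m) x)" for x
  proof -
    define z where "z i = \<lfloor>x $ i\<rfloor>" for i
    have z: "x \<in> unit_cell z" by (auto simp: unit_cell_def z_def)
    obtain k0 where k0: "e k0 = z" using e by (metis bij_pointE)
    have "ennpowr (skeleton_maximal k \<delta> f x) q \<le>
        ennpowr (2 * ennpowr (ennreal ((n / \<delta>) ^ d) * grid_maximal \<phi> \<delta> d z (grid_pt \<delta> x)) (1 / p)) q"
      using skeleton_maximal_le_grid_maximal[OF d z \<delta> f p] q unfolding \<phi>_def n_def by (intro ennpowr_mono) auto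
    also have "\<dots> = ennpowr 2 q * (ennpowr (ennreal ((n / \<delta>) ^ d)) (q / p) * G z (grid_pt \<delta> x))"
      using q p by (simp add: ennpowr_mult ennpowr_ennpowr G_def)
    also have "\<dots> = K * G z (grid_pt \<delta> x)"
    proof -
      have "ennpowr 2 q = ennreal (2 powr q)" using ennpowr_ennreal[of 2 q] by simp
      moreover have "((n / \<delta>) ^ d) powr (q / p) = (n / \<delta>) powr (d * q / p)"
        using n \<delta> by (simp add: powr_powr flip: powr_realpow)
      ultimately show ?thesis
        using n \<delta> by (simp add: ennpowr_ennreal K_def ennreal_mult mult.assoc)
    qed
    also have "\<dots> \<le> (\<Sum>m\<in>grid_cells \<delta> z. K * G z m * indicator (grid_cube \<delta> m) x)"
    proof -
      have "K * G z (grid_pt \<delta> x) = (\<Sum>m\<in>{grid_pt \<delta> x}. K * G z m * indicator (grid_cube \<delta> m) x)"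
        using mem_grid_cube_grid_pt[OF \<delta>(1), of x] by simp
      also have "\<dots> \<le> (\<Sum>m\<in>grid_cells \<delta> z. K * G z m * indicator (grid_cube \<delta> m) x)"
        using grid_pt_in_grid_cells[OF z \<delta>(1)] by (intro sum_mono2 finite_grid_cells) auto
      finally show ?thesis .
    qed
    also have "\<dots> = (\<Sum>k\<in>{k0}. \<Sum>m\<in>grid_cells \<delta> (e k). K * G (e k) m * indicator (grid_cube \<delta> m) x)"
      by (simp add: k0)
    also have "\<dots> \<le> (\<Sum>k. \<Sum>m\<in>grid_cells \<delta> (e k). K * G (e k) m * indicator (grid_cube \<delta> m) x)"
      by (intro sum_le_suminf) auto
    finally show ?thesis .
  qed
  have [measurable]: "grid_cube \<delta> m \<in> sets lebesgue" for m :: "'n \<Rightarrow> int" by (simp add: grid_cube_def)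
  have "(\<integral>\<^sup>+x. ennpowr (skeleton_maximal k \<delta> f x) q \<partial>lebesgue) \<le>
    (\<integral>\<^sup>+x. (\<Sum>k. \<Sum>m\<in>grid_cells \<delta> (e k). K * G (e k) m * indicator (grid_cube \<delta> m) x) \<partial>lebesgue)"
    by (intro nn_integral_mono pw)
  also have "\<dots> = (\<Sum>k. \<integral>\<^sup>+x. (\<Sum>m\<in>grid_cells \<delta> (e k). K * G (e k) m * indicator (grid_cube \<delta> m) x) \<partial>lebesgue)"
    by (intro nn_integral_suminf) measurable
  also have "\<dots> = (\<Sum>k. \<Sum>m\<in>grid_cells \<delta> (e k). K * G (e k) m * ennreal (\<delta> ^ CARD('n)))"
  proof (intro suminf_cong)
    fix k
    have "(\<integral>\<^sup>+x. (\<Sum>m\<in>grid_cells \<delta> (e k). K * G (e k) m * indicator (grid_cube \<delta> m) x) \<partial>lebesgue) =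
      (\<Sum>m\<in>grid_cells \<delta> (e k). \<integral>\<^sup>+x. K * G (e k) m * indicator (grid_cube \<delta> m) x \<partial>lebesgue)"
      by (rule nn_integral_sum) measurable
    also have "\<dots> = (\<Sum>m\<in>grid_cells \<delta> (e k). K * G (e k) m * emeasure lebesgue (grid_cube \<delta> m))"
      by (intro sum.cong refl nn_integral_cmult_indicator) measurable
    finally show "(\<integral>\<^sup>+x. (\<Sum>m\<in>grid_cells \<delta> (e k). K * G (e k) m * indicator (grid_cube \<delta> m) x) \<partial>lebesgue) =
      (\<Sum>m\<in>grid_cells \<delta> (e k). K * G (e k) m * ennreal (\<delta> ^ CARD('n)))"
      unfolding emeasure_grid_cube[OF \<delta>(1)] .
  qed
  also have "\<dots> = (\<Sum>k. K * ennreal (\<delta> ^ CARD('n)) * (\<Sum>m\<in>grid_cells \<delta> (e k). G (e k) m))"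
    by (simp add: sum_distrib_left ac_simps)
  also have "\<dots> = K * ennreal (\<delta> ^ CARD('n)) * (\<Sum>k. \<Sum>m\<in>grid_cells \<delta> (e k). G (e k) m)"
    by (rule ennreal_suminf_cmult)
  also have "K * ennreal (\<delta> ^ CARD('n)) = ennreal (2 powr q * n powr (d * q / p) * \<delta> powr (n - d * q / p))"
  proof -
    have "(n / \<delta>) powr (d * q / p) * \<delta> ^ CARD('n) = n powr (d * q / p) * \<delta> powr (n - d * q / p)"
      using n \<delta> by (simp add: powr_divide powr_diff n_def powr_realpow)
    then show ?thesis using \<delta> by (simp add: K_def mult.assoc flip: ennreal_mult)
  qed
  finally show ?thesis by (simp add: G_def n_def)
qed

text \<open>Passes from a bound on every unit cell, uniform in the cell and in
  \<open>\<phi>\<close>, to the operator norm. The local bounds add up because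
  \<open>s = q / p \<ge> 1\<close>, and the power \<open>1 / q\<close> of the total turns the mass
  of \<open>|f|^p\<close> back into the norm of \<open>f\<close>.\<close>

lemma skeleton_op_norm_le:
  assumes d: "d + k = CARD('n::finite)" and \<delta>: "0 < \<delta>" "\<delta> < 1" and p: "1 \<le> p" "p \<le> q" and K: "K > 0"
    and grid: "\<And>\<phi> (z :: 'n \<Rightarrow> int). \<phi> \<in> borel_measurable lebesgue \<Longrightarrow>
      (\<Sum>m\<in>grid_cells \<delta> z. ennpowr (grid_maximal \<phi> \<delta> d z m) (q / p)) \<le> ennreal K * ennpowr (cell_mass \<phi> z) (q / p)"
  shows "skeleton_op_norm TYPE('n) k \<delta> p q \<le> ennreal ((2 powr q * real CARD('n) powr (d * q / p) * 8 ^ CARD('n) *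
     (\<delta> powr (real CARD('n) - d * q / p) * K)) powr (1 / q))"
  unfolding skeleton_op_norm_def
proof (rule SUP_least)
  fix f :: "real ^ 'n \<Rightarrow> real" assume f: "f \<in> nonzero_Lp p"
  define \<phi> where "\<phi> y = ennpowr (ennreal \<bar>f y\<bar>) p" for y
  define A where "A = (\<integral>\<^sup>+y. \<phi> y \<partial>lebesgue)"
  define c where "c = 2 powr q * real CARD('n) powr (d * q / p) * \<delta> powr (real CARD('n) - d * q / p)"
  have c: "c > 0" using \<delta> by (simp add: c_def)
  have fm: "f \<in> borel_measurable lebesgue" and Lfin: "Lp_norm p (\<lambda>x. ennreal \<bar>f x\<bar>) < \<infinity>"
    and nz: "\<not> (AE x in lebesgue. f x = 0)" using f by (auto simp: nonzero_Lp_def)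
  have \<phi>: "\<phi> \<in> borel_measurable lebesgue" unfolding \<phi>_def using fm by measurable
  have L: "Lp_norm p (\<lambda>x. ennreal \<bar>f x\<bar>) = ennpowr A (1 / p)" by (simp add: Lp_norm_def A_def \<phi>_def)
  then have Afin: "A < \<infinity>" using Lfin by (cases A) auto
  have A0: "A \<noteq> 0"
  proof
    assume "A = 0"
    then have "AE x in lebesgue. \<phi> x = 0" using \<phi> by (simp add: A_def nn_integral_0_iff_AE)
    then have "AE x in lebesgue. f x = 0"
    proof (rule AE_mp, intro AE_I2 impI)
      fix x assume "\<phi> x = 0"
      then show "f x = 0" by (simp add: \<phi>_def ennpowr_ennreal)
    qed
    with nz show False by simp
  qed
  \<comment> \<open>The integer vectors include the constant ones, hence are infinite and can be
    enumerated bijectively by \<open>nat\<close>.\<close>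
  have inf: "infinite (UNIV :: ('n \<Rightarrow> int) set)"
  proof -
    have "inj (\<lambda>(t::int) (_::'n). t)" by (auto simp: inj_on_def fun_eq_iff)
    then show ?thesis using infinite_UNIV_int by (metis finite_subset range_inj_infinite subset_UNIV finite_imageD)
  qed
  define e :: "nat \<Rightarrow> 'n \<Rightarrow> int" where "e = from_nat_into UNIV"
  have e: "bij e" unfolding e_def using bij_betw_from_nat_into[OF _ inf] by simp
  have "(\<integral>\<^sup>+x. ennpowr (skeleton_maximal k \<delta> f x) q \<partial>lebesgue) \<le>
     ennreal c * (\<Sum>k. \<Sum>m\<in>grid_cells \<delta> (e k). ennpowr (grid_maximal \<phi> \<delta> d (e k) m) (q / p))"
    using nn_integral_skeleton_maximal_le[OF e d \<delta> fm p(1), of q] p unfolding \<phi>_def c_def by simp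
  also have "\<dots> \<le> ennreal c * (\<Sum>k. ennreal K * ennpowr (cell_mass \<phi> (e k)) (q / p))"
    by (intro mult_left_mono suminf_le grid \<phi>) auto
  also have "\<dots> = ennreal c * (ennreal K * (\<Sum>k. ennpowr (cell_mass \<phi> (e k)) (q / p)))"
    by simp
  also have "\<dots> \<le> ennreal c * (ennreal K * (8 ^ CARD('n) * ennpowr A (q / p)))"
    using suminf_ennpowr_cell_mass_le[OF bij_is_inj[OF e] \<phi>, of "q / p"] Afin p
    by (intro mult_left_mono) (auto simp: A_def)
  also have "\<dots> = ennreal (8 ^ CARD('n) * c * K) * ennpowr A (q / p)"
    using c K by (simp add: ennreal_mult ac_simps flip: ennreal_power)
  finally have "Lp_norm q (skeleton_maximal k \<delta> f) \<le> ennpowr (ennreal (8 ^ CARD('n) * c * K) * ennpowr A (q / p)) (1 / q)"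
    unfolding Lp_norm_def using p by (intro ennpowr_mono) auto
  also have "\<dots> = ennreal ((8 ^ CARD('n) * c * K) powr (1 / q)) * Lp_norm p (\<lambda>x. ennreal \<bar>f x\<bar>)"
    using p c K by (simp add: ennpowr_mult ennpowr_ennpowr ennpowr_ennreal L)
  finally have "Lp_norm q (skeleton_maximal k \<delta> f) / Lp_norm p (\<lambda>x. ennreal \<bar>f x\<bar>) \<le>
      ennreal ((8 ^ CARD('n) * c * K) powr (1 / q)) * Lp_norm p (\<lambda>x. ennreal \<bar>f x\<bar>) / Lp_norm p (\<lambda>x. ennreal \<bar>f x\<bar>)"
    by (rule divide_right_mono_ennreal)
  also have "\<dots> = ennreal ((8 ^ CARD('n) * c * K) powr (1 / q))"
  proof (rule ennreal_mult_divide_eq)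
    obtain a where "A = ennreal a" "a > 0" using A0 Afin by (cases A) (auto simp: less_le)
    then have "Lp_norm p (\<lambda>x. ennreal \<bar>f x\<bar>) = ennreal (a powr (1 / p))" "a powr (1 / p) > 0"
      by (auto simp: L ennpowr_ennreal)
    then show "Lp_norm p (\<lambda>x. ennreal \<bar>f x\<bar>) \<noteq> 0" by simp
    show "Lp_norm p (\<lambda>x. ennreal \<bar>f x\<bar>) \<noteq> top" using Lfin by simp
  qed
  also have "8 ^ CARD('n) * c * K = 2 powr q * real CARD('n) powr (d * q / p) * 8 ^ CARD('n) *
     (\<delta> powr (real CARD('n) - d * q / p) * K)" by (simp add: c_def)
  finally show "Lp_norm q (skeleton_maximal k \<delta> f) / Lp_norm p (\<lambda>x. ennreal \<bar>f x\<bar>) \<le>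
    ennreal ((2 powr q * real CARD('n) powr (d * q / p) * 8 ^ CARD('n) *
     (\<delta> powr (real CARD('n) - d * q / p) * K)) powr (1 / q))" .
qed

section \<open>The upper bound in the two ranges of \<open>q\<close>\<close>

lemma skeleton_op_norm_upper:
  assumes k: "k < CARD('n::finite)" and p: "1 \<le> p" "p \<le> q"
  shows "q \<le> q_star CARD('n) k * p \<Longrightarrow> \<exists>C>0. \<forall>\<delta>\<in>{0<..<1}. skeleton_op_norm TYPE('n) k \<delta> p q
      \<le> ennreal (C * \<delta> powr ((real k - real CARD('n)) / (2 * real CARD('n) * p)))"
    and "q > q_star CARD('n) k * p \<Longrightarrow> \<exists>C>0. \<forall>\<delta>\<in>{0<..<1}. skeleton_op_norm TYPE('n) k \<delta> p q
      \<le> ennreal (C * \<delta> powr (real CARD('n) / q - (real CARD('n) - real k) / p))"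
proof -
  define n where "n = real CARD('n)"
  have n: "n \<ge> 1" by (simp add: n_def Suc_le_eq)
  define d where "d = CARD('n) - k"
  have d: "d + k = CARD('n)" "1 \<le> d" "d \<le> CARD('n)" "real d = n - real k" using k by (auto simp: d_def n_def)
  define Q where "Q = 2 * (real CARD('n))\<^sup>2 / (d * (2 * real CARD('n) - 1))"
  have Qs: "Q = q_star CARD('n) k" by (simp add: Q_def q_star_def d(4) n_def)
  define C where "C = 3 ^ CARD('n) + (real CARD('n) + 1) * (7 ^ d) powr Q"
  have C: "C > 0" by (simp add: C_def add_pos_nonneg)
  define s where "s = q / p"
  have s: "s > 0" using p by (simp add: s_def)
  define B where "B = 2 powr q * real CARD('n) powr (d * q / p) * 8 ^ CARD('n)"
  have B: "B > 0" by (simp add: B_def)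
  \<comment> \<open>In the lower range the powers of \<open>q\<close> cancel: since
    \<open>n / Q = d - d / (2 * n)\<close>, the exponent becomes
    \<open>(n / Q - d) / p = - d / (2 * n * p)\<close>.\<close>
  have exp1: "(n - d * q / p + (n * s / Q - n)) / q = (real k - n) / (2 * n * p)"
  proof -
    have "n / Q = d * (2 * n - 1) / (2 * n)"
      using n d by (simp add: Q_def n_def[symmetric] power2_eq_square)
    then have "n / Q - d = - d / (2 * n)" using n by (simp add: field_simps)
    moreover have "(n - d * q / p + (n * s / Q - n)) / q = (n / Q - d) / p"
      using p by (simp add: s_def field_simps)
    ultimately show ?thesis by (simp add: d(4))
  qed
  show "\<exists>C>0. \<forall>\<delta>\<in>{0<..<1}. skeleton_op_norm TYPE('n) k \<delta> p q
      \<le> ennreal (C * \<delta> powr ((real k - real CARD('n)) / (2 * real CARD('n) * p)))"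
    if "q \<le> q_star CARD('n) k * p"
  proof (intro exI[of _ "(B * C) powr (1 / q)"] conjI ballI)
    fix \<delta> :: real assume "\<delta> \<in> {0<..<1}"
    then have \<delta>: "0 < \<delta>" "\<delta> < 1" by auto
    have sQ: "s \<le> Q" using that p by (simp add: Qs s_def field_simps)
    have "skeleton_op_norm TYPE('n) k \<delta> p q \<le> ennreal ((B * (\<delta> powr (n - d * q / p) * (C * \<delta> powr (n * s / Q - n)))) powr (1 / q))"
      unfolding B_def n_def
      by (rule skeleton_op_norm_le[OF d(1) \<delta> p])
        (use C \<delta> sum_ennpowr_grid_maximal_le(1)[OF d(2,3) s _ \<delta> sQ[unfolded Q_def]] in \<open>auto simp: C_def s_def Q_def\<close>)
    also have "B * (\<delta> powr (n - d * q / p) * (C * \<delta> powr (n * s / Q - n))) =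
        B * C * \<delta> powr (n - d * q / p + (n * s / Q - n))"
      by (simp only: powr_add) (simp add: ac_simps)
    also have "\<dots> powr (1 / q) = (B * C) powr (1 / q) * \<delta> powr ((real k - n) / (2 * n * p))"
      using B C \<delta> by (simp add: powr_mult powr_powr flip: exp1)
    finally show "skeleton_op_norm TYPE('n) k \<delta> p q \<le>
      ennreal ((B * C) powr (1 / q) * \<delta> powr ((real k - real CARD('n)) / (2 * real CARD('n) * p)))"
      by (simp add: n_def)
  qed (use B C in simp)
  show "\<exists>C>0. \<forall>\<delta>\<in>{0<..<1}. skeleton_op_norm TYPE('n) k \<delta> p q
      \<le> ennreal (C * \<delta> powr (real CARD('n) / q - (real CARD('n) - real k) / p))"
    if "q > q_star CARD('n) k * p"
  proof (intro exI[of _ "(B * C) powr (1 / q)"] conjI ballI)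
    fix \<delta> :: real assume "\<delta> \<in> {0<..<1}"
    then have \<delta>: "0 < \<delta>" "\<delta> < 1" by auto
    have sQ: "Q \<le> s" using that p by (simp add: Qs s_def field_simps)
    have "skeleton_op_norm TYPE('n) k \<delta> p q \<le> ennreal ((B * (\<delta> powr (n - d * q / p) * C)) powr (1 / q))"
      unfolding B_def n_def
      by (rule skeleton_op_norm_le[OF d(1) \<delta> p C])
        (use sum_ennpowr_grid_maximal_le(2)[OF d(2,3) s _ \<delta> sQ[unfolded Q_def]] in \<open>auto simp: C_def s_def Q_def\<close>)
    also have "B * (\<delta> powr (n - d * q / p) * C) = B * C * \<delta> powr (n - d * q / p)"
      by (simp add: ac_simps)
    also have "\<dots> powr (1 / q) = (B * C) powr (1 / q) * \<delta> powr ((n - d * q / p) / q)"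
      using B C \<delta> by (simp add: powr_mult powr_powr)
    also have "(n - d * q / p) / q = n / q - (n - real k) / p"
      using p by (simp add: d(4) diff_divide_distrib)
    finally show "skeleton_op_norm TYPE('n) k \<delta> p q \<le>
      ennreal ((B * C) powr (1 / q) * \<delta> powr (real CARD('n) / q - (real CARD('n) - real k) / p))"
      by (simp add: n_def)
  qed (use B C in simp)
qed

theorem theorem1p2:
  fixes k n :: nat and p q :: real
  assumes n_def: "n = CARD('n::finite)"
    and k_less: "k < n"
    and p_gt: "1 < p"
    and p_le: "p \<le> q"
  shows
    "(q \<le> q_star n k * p \<longrightarrow>
       (\<exists>C>0. \<forall>\<epsilon>>0. \<exists>C'>0. \<forall>\<delta>\<in>{0<..<1}.
          ennreal (C' * \<delta> powr ((real k - real n) / (2 * real n * p) + \<epsilon>))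
            \<le> skeleton_op_norm TYPE('n) k \<delta> p q \<and>
          skeleton_op_norm TYPE('n) k \<delta> p q
            \<le> ennreal (C * \<delta> powr ((real k - real n) / (2 * real n * p))))) \<and>
     (q > q_star n k * p \<longrightarrow>
       (\<exists>c>0. \<exists>c'>0. \<forall>\<delta>\<in>{0<..<1}.
          ennreal (c' * \<delta> powr (real n / q - (real n - real k) / p))
            \<le> skeleton_op_norm TYPE('n) k \<delta> p q \<and>
          skeleton_op_norm TYPE('n) k \<delta> p q
            \<le> ennreal (c * \<delta> powr (real n / q - (real n - real k) / p))))"
proof (intro conjI impI)
  have k: "k < CARD('n)" using k_less by (simp only: n_def)
  have p: "1 \<le> p" "p > 0" "q > 0" using p_gt p_le by simp_all
  note upper = skeleton_op_norm_upper[OF k p(1) p_le, folded n_def]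
  note lattice = skeleton_op_norm_lower_lattice[OF k p(2,3), folded n_def]
  note ball = skeleton_op_norm_lower_ball[OF k p(2,3), folded n_def]
  show "\<exists>C>0. \<forall>\<epsilon>>0. \<exists>C'>0. \<forall>\<delta>\<in>{0<..<1}.
          ennreal (C' * \<delta> powr ((real k - real n) / (2 * real n * p) + \<epsilon>)) \<le> skeleton_op_norm TYPE('n) k \<delta> p q \<and>
          skeleton_op_norm TYPE('n) k \<delta> p q \<le> ennreal (C * \<delta> powr ((real k - real n) / (2 * real n * p)))"
    if small: "q \<le> q_star n k * p"
  proof -
    let ?a = "(real k - real n) / (2 * real n * p)"
    obtain C where C: "C > 0" "\<forall>\<delta>\<in>{0<..<1}. skeleton_op_norm TYPE('n) k \<delta> p q \<le> ennreal (C * \<delta> powr ?a)"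
      using upper(1)[OF small] by blast
    obtain c where c: "c > 0" "\<forall>\<delta>\<in>{0<..<1}. ennreal (c * \<delta> powr ?a) \<le> skeleton_op_norm TYPE('n) k \<delta> p q"
      using lattice by blast
    \<comment> \<open>The lattice construction loses nothing in the exponent. As
      \<open>\<delta> < 1\<close>, the extra \<open>\<epsilon>\<close> only weakens the bound, so
      one constant \<open>c\<close> serves every \<open>\<epsilon>\<close>.\<close>
    have "ennreal (c * \<delta> powr (?a + \<epsilon>)) \<le> skeleton_op_norm TYPE('n) k \<delta> p q"
      if "\<epsilon> > 0" and \<delta>: "\<delta> \<in> {0<..<1}" for \<epsilon> \<delta>
    proof -
      have "\<delta> powr (?a + \<epsilon>) \<le> \<delta> powr ?a" using that by (intro powr_mono') auto
      then have "ennreal (c * \<delta> powr (?a + \<epsilon>)) \<le> ennreal (c * \<delta> powr ?a)"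
        using c(1) by (intro ennreal_leI mult_left_mono) auto
      also have "\<dots> \<le> skeleton_op_norm TYPE('n) k \<delta> p q" using c(2) \<delta> by blast
      finally show ?thesis .
    qed
    then show ?thesis using C c(1) by blast
  qed
  show "\<exists>c>0. \<exists>c'>0. \<forall>\<delta>\<in>{0<..<1}.
          ennreal (c' * \<delta> powr (real n / q - (real n - real k) / p)) \<le> skeleton_op_norm TYPE('n) k \<delta> p q \<and>
          skeleton_op_norm TYPE('n) k \<delta> p q \<le> ennreal (c * \<delta> powr (real n / q - (real n - real k) / p))"
    if "q > q_star n k * p"
    using upper(2)[OF that] ball by blast
qed

end
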